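(* Let $g$ be a simple godron, with cr-invariant $\rho=\rho(g)$, of a smooth surface $S$ in real $3$-space, where $\rho\notin\{-\tfrac12,0,\tfrac12,\tfrac23,1\}$. There are six possible configurations at $g$ of the flecnodal curve $F$, the parabolic curve $P$ and the conodal curve $D$ with respect to the separating $2$-jet and to the asymptotic line at $g$; that is, six possible orderings on the real line of the canonical coefficients $c_F,c_P,c_D$ of these curves relative to the numbers $1$ (separating $2$-jet) and $0$ (asymptotic line). The actual configuration is determined by which of the following six open intervals contains $\rho$: $$\begin{array}{ccc} \rho\in(1,\infty) & \iff & 1<c_D<c_P<c_F;\\ \rho\in(\frac23,1) & \iff & 0<c_P<c_F<c_D<1;\\ \rho\in(\frac12,\frac23) & \iff & c_P<0<c_F<c_D<1;\\ \rho\in(0,\frac12) & \iff & c_P<c_F<0<c_D<1;\\ \rho\in(-\frac12,0) & \iff & c_P<c_D<0<c_F<1;\\ \rho\in(-\infty,-\frac12) & \iff & c_P<c_D<0<1<c_F. \end{array}$$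
   Context: The ambient space is $\mathbb{R}^3$ or $\mathbb{RP}^3$. The elliptic domain of $S$ is the open set of points at which no real tangent line has more than $2$-point contact with $S$; the hyperbolic domain is the open set of points at which exactly two tangent lines (asymptotic lines) have more than $2$-point contact; the parabolic curve $P$ is the smooth curve, separating these domains, of points with a unique (double) asymptotic line. A godron is a parabolic point at which the unique asymptotic direction is tangent to $P$. The tangential map $\tau_S:S\to(\mathbb{RP}^3)^\vee$ sends each point to the tangent plane of $S$ there; its image $S^\vee$ is the dual surface. A godron $g$ is simple if $\tau_S(g)$ is a swallowtail point ($A_3$ Legendre singularity) of $S^\vee$. The flecnodal curve $F$ is formed by the points of the closure of the hyperbolic domain at which an asymptotic line has more than $3$-point contact with $S$. The conodal curve $D$ is the closure of the set of points of contact of $S$ with its bitangent planes (planes tangent to $S$ at at least two distinct points). At a simple godron $g$ the curves $F,P,D$ are smooth and mutually tangent. cr-invariant: in the contact $3$-manifold $PT^*S$ of contact elements of $S$, let $L_F,L_P,L_D$ be the Legendrian curves of contact elements tangent to $F,P,D$, and $L_g$ the fibre over $g$. All four are tangent to one contact plane $\Pi$ at a common point, and their tangent lines there are $\ell_F,\ell_P,\ell_D,\ell_g\subset\Pi$. The cr-invariant is the cross-ratio $\rho(g)=(\ell_F,\ell_P,\ell_D,\ell_g)$, with the convention $(a,b,c,d)=\frac{(a-c)(b-d)}{(b-c)(a-d)}$ (so it equals $\frac{a-c}{b-c}$ when $d=\infty$). Canonical coefficients: by a projective transformation the surface is put near $g$ (at the origin) in the normal form $z=\frac{y^2}{2}-x^2y+\frac{\rho}{2}x^4+\varphi(x,y)$,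 where $\varphi$ consists of terms of degree greater than $4$ (and possibly flat functions). The projections of $F,P,D$ to the $(x,y)$-plane along the $z$-axis have $2$-jets at the origin $y=c_Fx^2$, $y=c_Px^2$, $y=c_Dx^2$; these numbers are the canonical coefficients. In these coordinates the asymptotic line at $g$ is $y=0$ and the separating $2$-jet at $g$ is $y=x^2$. (The separating $2$-jet is the unique $2$-jet $\sigma$ of curves of $S$ tangent to $P$ at $g$ such that the images under $\tau_S$ of all other such $2$-jets are cusps with one common tangent line at $\tau_S(g)$, pointing in opposite directions for $2$-jets on opposite sides of $\sigma$.) *)

theory Defs
  imports "HOL-Analysis.Analysis"
begin

section \<open>Smooth maps and smooth curves\<close>

text \<open>Iterated directional derivatives; on an open set \<open>U\<close>, \<open>smooth_on U f\<close> says that all of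
  them exist and are differentiable, i.e. that \<open>f\<close> is of class $C^\infty$ on \<open>U\<close>.\<close>

fun dir_deriv ::
  "'a::real_normed_vector list \<Rightarrow> ('a \<Rightarrow> 'b::real_normed_vector) \<Rightarrow> 'a \<Rightarrow> 'b" where
  "dir_deriv [] f = f"
| "dir_deriv (v # vs) f = (\<lambda>x. frechet_derivative (dir_deriv vs f) (at x) v)"

definition smooth_on ::
  "'a::real_normed_vector set \<Rightarrow> ('a \<Rightarrow> 'b::real_normed_vector) \<Rightarrow> bool" where
  "smooth_on U f \<longleftrightarrow> (\<forall>vs. dir_deriv vs f differentiable_on U)"

text \<open>Near \<open>p\<close> the set \<open>C\<close> is a smooth (regular, embedded) curve, and \<open>w\<close> is a nonzero tangent
  vector of this curve at \<open>p\<close>.\<close>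

definition curve_tangent :: "'a::euclidean_space set \<Rightarrow> 'a \<Rightarrow> 'a \<Rightarrow> bool" where
  "curve_tangent C p w \<longleftrightarrow>
     (\<exists>\<gamma> \<epsilon> W \<eta>. 0 < \<epsilon> \<and> open W \<and>
        smooth_on {-\<epsilon><..<\<epsilon>::real} \<gamma> \<and>
        (\<forall>t\<in>{-\<epsilon><..<\<epsilon>}. vector_derivative \<gamma> (at t) \<noteq> 0) \<and>
        homeomorphism {-\<epsilon><..<\<epsilon>} (C \<inter> W) \<gamma> \<eta> \<and>
        \<gamma> 0 = p \<and> vector_derivative \<gamma> (at 0) = w)"


section \<open>Real projective 3-space\<close>

text \<open>Points are the one-dimensional subspaces of \<open>\<real>\<^sup>4\<close>. Affine 3-space is the open subset of the
  points \<open>[x : y : z : 1]\<close>, so surfaces in affine space are included. The dual space is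
  identified with the same type: the point with homogeneous coordinates \<open>\<xi>\<close> stands for the plane
  consisting of the points \<open>[v]\<close> with \<open>\<xi> \<bullet> v = 0\<close>.\<close>

typedef rp3 = "{L :: (real^4) set. subspace L \<and> dim L = 1}"
proof -
  have "dim (span {axis 1 1 :: real^4}) = 1"
    unfolding dim_span by (subst dim_singleton) (simp add: axis_eq_0_iff)
  then show ?thesis
    by (intro exI[of _ "span {axis 1 1 :: real^4}"]) simp
qed

definition proj :: "real^4 \<Rightarrow> rp3" where
  "proj v = Abs_rp3 (span {v})"

instantiation rp3 :: topological_space
begin

definition open_rp3 :: "rp3 set \<Rightarrow> bool" where
  "open_rp3 U \<longleftrightarrow> open {v. v \<noteq> 0 \<and> proj v \<in> U}"

instance
proof
  have "{v::real^4. v \<noteq> 0 \<and> proj v \<in> UNIV} = - {0}"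
    by auto
  then show "open (UNIV :: rp3 set)"
    by (simp add: open_rp3_def open_Compl)
next
  fix S T :: "rp3 set"
  assume "open S" "open T"
  moreover have "{v. v \<noteq> 0 \<and> proj v \<in> S \<inter> T} =
      {v. v \<noteq> 0 \<and> proj v \<in> S} \<inter> {v. v \<noteq> 0 \<and> proj v \<in> T}"
    by auto
  ultimately show "open (S \<inter> T)"
    by (simp add: open_rp3_def open_Int)
next
  fix K :: "rp3 set set"
  assume "\<forall>S\<in>K. open S"
  moreover have "{v. v \<noteq> 0 \<and> proj v \<in> \<Union>K} = (\<Union>S\<in>K. {v. v \<noteq> 0 \<and> proj v \<in> S})"
    by auto
  ultimately show "open (\<Union>K)"
    by (simp add: open_rp3_def open_UN)
qed

end

text \<open>Projective coordinates: for invertible \<open>B\<close>, the affine coordinates \<open>(x, y, z)\<close> in the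
  projective frame \<open>B\<close>. Applying a projective transformation to a surface amounts to describing
  it in such a frame.\<close>

definition affine_pt :: "real^4^4 \<Rightarrow> real \<times> real \<times> real \<Rightarrow> rp3" where
  "affine_pt B = (\<lambda>(x, y, z). proj (B *v vector [x, y, z, 1]))"


section \<open>Surfaces, contact with lines\<close>

text \<open>A regular equation, near \<open>v\<close>, of the cone in \<open>\<real>\<^sup>4\<close> over \<open>S\<close>. It need not be homogeneous.\<close>

definition local_equation ::
  "rp3 set \<Rightarrow> real^4 \<Rightarrow> (real^4) set \<Rightarrow> (real^4 \<Rightarrow> real) \<Rightarrow> bool" where
  "local_equation S v W F \<longleftrightarrow>
     open W \<and> v \<in> W \<and> 0 \<notin> W \<and> smooth_on W F \<and>
     (\<forall>w\<in>W. (proj w \<in> S \<longleftrightarrow> F w = 0) \<and> frechet_derivative F (at w) \<noteq> (\<lambda>_. 0))"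

definition smooth_surface :: "rp3 set \<Rightarrow> bool" where
  "smooth_surface S \<longleftrightarrow> (\<forall>v. v \<noteq> 0 \<and> proj v \<in> S \<longrightarrow> (\<exists>W F. local_equation S v W F))"

text \<open>The projective line given by the plane \<open>L\<close> of \<open>\<real>\<^sup>4\<close> passes through \<open>p\<close> and has at least
  \<open>k\<close>-point contact with \<open>S\<close> there: the equation of \<open>S\<close> restricted to the line has a zero of
  multiplicity at least \<open>k\<close>.\<close>

definition has_contact :: "nat \<Rightarrow> rp3 set \<Rightarrow> rp3 \<Rightarrow> (real^4) set \<Rightarrow> bool" where
  "has_contact k S p L \<longleftrightarrow>
     (\<exists>v w W F. v \<noteq> 0 \<and> p = proj v \<and> L = span {v, w} \<and> dim L = 2 \<and>
        local_equation S v W F \<and>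
        (\<forall>j<k. (deriv ^^ j) (\<lambda>t. F (v + t *\<^sub>R w)) 0 = 0))"

definition asymptotic_lines :: "rp3 set \<Rightarrow> rp3 \<Rightarrow> (real^4) set set" where
  "asymptotic_lines S p = {L. has_contact 3 S p L}"

definition hyperbolic_domain :: "rp3 set \<Rightarrow> rp3 set" where
  "hyperbolic_domain S = {p\<in>S. card (asymptotic_lines S p) = 2}"

definition parabolic_curve :: "rp3 set \<Rightarrow> rp3 set" where
  "parabolic_curve S = {p\<in>S. \<exists>!L. L \<in> asymptotic_lines S p}"

definition flecnodal_curve :: "rp3 set \<Rightarrow> rp3 set" where
  "flecnodal_curve S = {p\<in>S. p \<in> closure (hyperbolic_domain S) \<and> (\<exists>L. has_contact 4 S p L)}"


section \<open>Tangential map and conodal curve\<close>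

definition tangential_map :: "rp3 set \<Rightarrow> rp3 \<Rightarrow> rp3" where
  "tangential_map S p =
     (THE q. \<exists>v W F \<xi>. v \<noteq> 0 \<and> p = proj v \<and> local_equation S v W F \<and>
        (F has_derivative (\<lambda>h. \<xi> \<bullet> h)) (at v) \<and> q = proj \<xi>)"

definition conodal_curve :: "rp3 set \<Rightarrow> rp3 set" where
  "conodal_curve S =
     S \<inter> closure {p\<in>S. \<exists>q\<in>S. q \<noteq> p \<and> tangential_map S q = tangential_map S p}"

text \<open>Bitangency is not a local condition on \<open>S\<close>. The conodal curve at \<open>g\<close> is understood as a germ:
  a property of it is required of the conodal curves of all sufficiently small neighbourhoods
  of \<open>g\<close> in \<open>S\<close>. This discards planes tangent at points near \<open>g\<close> and at points far from \<open>g\<close>.\<close>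

definition germ_conodal :: "rp3 set \<Rightarrow> rp3 \<Rightarrow> (rp3 set \<Rightarrow> bool) \<Rightarrow> bool" where
  "germ_conodal S g Q \<longleftrightarrow>
     (\<exists>W\<^sub>0. open W\<^sub>0 \<and> g \<in> W\<^sub>0 \<and>
        (\<forall>W. open W \<and> g \<in> W \<and> W \<subseteq> W\<^sub>0 \<longrightarrow> Q (conodal_curve (S \<inter> W))))"


section \<open>Simple godrons\<close>

text \<open>A smooth local parametrisation of \<open>S\<close> at \<open>g\<close>, lifted to homogeneous coordinates. The
  condition on \<open>dim\<close> says that the induced map into projective space is an immersion.\<close>

definition surface_param ::
  "rp3 set \<Rightarrow> rp3 \<Rightarrow> (real \<times> real) set \<Rightarrow> (real \<times> real \<Rightarrow> real^4) \<Rightarrow> bool" where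
  "surface_param S g U \<sigma> \<longleftrightarrow>
     open U \<and> (0, 0) \<in> U \<and> smooth_on U \<sigma> \<and> proj (\<sigma> (0, 0)) = g \<and>
     (\<forall>q\<in>U. dim {\<sigma> q, frechet_derivative \<sigma> (at q) (1, 0),
                      frechet_derivative \<sigma> (at q) (0, 1)} = 3) \<and>
     (\<exists>W \<tau>. open W \<and> homeomorphism U (S \<inter> W) (\<lambda>q. proj (\<sigma> q)) \<tau>)"

definition pull :: "(real \<times> real) set \<Rightarrow> (real \<times> real \<Rightarrow> real^4) \<Rightarrow> rp3 set \<Rightarrow> (real \<times> real) set"
  where "pull U \<sigma> C = {q\<in>U. proj (\<sigma> q) \<in> C}"

text \<open>A parabolic point at which the parabolic curve is smooth and tangent to the unique
  asymptotic line.\<close>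

definition godron :: "rp3 set \<Rightarrow> rp3 \<Rightarrow> bool" where
  "godron S g \<longleftrightarrow>
     g \<in> parabolic_curve S \<and>
     (\<exists>U \<sigma> w. surface_param S g U \<sigma> \<and>
        curve_tangent (pull U \<sigma> (parabolic_curve S)) (0, 0) w \<and>
        span {\<sigma> (0, 0), frechet_derivative \<sigma> (at (0, 0)) w} \<in> asymptotic_lines S g)"

text \<open>The double roots \<open>v\<close> of \<open>t\<^sup>4 + u t\<^sup>2 - b t + c\<close> parametrise the standard swallowtail.\<close>

definition std_swallowtail :: "real \<times> real \<Rightarrow> real \<times> real \<times> real" where
  "std_swallowtail = (\<lambda>(u, v). (u, 4 * v^3 + 2 * u * v, 3 * v^4 + u * v^2))"

text \<open>The tangential map germ at \<open>g\<close> is left-right equivalent to the standard swallowtail: \<open>\<sigma>\<close> is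
  the change of coordinates in the source, \<open>\<Phi>\<close> (a lift to homogeneous coordinates of a local
  diffeomorphism into the dual space) the one in the target.\<close>

definition dual_swallowtail :: "rp3 set \<Rightarrow> rp3 \<Rightarrow> bool" where
  "dual_swallowtail S g \<longleftrightarrow>
     (\<exists>U \<sigma> V \<Phi>. surface_param S g U \<sigma> \<and>
        open V \<and> (0, 0, 0) \<in> V \<and> smooth_on V \<Phi> \<and>
        dim {\<Phi> (0, 0, 0), frechet_derivative \<Phi> (at (0, 0, 0)) (1, 0, 0),
             frechet_derivative \<Phi> (at (0, 0, 0)) (0, 1, 0),
             frechet_derivative \<Phi> (at (0, 0, 0)) (0, 0, 1)} = 4 \<and>
        (\<forall>q\<in>U. std_swallowtail q \<in> V \<and>
           tangential_map S (proj (\<sigma> q)) = proj (\<Phi> (std_swallowtail q))))"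

definition simple_godron :: "rp3 set \<Rightarrow> rp3 \<Rightarrow> bool" where
  "simple_godron S g \<longleftrightarrow> godron S g \<and> dual_swallowtail S g"


section \<open>The cr-invariant\<close>

text \<open>A parametrisation by \<open>(u, v)\<close> gives coordinates \<open>(u, v, m)\<close> on the manifold of contact elements
  of \<open>S\<close>: \<open>m\<close> is the slope \<open>dv/du\<close> of a contact element not parallel to the \<open>v\<close>-axis. The contact
  structure is \<open>dv = m du\<close>.\<close>

definition contact_plane :: "real \<times> real \<times> real \<Rightarrow> (real \<times> real \<times> real) set" where
  "contact_plane = (\<lambda>(u, v, m). {(a, b, c). b = m * a})"

definition legendrian_lift :: "(real \<times> real) set \<Rightarrow> (real \<times> real \<times> real) set" where
  "legendrian_lift C = {(u, v, m). curve_tangent C (u, v) (1, m)}"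

definition fibre :: "real \<times> real \<Rightarrow> (real \<times> real \<times> real) set" where
  "fibre = (\<lambda>(u, v). {(u, v, m) |m. True})"

definition det2 :: "real \<times> real \<Rightarrow> real \<times> real \<Rightarrow> real" where
  "det2 = (\<lambda>(p, q) (r, s). p * s - r * q)"

text \<open>Cross-ratio of four lines through the origin of a plane \<open>E\<close>, where the line spanned by
  \<open>p e + q f\<close> has the affine coordinate \<open>p / q\<close>: this is \<open>(a - c)(b - d) / ((b - c)(a - d))\<close> in
  homogeneous form, so that a line with coordinate \<open>\<infinity>\<close> is allowed.\<close>

definition has_cross_ratio ::
  "'a::real_vector set \<Rightarrow> 'a set \<Rightarrow> 'a set \<Rightarrow> 'a set \<Rightarrow> 'a set \<Rightarrow> real \<Rightarrow> bool" where
  "has_cross_ratio E la lb lc ld \<rho> \<longleftrightarrow>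
     (\<exists>e f a b c d. E = span {e, f} \<and> e \<noteq> f \<and> independent {e, f} \<and>
        la = span {fst a *\<^sub>R e + snd a *\<^sub>R f} \<and> lb = span {fst b *\<^sub>R e + snd b *\<^sub>R f} \<and>
        lc = span {fst c *\<^sub>R e + snd c *\<^sub>R f} \<and> ld = span {fst d *\<^sub>R e + snd d *\<^sub>R f} \<and>
        a \<noteq> 0 \<and> b \<noteq> 0 \<and> c \<noteq> 0 \<and> d \<noteq> 0 \<and> det2 b c \<noteq> 0 \<and> det2 a d \<noteq> 0 \<and>
        \<rho> = (det2 a c * det2 b d) / (det2 b c * det2 a d))"

definition is_cr_invariant :: "rp3 set \<Rightarrow> rp3 \<Rightarrow> real \<Rightarrow> bool" where
  "is_cr_invariant S g \<rho> \<longleftrightarrow>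
     (\<exists>U \<sigma> m w\<^sub>F w\<^sub>P w\<^sub>D w\<^sub>g. surface_param S g U \<sigma> \<and>
        curve_tangent (legendrian_lift (pull U \<sigma> (flecnodal_curve S))) (0, 0, m) w\<^sub>F \<and>
        curve_tangent (legendrian_lift (pull U \<sigma> (parabolic_curve S))) (0, 0, m) w\<^sub>P \<and>
        germ_conodal S g (\<lambda>D. curve_tangent (legendrian_lift (pull U \<sigma> D)) (0, 0, m) w\<^sub>D) \<and>
        curve_tangent (fibre (0, 0)) (0, 0, m) w\<^sub>g \<and>
        has_cross_ratio (contact_plane (0, 0, m))
          (span {w\<^sub>F}) (span {w\<^sub>P}) (span {w\<^sub>D}) (span {w\<^sub>g}) \<rho>)"


section \<open>Normal form and canonical coefficients\<close>

definition normal_form_fun :: "real \<Rightarrow> (real \<times> real \<Rightarrow> real) \<Rightarrow> real \<times> real \<Rightarrow> real" where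
  "normal_form_fun r \<phi> = (\<lambda>(x, y). y^2 / 2 - x^2 * y + r / 2 * x^4 + \<phi> (x, y))"

text \<open>In the frame \<open>B\<close> the point \<open>g\<close> is the origin and \<open>S\<close> is near \<open>g\<close> the graph of the function
  \<open>normal_form_fun r \<phi>\<close>, where the 4-jet of \<open>\<phi>\<close> at the origin vanishes. The quartic coefficient \<open>r\<close>
  is not assumed to be related to the cr-invariant.\<close>

definition normal_form ::
  "rp3 set \<Rightarrow> rp3 \<Rightarrow> real^4^4 \<Rightarrow> real \<Rightarrow> (real \<times> real \<Rightarrow> real) \<Rightarrow> bool" where
  "normal_form S g B r \<phi> \<longleftrightarrow>
     invertible B \<and> affine_pt B (0, 0, 0) = g \<and>
     (\<exists>U. open U \<and> (0, 0) \<in> U \<and> smooth_on U \<phi>) \<and>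
     (\<forall>vs. length vs \<le> 4 \<longrightarrow> dir_deriv vs \<phi> (0, 0) = 0) \<and>
     (\<exists>V. open V \<and> (0, 0, 0) \<in> V \<and>
        (\<forall>(x, y, z)\<in>V. affine_pt B (x, y, z) \<in> S \<longleftrightarrow> z = normal_form_fun r \<phi> (x, y)))"

text \<open>For a subset \<open>C\<close> of the graph of \<open>f\<close> in the frame \<open>B\<close>: near the origin, the projection of \<open>C\<close>
  along the \<open>z\<close>-axis is a smooth curve \<open>y = h(x)\<close> with 2-jet \<open>y = c x\<^sup>2\<close>.\<close>

definition has_2jet ::
  "real^4^4 \<Rightarrow> (real \<times> real \<Rightarrow> real) \<Rightarrow> rp3 set \<Rightarrow> real \<Rightarrow> bool" where
  "has_2jet B f C c \<longleftrightarrow>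
     (\<exists>h \<epsilon>. 0 < \<epsilon> \<and> smooth_on {-\<epsilon><..<\<epsilon>} h \<and>
        (\<forall>x\<in>{-\<epsilon><..<\<epsilon>}. \<forall>y\<in>{-\<epsilon><..<\<epsilon>}. affine_pt B (x, y, f (x, y)) \<in> C \<longleftrightarrow> y = h x) \<and>
        h 0 = 0 \<and> deriv h 0 = 0 \<and> deriv (deriv h) 0 = 2 * c)"

definition canonical_coefficients :: "rp3 set \<Rightarrow> rp3 \<Rightarrow> real \<Rightarrow> real \<Rightarrow> real \<Rightarrow> bool" where
  "canonical_coefficients S g c\<^sub>F c\<^sub>P c\<^sub>D \<longleftrightarrow>
     (\<exists>B r \<phi>. normal_form S g B r \<phi> \<and>
        has_2jet B (normal_form_fun r \<phi>) (flecnodal_curve S) c\<^sub>F \<and>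
        has_2jet B (normal_form_fun r \<phi>) (parabolic_curve S) c\<^sub>P \<and>
        germ_conodal S g (\<lambda>D. has_2jet B (normal_form_fun r \<phi>) D c\<^sub>D))"

end

theory Submission
  imports Defs
begin

text \<open>In the normal form with quartic coefficient \<open>r\<close>, a point \<open>(x, y)\<close> is parabolic when the
  discriminant of the second fundamental form vanishes, flecnodal when the second and third
  derivatives in a direction \<open>(1, m)\<close> vanish, and conodal when it shares its tangent plane with
  a second point, asymptotically \<open>(- x, y)\<close>. To second order in \<open>x\<close> this gives the coefficients
  \<open>3 r - 2\<close>, \<open>2 r\<^sup>2 - r\<close> and, if \<open>r \<noteq> 1\<close>, \<open>r\<close>. The slopes of the Legendrian lifts in any
  parametrisation are a common affine function of these coefficients, so their cross-ratio is
  \<open>(c\<^sub>F - c\<^sub>D) / (c\<^sub>P - c\<^sub>D) = r\<close>; for \<open>r = 1\<close> one has \<open>c\<^sub>F = c\<^sub>P\<close> and the cross-ratio can only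
  be 1. The graphs of the normal form polynomials realise every value \<open>r \<noteq> 1\<close>.\<close>

text \<open>Contact and tangent planes are defined through arbitrary, possibly inhomogeneous
  equations of the cone over the surface. They become conditions on the graph function because every
  such equation is comparable, up to positive constants, with the height above the graph.
  Multiplicities are therefore handled as bounds O(|t|^k), which survive this comparison and a
  change of parameter on a line. The natural weights are 1 for x and for slopes, 2 for y. The
  remainder \<open>\<phi>\<close> has zero 4-jet, so its derivatives of order j are o(|x|^(4-j))
  along curves y = O(x^2); dividing by the right power of x leaves polynomial identities in r and
  the coefficient. The flecnodal slope and the conodal partner are unknown functions of the point,
  so a priori bounds for them must come first. For two points with the same tangent plane the
  trapezoidal rule is exact along the chord. For \<open>\<phi>\<close> its error is of third order
  in the chord, which permits division by powers of x1 - x2 however close the two points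
  are.\<close>

section \<open>Smooth functions\<close>

text \<open>Differentiability is not assumed: \<open>frechet_derivative\<close> chooses among all
  derivatives, and by locality f and g have the same ones at x.\<close>

lemma frechet_derivative_cong_open:
  assumes "open U" "x \<in> U" "\<And>y. y \<in> U \<Longrightarrow> f y = g y"
  shows "frechet_derivative f (at x) = frechet_derivative g (at x)"
proof -
  have "(f has_derivative f') (at x) \<longleftrightarrow> (g has_derivative f') (at x)" for f'
    using has_derivative_transform_within_open[OF _ assms(1,2)] assms(3) by metis
  then show ?thesis by (simp add: frechet_derivative_def)
qed

lemma dir_deriv_append: "dir_deriv (vs @ ws) f = dir_deriv vs (dir_deriv ws f)"
  by (induction vs) auto

lemma smooth_on_dir_deriv: "smooth_on U f \<Longrightarrow> smooth_on U (dir_deriv ws f)"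
  by (simp add: smooth_on_def flip: dir_deriv_append)

lemma smooth_on_subset: "smooth_on U f \<Longrightarrow> V \<subseteq> U \<Longrightarrow> smooth_on V f"
  by (meson smooth_on_def differentiable_on_subset)

lemma smooth_on_has_derivative:
  assumes "smooth_on U f" "open U" "x \<in> U"
  shows "(dir_deriv vs f has_derivative (\<lambda>v. dir_deriv (v # vs) f x)) (at x)"
proof -
  have "dir_deriv vs f differentiable (at x)"
    using assms by (auto simp: smooth_on_def differentiable_on_eq_differentiable_at)
  then show ?thesis by (simp add: frechet_derivative_works[symmetric])
qed

lemma smooth_on_continuous:
  assumes "smooth_on U f" "open U" "x \<in> U"
  shows "isCont (dir_deriv vs f) x"
  using smooth_on_has_derivative[OF assms] by (rule has_derivative_continuous)

text \<open>Induction on the list of directions never leaves the class P, so smoothness reduces to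
  finding a class closed under one derivative. Closure is needed only up to equality on U, because
  iterated derivatives at points of the open set U depend only on the values there.\<close>

lemma smooth_on_coinduct:
  assumes "open U" "P f"
    and diff: "\<And>f. P f \<Longrightarrow> f differentiable_on U"
    and closed: "\<And>f v. P f \<Longrightarrow> \<exists>g. P g \<and> (\<forall>x\<in>U. frechet_derivative f (at x) v = g x)"
  shows "smooth_on U f"
proof -
  have *: "\<exists>g. P g \<and> (\<forall>x\<in>U. dir_deriv vs f x = g x)" for vs
  proof (induction vs)
    case Nil
    then show ?case using \<open>P f\<close> by auto
  next
    case (Cons v vs)
    then obtain g where g: "P g" "\<forall>x\<in>U. dir_deriv vs f x = g x" by blast
    then have "frechet_derivative (dir_deriv vs f) (at x) v = frechet_derivative g (at x) v"
      if "x \<in> U" for x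
      using frechet_derivative_cong_open[OF \<open>open U\<close> that] by metis
    with closed[OF g(1)] show ?case by (metis dir_deriv.simps(2))
  qed
  show ?thesis
    unfolding smooth_on_def
  proof
    fix vs
    obtain g where g: "P g" "\<forall>x\<in>U. dir_deriv vs f x = g x" using * by blast
    show "dir_deriv vs f differentiable_on U"
      using diff[OF g(1)] g(2) by (metis differentiable_on_def differentiable_transform_within zero_less_one)
  qed
qed

text \<open>The derivative of a linear map in a fixed direction is constant and that of a constant
  is zero, so both kinds together form a class closed under derivatives.\<close>

lemma smooth_on_const_linear:
  fixes f :: "'a::real_normed_vector \<Rightarrow> 'b::real_normed_vector"
  assumes "open U" "bounded_linear f"
  shows smooth_on_const: "smooth_on U (\<lambda>x::'a. c::'b)" and smooth_on_bounded_linear: "smooth_on U f"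
proof -
  have *: "smooth_on U f" if "(\<exists>c. f = (\<lambda>x. c)) \<or> bounded_linear f" for f :: "'a \<Rightarrow> 'b"
  proof (rule smooth_on_coinduct[where P = "\<lambda>f. (\<exists>c. f = (\<lambda>x. c)) \<or> bounded_linear f", OF assms(1) that], goal_cases)
    case (1 f)
    then show ?case
      by (auto simp: bounded_linear_imp_differentiable differentiable_on_def)
  next
    case (2 f v)
    then consider c where "f = (\<lambda>x. c)" | "bounded_linear f" by blast
    then show ?case
    proof cases
      case 1
      then show ?thesis by (intro exI[of _ "\<lambda>x. 0"]) (auto simp: frechet_derivative_const)
    next
      case 2
      have "frechet_derivative f (at x) v = f v" for x
        using frechet_derivative_at[OF bounded_linear_imp_has_derivative[OF 2]] by metis
      then show ?thesis by (intro exI[of _ "\<lambda>x. f v"]) auto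
    qed
  qed
  show "smooth_on U (\<lambda>x. c)" "smooth_on U f" using *[of f] *[of "\<lambda>x. c"] assms(2) by auto
qed

lemma frechet_derivative_smooth:
  assumes "smooth_on U f" "open U" "x \<in> U"
  shows "(f has_derivative frechet_derivative f (at x)) (at x)"
  using smooth_on_has_derivative[OF assms, of "[]"] by simp

lemma smooth_on_linear_compose:
  assumes "open U" "smooth_on U f" "bounded_linear L"
  shows "smooth_on U (\<lambda>x. L (f x))"
proof (rule smooth_on_coinduct[where P = "\<lambda>h. \<exists>f. smooth_on U f \<and> h = (\<lambda>x. L (f x))", OF assms(1)], goal_cases)
  case 1
  then show ?case using assms by blast
next
  case (2 h)
  then obtain f where f: "smooth_on U f" "h = (\<lambda>x. L (f x))" by blast
  show ?case
    unfolding f(2)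
  proof (rule differentiable_at_imp_differentiable_on)
    fix x assume "x \<in> U"
    from bounded_linear.has_derivative[OF assms(3) frechet_derivative_smooth[OF f(1) assms(1) this]]
    show "(\<lambda>x. L (f x)) differentiable at x" by (auto simp: differentiable_def)
  qed
next
  case (3 h v)
  then obtain f where f: "smooth_on U f" "h = (\<lambda>x. L (f x))" by blast
  have "frechet_derivative h (at x) v = L (dir_deriv [v] f x)" if "x \<in> U" for x
  proof -
    have "(h has_derivative (\<lambda>v. L (frechet_derivative f (at x) v))) (at x)"
      unfolding f(2) using frechet_derivative_smooth[OF f(1) assms(1) that] bounded_linear.has_derivative[OF assms(3)] by blast
    from frechet_derivative_at[OF this, symmetric] show ?thesis by simp
  qed
  then show ?case using smooth_on_dir_deriv[OF f(1)] by blast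
qed

lemma smooth_on_add:
  assumes "open U" "smooth_on U f" "smooth_on U g"
  shows "smooth_on U (\<lambda>x. f x + g x)"
proof (rule smooth_on_coinduct[where P = "\<lambda>h. \<exists>f g. smooth_on U f \<and> smooth_on U g \<and> h = (\<lambda>x. f x + g x)", OF assms(1)], goal_cases)
  case 1
  then show ?case using assms by blast
next
  case (2 h)
  then obtain f g where "smooth_on U f" "smooth_on U g" "h = (\<lambda>x. f x + g x)" by blast
  then show ?case
    by (metis smooth_on_def dir_deriv.simps(1) differentiable_on_add)
next
  case (3 h v)
  then obtain f g where f: "smooth_on U f" "smooth_on U g" "h = (\<lambda>x. f x + g x)" by blast
  have "frechet_derivative h (at x) v = dir_deriv [v] f x + dir_deriv [v] g x" if "x \<in> U" for x
  proof -
    have "(h has_derivative (\<lambda>v. frechet_derivative f (at x) v + frechet_derivative g (at x) v)) (at x)"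
      unfolding f(3) using frechet_derivative_smooth assms(1) that f by (intro has_derivative_add) auto
    from frechet_derivative_at[OF this, symmetric] show ?thesis by simp
  qed
  then show ?case using smooth_on_dir_deriv f by blast
qed

text \<open>Unlike the set of products of two smooth functions, this class is visibly closed under
  derivatives.\<close>

inductive ring_closure :: "'a::real_normed_vector set \<Rightarrow> ('a \<Rightarrow> real) \<Rightarrow> bool" for U where
  base: "smooth_on U f \<Longrightarrow> ring_closure U f"
| add: "ring_closure U f \<Longrightarrow> ring_closure U g \<Longrightarrow> ring_closure U (\<lambda>x. f x + g x)"
| mult: "ring_closure U f \<Longrightarrow> ring_closure U g \<Longrightarrow> ring_closure U (\<lambda>x. f x * g x)"
| inverse: "ring_closure U f \<Longrightarrow> \<forall>x\<in>U. f x \<noteq> 0 \<Longrightarrow> ring_closure U (\<lambda>x. inverse (f x))"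

text \<open>The derivative is returned together with the membership of every
  \<open>\<lambda>x. D x v\<close> in the class, which is the closure condition of
  \<open>smooth_on_coinduct\<close>. The inductive cases are the sum, product and reciprocal
  rules.\<close>

lemma ring_closure_derivative:
  assumes "ring_closure U f" "open U"
  shows "\<exists>D. (\<forall>v. ring_closure U (\<lambda>x. D x v)) \<and> (\<forall>x\<in>U. (f has_derivative D x) (at x))"
  using assms(1)
proof induction
  case (base f)
  have "ring_closure U (\<lambda>x. frechet_derivative f (at x) v)" for v
    using ring_closure.base[OF smooth_on_dir_deriv[OF base, of "[v]"]] by simp
  then show ?case
    using frechet_derivative_smooth[OF base assms(2)]
    by (intro exI[of _ "\<lambda>x. frechet_derivative f (at x)"]) auto
next
  case (add f g)
  then obtain D E where D: "\<forall>v. ring_closure U (\<lambda>x. D x v)" "\<forall>x\<in>U. (f has_derivative D x) (at x)"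
    "\<forall>v. ring_closure U (\<lambda>x. E x v)" "\<forall>x\<in>U. (g has_derivative E x) (at x)" by blast
  then show ?case
    by (intro exI[of _ "\<lambda>x v. D x v + E x v"]) (auto intro: ring_closure.intros has_derivative_add)
next
  case (mult f g)
  then obtain D E where D: "\<forall>v. ring_closure U (\<lambda>x. D x v)" "\<forall>x\<in>U. (f has_derivative D x) (at x)"
    "\<forall>v. ring_closure U (\<lambda>x. E x v)" "\<forall>x\<in>U. (g has_derivative E x) (at x)" by blast
  with mult show ?case
    by (intro exI[of _ "\<lambda>x v. f x * E x v + D x v * g x"]) (auto intro!: ring_closure.add ring_closure.mult has_derivative_mult)
next
  case (inverse f)
  then obtain D where D: "\<forall>v. ring_closure U (\<lambda>x. D x v)" "\<forall>x\<in>U. (f has_derivative D x) (at x)" by blast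
  \<comment> \<open>The sign is written as a product with the constant function -1, since the class
    has no rule for negation.\<close>
  have "ring_closure U (\<lambda>x. - 1 * (inverse (f x) * D x v * inverse (f x)))" for v
    by (intro ring_closure.mult ring_closure.inverse ring_closure.base[OF smooth_on_const[OF _ bounded_linear_zero]])
       (use inverse D assms(2) in auto)
  with inverse D show ?case
    by (intro exI[of _ "\<lambda>x v. - (inverse (f x) * D x v * inverse (f x))"]) (auto intro!: has_derivative_inverse)
qed

lemma ring_closure_smooth:
  assumes "open U" "ring_closure U f"
  shows "smooth_on U f"
proof (rule smooth_on_coinduct[where P = "ring_closure U", OF assms])
  fix f assume "ring_closure U f"
  from ring_closure_derivative[OF this assms(1)]
  obtain D where D: "\<And>v. ring_closure U (\<lambda>x. D x v)" "\<And>x. x \<in> U \<Longrightarrow> (f has_derivative D x) (at x)"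
    by blast
  show "f differentiable_on U"
    using D(2) by (intro differentiable_at_imp_differentiable_on) (auto simp: differentiable_def)
  show "\<exists>g. ring_closure U g \<and> (\<forall>x\<in>U. frechet_derivative f (at x) v = g x)" for v
    using D(1)[of v] frechet_derivative_at[OF D(2), symmetric]
    by (intro exI[of _ "\<lambda>x. D x v"]) auto
qed

lemma smooth_on_mult:
  fixes f g :: "'a::real_normed_vector \<Rightarrow> real"
  shows "open U \<Longrightarrow> smooth_on U f \<Longrightarrow> smooth_on U g \<Longrightarrow> smooth_on U (\<lambda>x. f x * g x)"
  by (rule ring_closure_smooth[OF _ ring_closure.mult[OF ring_closure.base ring_closure.base]])

lemma smooth_on_inverse:
  fixes f :: "'a::real_normed_vector \<Rightarrow> real"
  shows "open U \<Longrightarrow> smooth_on U f \<Longrightarrow> \<forall>x\<in>U. f x \<noteq> 0 \<Longrightarrow> smooth_on U (\<lambda>x. inverse (f x))"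
  by (rule ring_closure_smooth[OF _ ring_closure.inverse[OF ring_closure.base]])

lemma smooth_on_constant: "open U \<Longrightarrow> smooth_on U (\<lambda>x. c)"
  by (rule smooth_on_const[OF _ bounded_linear_zero])

lemma smooth_on_minus: "open U \<Longrightarrow> smooth_on U f \<Longrightarrow> smooth_on U (\<lambda>x. - f x)"
  by (rule smooth_on_linear_compose) (auto intro: bounded_linear_minus bounded_linear_ident)

lemma smooth_on_diff:
  "open U \<Longrightarrow> smooth_on U f \<Longrightarrow> smooth_on U g \<Longrightarrow> smooth_on U (\<lambda>x. f x - g x)"
  using smooth_on_add[of U f "\<lambda>x. - g x"] smooth_on_minus[of U g] by simp

lemma smooth_on_power:
  fixes f :: "'a::real_normed_vector \<Rightarrow> real"
  shows "open U \<Longrightarrow> smooth_on U f \<Longrightarrow> smooth_on U (\<lambda>x. f x ^ n)"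
  by (induction n) (auto intro: smooth_on_mult smooth_on_constant)

lemma smooth_on_divide_const:
  fixes f :: "'a::real_normed_vector \<Rightarrow> real"
  shows "open U \<Longrightarrow> smooth_on U f \<Longrightarrow> smooth_on U (\<lambda>x. f x / c)"
  using smooth_on_mult[of U f "\<lambda>x. inverse c"] smooth_on_constant[of U "inverse c"]
  by (simp add: divide_inverse)

lemma smooth_on_Pair:
  assumes "open U" "smooth_on U f" "smooth_on U g"
  shows "smooth_on U (\<lambda>x. (f x, g x))"
proof -
  have "smooth_on U (\<lambda>x. (f x, 0) + (0, g x))"
    by (intro smooth_on_add smooth_on_linear_compose[OF _ assms(2), of "\<lambda>z. (z, 0)"]
        smooth_on_linear_compose[OF _ assms(3), of "\<lambda>z. (0, z)"] assms(1))
      (auto intro!: bounded_linear_Pair bounded_linear_ident bounded_linear_zero)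
  then show ?thesis by simp
qed

lemma smooth_on_fst: "open U \<Longrightarrow> smooth_on U fst"
  and smooth_on_snd: "open V \<Longrightarrow> smooth_on V snd"
  and smooth_on_id: "open W \<Longrightarrow> smooth_on W (\<lambda>x. x)"
  by (auto intro!: smooth_on_bounded_linear bounded_linear_fst bounded_linear_snd bounded_linear_ident)

lemma smooth_on_nth_compose:
  fixes f :: "'a::real_normed_vector \<Rightarrow> real^'n"
  shows "open U \<Longrightarrow> smooth_on U f \<Longrightarrow> smooth_on U (\<lambda>x. f x $ i)"
  by (rule smooth_on_linear_compose[where L = "\<lambda>x. x $ i"]) (auto intro: bounded_linear_vec_nth)

lemmas smooth_on_intros = smooth_on_add smooth_on_diff smooth_on_minus smooth_on_mult smooth_on_power
  smooth_on_divide_const smooth_on_constant smooth_on_Pair smooth_on_id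

section \<open>Restriction to lines and orders of vanishing\<close>

lemma smooth_on_line_derivative:
  fixes f :: "'a::real_normed_vector \<Rightarrow> real"
  assumes "smooth_on U f" "open U" "p + t *\<^sub>R v \<in> U"
  shows "((\<lambda>t. dir_deriv vs f (p + t *\<^sub>R v)) has_real_derivative dir_deriv (v # vs) f (p + t *\<^sub>R v)) (at t)"
proof -
  have "((\<lambda>t. p + t *\<^sub>R v) has_derivative (\<lambda>t. t *\<^sub>R v)) (at t)"
    by (auto intro!: derivative_eq_intros)
  have comm: "(*) c = (\<lambda>s. s * c)" for c :: real by auto
  from diff_chain_at[OF \<open>((\<lambda>t. p + t *\<^sub>R v) has_derivative (\<lambda>t. t *\<^sub>R v)) (at t)\<close> smooth_on_has_derivative[OF assms]]
  have "((\<lambda>t. dir_deriv vs f (p + t *\<^sub>R v)) has_derivative (\<lambda>s. dir_deriv ((s *\<^sub>R v) # vs) f (p + t *\<^sub>R v))) (at t)"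
    by (simp add: o_def)
  moreover have "dir_deriv ((s *\<^sub>R v) # vs) f (p + t *\<^sub>R v) = s * dir_deriv (v # vs) f (p + t *\<^sub>R v)" for s
    using linear_scale[OF has_derivative_linear[OF smooth_on_has_derivative[OF assms]], of s v] by simp
  ultimately show ?thesis
    unfolding has_field_derivative_def comm[of "dir_deriv (v # vs) f (p + t *\<^sub>R v)"] by simp
qed

text \<open>The parameter t is generalised in the induction: differentiating once more needs the
  formula on a whole neighbourhood of t.\<close>

lemma funpow_deriv_line:
  fixes f :: "'a::real_normed_vector \<Rightarrow> real"
  assumes "smooth_on U f" "open U" "p + t *\<^sub>R v \<in> U"
  shows "(deriv ^^ j) (\<lambda>t. f (p + t *\<^sub>R v)) t = dir_deriv (replicate j v) f (p + t *\<^sub>R v)"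
  using assms(3)
proof (induction j arbitrary: t)
  case (Suc j)
  let ?T = "(\<lambda>t. p + t *\<^sub>R v) -` U"
  have "open ?T" by (intro open_vimage assms continuous_intros)
  have "(deriv ^^ Suc j) (\<lambda>t. f (p + t *\<^sub>R v)) t = deriv (\<lambda>t. dir_deriv (replicate j v) f (p + t *\<^sub>R v)) t"
  proof -
    have "\<forall>\<^sub>F s in nhds t. s \<in> ?T"
      using \<open>open ?T\<close> Suc.prems by (intro eventually_nhds_in_open) auto
    then have "\<forall>\<^sub>F s in nhds t. (deriv ^^ j) (\<lambda>t. f (p + t *\<^sub>R v)) s = dir_deriv (replicate j v) f (p + s *\<^sub>R v)"
      by eventually_elim (use Suc.IH in auto)
    then show ?thesis by (simp add: deriv_cong_ev[OF _ refl])
  qed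
  also have "\<dots> = dir_deriv (replicate (Suc j) v) f (p + t *\<^sub>R v)"
    using smooth_on_line_derivative[OF assms(1,2) Suc.prems] by (simp add: DERIV_imp_deriv)
  finally show ?case .
qed simp

text \<open>Taylor expansion of \<open>D 0\<close>, whose successive derivatives are the
  \<open>D j\<close>. The growth condition on the right is unaffected by factors bounded away from 0
  and infinity, whereas derivatives are not; this makes different equations of one surface
  comparable.\<close>

lemma vanishing_derivatives_iff_bigo:
  fixes D :: "nat \<Rightarrow> real \<Rightarrow> real"
  assumes "open T" "0 \<in> T" and D: "\<And>j t. t \<in> T \<Longrightarrow> (D j has_real_derivative D (Suc j) t) (at t)"
  shows "(\<forall>j<k. D j 0 = 0) \<longleftrightarrow> (\<exists>C. \<forall>\<^sub>F t in nhds 0. \<bar>D 0 t\<bar> \<le> C * \<bar>t\<bar> ^ k)"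
proof -
  obtain e where e: "0 < e" "cball 0 e \<subseteq> T"
    using assms(1,2) open_contains_cball by blast
  have bound: "\<exists>C\<ge>0. \<forall>t\<in>cball 0 e. \<bar>D j t\<bar> \<le> C" for j
  proof -
    have "continuous_on (cball 0 e) (D j)"
      by (meson D e(2) DERIV_isCont continuous_at_imp_continuous_on subsetD)
    then have "bounded (D j ` cball 0 e)"
      by (intro compact_imp_bounded compact_continuous_image compact_cball)
    then obtain a where "\<forall>t\<in>cball 0 e. \<bar>D j t\<bar> \<le> a"
      by (auto simp: bounded_iff)
    then show ?thesis by (intro exI[of _ "\<bar>a\<bar>"]) fastforce
  qed
  have DT: "\<forall>m s. m < n \<and> \<bar>s\<bar> \<le> \<bar>t\<bar> \<longrightarrow> (D m has_real_derivative D (Suc m) s) (at s)"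
    if "t \<in> cball 0 e" for t n
  proof (intro allI impI D)
    fix m s assume "m < n \<and> \<bar>s\<bar> \<le> \<bar>t\<bar>"
    then have "s \<in> cball 0 e" using that by (simp add: dist_real_def)
    then show "s \<in> T" using e(2) by blast
  qed
  have taylor: "\<exists>C\<ge>0. \<forall>t\<in>cball 0 e. \<bar>D 0 t\<bar> \<le> C * \<bar>t\<bar> ^ k" if "\<forall>j<k. D j 0 = 0" for k
  proof -
    obtain C where C: "C \<ge> 0" "\<forall>t\<in>cball 0 e. \<bar>D k t\<bar> \<le> C" using bound by blast
    have "\<bar>D 0 t\<bar> \<le> C * \<bar>t\<bar> ^ k" if t: "t \<in> cball 0 e" for t
    proof -
      from Maclaurin_bi_le[of D "D 0" k t, OF refl DT[OF t]]
      obtain s where s: "\<bar>s\<bar> \<le> \<bar>t\<bar>" "D 0 t = (\<Sum>m<k. D m 0 / fact m * t ^ m) + D k s / fact k * t ^ k"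
        by blast
      then have "\<bar>D 0 t\<bar> = \<bar>D k s\<bar> / fact k * \<bar>t\<bar> ^ k"
        using \<open>\<forall>j<k. D j 0 = 0\<close> by (simp add: abs_mult power_abs)
      also have "\<dots> \<le> C / 1 * \<bar>t\<bar> ^ k"
        using C s(1) t by (intro mult_right_mono frac_le) (auto simp: dist_real_def fact_ge_1)
      finally show ?thesis by simp
    qed
    then show ?thesis using C by blast
  qed
  have near: "\<forall>\<^sub>F t in nhds (0::real). t \<in> cball 0 e"
    by (rule eventually_mono[OF eventually_nhds_in_open[of "ball 0 e" "0::real"]])
       (use e(1) ball_subset_cball[of "0::real" e] in auto)
  have 1: "\<exists>C. \<forall>\<^sub>F t in nhds 0. \<bar>D 0 t\<bar> \<le> C * \<bar>t\<bar> ^ k" if "\<forall>j<k. D j 0 = 0"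
  proof -
    from taylor[OF that] obtain C where "\<forall>t\<in>cball 0 e. \<bar>D 0 t\<bar> \<le> C * \<bar>t\<bar> ^ k" by blast
    then show ?thesis using near by (intro exI[of _ C]) (auto elim: eventually_mono)
  qed
  have 2: "\<forall>j<k. D j 0 = 0" if "\<exists>C. \<forall>\<^sub>F t in nhds 0. \<bar>D 0 t\<bar> \<le> C * \<bar>t\<bar> ^ k"
  proof -
  from that obtain C where C: "\<forall>\<^sub>F t in nhds 0. \<bar>D 0 t\<bar> \<le> C * \<bar>t\<bar> ^ k" by blast
  have "j < k \<Longrightarrow> D j 0 = 0" for j
  proof (induction j rule: less_induct)
    case (less j)
    obtain M where M: "M \<ge> 0" "\<forall>t\<in>cball 0 e. \<bar>D (Suc j) t\<bar> \<le> M" using bound by blast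
    \<comment> \<open>The lower Taylor coefficients vanish by induction, so the term of order j
      equals \<open>D 0 t\<close> minus a remainder. Both are O(|t|^(j+1)); one factor |t| is left
      after cancelling |t|^j, and t tends to 0.\<close>
    have *: "\<bar>D j 0\<bar> / fact j \<le> (\<bar>C\<bar> + M) * \<bar>t\<bar>"
      if t: "t \<in> cball 0 e" "\<bar>D 0 t\<bar> \<le> C * \<bar>t\<bar> ^ k" "t \<noteq> 0" "\<bar>t\<bar> \<le> 1" for t
    proof -
      from Maclaurin_bi_le[of D "D 0" "Suc j" t, OF refl DT[OF t(1)]]
      obtain s where s: "\<bar>s\<bar> \<le> \<bar>t\<bar>" "D 0 t = (\<Sum>m<Suc j. D m 0 / fact m * t ^ m) + D (Suc j) s / fact (Suc j) * t ^ Suc j"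
        by blast
      then have "D j 0 / fact j * t ^ j = D 0 t - D (Suc j) s / fact (Suc j) * t ^ Suc j"
        using less by simp
      moreover have "\<bar>D j 0\<bar> / fact j * \<bar>t\<bar> ^ j = \<bar>D j 0 / fact j * t ^ j\<bar>"
        by (simp add: abs_mult power_abs)
      ultimately have "\<bar>D j 0\<bar> / fact j * \<bar>t\<bar> ^ j = \<bar>D 0 t - D (Suc j) s / fact (Suc j) * t ^ Suc j\<bar>"
        by (simp only:)
      also have "\<dots> \<le> \<bar>D 0 t\<bar> + \<bar>D (Suc j) s\<bar> / fact (Suc j) * \<bar>t\<bar> ^ Suc j"
        by (rule order_trans[OF abs_triangle_ineq4]) (simp add: abs_mult power_abs del: power_Suc fact_Suc)
      also have "\<bar>D (Suc j) s\<bar> / fact (Suc j) * \<bar>t\<bar> ^ Suc j \<le> M / 1 * \<bar>t\<bar> ^ Suc j"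
        using M s(1) t by (intro mult_right_mono frac_le fact_ge_1) (auto simp: dist_real_def)
      \<comment> \<open>Since j < k and |t| is at most 1, the power |t|^k is dominated by
        |t|^(j+1).\<close>
      also have "\<bar>D 0 t\<bar> \<le> \<bar>C\<bar> * \<bar>t\<bar> ^ Suc j"
        using t less.prems by (intro order_trans[OF t(2)] mult_mono power_decreasing) auto
      finally have "\<bar>D j 0\<bar> / fact j * \<bar>t\<bar> ^ j \<le> ((\<bar>C\<bar> + M) * \<bar>t\<bar>) * \<bar>t\<bar> ^ j"
        by (simp add: algebra_simps)
      then show ?thesis
        by (rule mult_right_le_imp_le) (use t(3) in simp)
    qed
    have "\<forall>\<^sub>F t in at 0. \<bar>D j 0\<bar> / fact j \<le> (\<bar>C\<bar> + M) * \<bar>t\<bar>"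
    proof -
      have "\<forall>\<^sub>F t in at 0. t \<in> cball 0 e \<and> \<bar>D 0 t\<bar> \<le> C * \<bar>t\<bar> ^ k"
        using near C by (auto simp: eventually_nhds_conv_at intro: eventually_conj)
      moreover have "\<forall>\<^sub>F t::real in at 0. \<bar>t\<bar> \<le> 1"
        by (auto simp: eventually_at intro!: exI[of _ 1])
      moreover have "\<forall>\<^sub>F t::real in at 0. t \<noteq> 0" by (simp add: eventually_at_filter)
      ultimately show ?thesis by eventually_elim (use * in blast)
    qed
    moreover have "((\<lambda>t. (\<bar>C\<bar> + M) * \<bar>t\<bar>) \<longlongrightarrow> (\<bar>C\<bar> + M) * \<bar>0\<bar>) (at 0)"
      by (intro tendsto_intros)
    ultimately have "\<bar>D j 0\<bar> / fact j \<le> 0"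
      by (intro tendsto_lowerbound[where f = "\<lambda>t. (\<bar>C\<bar> + M) * \<bar>t\<bar>" and F = "at 0"]) auto
    then show ?case using fact_gt_zero[of j, where ?'a = real] by (auto simp: divide_le_0_iff)
  qed
  then show ?thesis by blast
  qed
  from 1 2 show ?thesis by blast
qed

section \<open>Projective coordinates\<close>

lemma vector_4:
  "(vector [x, y, z, t] :: 'a::zero^4) $ 1 = x"
  "(vector [x, y, z, t] :: 'a::zero^4) $ 2 = y"
  "(vector [x, y, z, t] :: 'a::zero^4) $ 3 = z"
  "(vector [x, y, z, t] :: 'a::zero^4) $ 4 = t"
  unfolding vector_def by simp_all

lemma line_in_rp3: "v \<noteq> 0 \<Longrightarrow> span {v :: real^4} \<in> {L. subspace L \<and> dim L = 1}"
  by simp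

lemma proj_scale: "c \<noteq> 0 \<Longrightarrow> proj (c *\<^sub>R v) = proj v"
proof -
  assume "c \<noteq> 0"
  then have "span {c *\<^sub>R v} = span {v}"
    using span_image_scale[of "{v}" "\<lambda>_. c"] by simp
  then show ?thesis by (simp add: proj_def)
qed

lemma proj_eq_iff:
  assumes "v \<noteq> 0" "w \<noteq> 0"
  shows "proj v = proj w \<longleftrightarrow> (\<exists>c. c \<noteq> 0 \<and> v = c *\<^sub>R w)"
proof
  assume "proj v = proj w"
  then have "span {v} = span {w}"
    using Abs_rp3_inject[OF line_in_rp3 line_in_rp3] assms by (simp add: proj_def)
  then have "v \<in> span {w}" by (metis span_base singletonI)
  then show "\<exists>c. c \<noteq> 0 \<and> v = c *\<^sub>R w"
    using assms by (auto simp: span_singleton)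
qed (use proj_scale in auto)

lemma open_proj_vimage: "open W \<Longrightarrow> open {v. v \<noteq> 0 \<and> proj v \<in> W}"
  by (simp add: open_rp3_def)

text \<open>All four homogeneous coordinates in the frame B are arguments: t = 1 gives affine
  points, t = 0 gives directions, and linear combinations act componentwise.\<close>

definition hom :: "real^4^4 \<Rightarrow> real \<Rightarrow> real \<Rightarrow> real \<Rightarrow> real \<Rightarrow> real^4" where
  "hom B x y z t = B *v vector [x, y, z, t]"

definition coord :: "real^4^4 \<Rightarrow> 4 \<Rightarrow> real^4 \<Rightarrow> real" where
  "coord B i v = (matrix_inv B *v v) $ i"

lemma matrix_inv_mult:
  fixes A :: "real^'n^'n"
  assumes "invertible A"
  shows "matrix_inv A ** A = mat 1" "A ** matrix_inv A = mat 1"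
proof -
  have "A ** matrix_inv A = mat 1 \<and> matrix_inv A ** A = mat 1"
    unfolding matrix_inv_def by (rule someI_ex) (use assms in \<open>simp add: invertible_def\<close>)
  then show "matrix_inv A ** A = mat 1" "A ** matrix_inv A = mat 1" by auto
qed

lemma affine_pt_hom: "affine_pt B (x, y, z) = proj (hom B x y z 1)"
  by (simp add: affine_pt_def hom_def)

lemma hom_add: "hom B x y z t + hom B x' y' z' t' = hom B (x + x') (y + y') (z + z') (t + t')"
proof -
  have "(vector [x + x', y + y', z + z', t + t'] :: real^4) = vector [x, y, z, t] + vector [x', y', z', t']"
    by (simp add: vec_eq_iff forall_4 vector_4)
  then show ?thesis by (simp add: hom_def matrix_vector_right_distrib)
qed

lemma hom_scale: "c *\<^sub>R hom B x y z t = hom B (c * x) (c * y) (c * z) (c * t)"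
proof -
  have "(vector [c * x, c * y, c * z, c * t] :: real^4) = c *\<^sub>R vector [x, y, z, t]"
    by (simp add: vec_eq_iff forall_4 vector_4)
  then show ?thesis by (simp add: hom_def matrix_vector_mult_scaleR)
qed

lemma hom_expand:
  "hom B x y z t = x *\<^sub>R hom B 1 0 0 0 + y *\<^sub>R hom B 0 1 0 0 + z *\<^sub>R hom B 0 0 1 0 + t *\<^sub>R hom B 0 0 0 1"
  by (simp add: hom_add hom_scale)

lemma hom_zero [simp]: "hom B 0 0 0 0 = 0"
  using hom_scale[of 0 B 0 0 0 0] by simp

lemma coord_linear: "bounded_linear (coord B i)"
  unfolding coord_def
  by (intro linear_conv_bounded_linear[THEN iffD1])
    (simp add: linear_iff matrix_vector_right_distrib matrix_vector_mult_scaleR)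

lemma coord_add: "coord B i (v + w) = coord B i v + coord B i w"
  and coord_scale: "coord B i (c *\<^sub>R v) = c * coord B i v"
  using coord_linear[of B i] by (simp_all add: linear_simps)

lemma coord_hom:
  assumes "invertible B"
  shows "coord B 1 (hom B x y z t) = x" "coord B 2 (hom B x y z t) = y"
    "coord B 3 (hom B x y z t) = z" "coord B 4 (hom B x y z t) = t"
  using assms by (simp_all add: coord_def hom_def matrix_vector_mul_assoc matrix_inv_mult(1) vector_4)

lemma hom_coord:
  assumes "invertible B"
  shows "hom B (coord B 1 v) (coord B 2 v) (coord B 3 v) (coord B 4 v) = v"
proof -
  have "vector [coord B 1 v, coord B 2 v, coord B 3 v, coord B 4 v] = matrix_inv B *v v"
    by (simp add: vec_eq_iff forall_4 vector_4 coord_def)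
  then show ?thesis
    using assms by (simp add: hom_def matrix_vector_mul_assoc matrix_inv_mult(2))
qed

lemma hom_eq_iff:
  assumes "invertible B"
  shows "hom B x y z t = hom B x' y' z' t' \<longleftrightarrow> x = x' \<and> y = y' \<and> z = z' \<and> t = t'"
  by (metis coord_hom[OF assms])

lemma hom_eq_0_iff:
  assumes "invertible B"
  shows "hom B x y z t = 0 \<longleftrightarrow> x = 0 \<and> y = 0 \<and> z = 0 \<and> t = 0"
  using hom_eq_iff[OF assms, of x y z t 0 0 0 0] by simp

lemma tendsto_hom [tendsto_intros]:
  assumes "(x \<longlongrightarrow> x0) F" "(y \<longlongrightarrow> y0) F" "(z \<longlongrightarrow> z0) F" "(t \<longlongrightarrow> t0) F"
  shows "((\<lambda>s. hom B (x s) (y s) (z s) (t s)) \<longlongrightarrow> hom B x0 y0 z0 t0) F"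
  unfolding hom_expand[of B "x _"] hom_expand[of B x0] by (intro tendsto_intros assms)

lemma continuous_on_hom [continuous_intros]:
  assumes "continuous_on A x" "continuous_on A y" "continuous_on A z" "continuous_on A t"
  shows "continuous_on A (\<lambda>s. hom B (x s) (y s) (z s) (t s))"
  using assms unfolding continuous_on_def by (auto intro: tendsto_hom)

lemma has_derivative_hom:
  assumes "(x has_derivative x') F" "(y has_derivative y') F" "(z has_derivative z') F" "(t has_derivative t') F"
  shows "((\<lambda>s. hom B (x s) (y s) (z s) (t s)) has_derivative (\<lambda>h. hom B (x' h) (y' h) (z' h) (t' h))) F"
  unfolding hom_expand[of B "x _"] hom_expand[of B "x' _"]
  by (intro derivative_intros has_derivative_scaleR_left assms)

lemma smooth_on_hom:
  assumes "open U" "smooth_on U x" "smooth_on U y" "smooth_on U z" "smooth_on U t"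
  shows "smooth_on U (\<lambda>s. hom B (x s) (y s) (z s) (t s))"
  unfolding hom_expand[of B "x _"]
  by (intro smooth_on_add smooth_on_linear_compose[OF assms(1,2)] smooth_on_linear_compose[OF assms(1,3)]
      smooth_on_linear_compose[OF assms(1,4)] smooth_on_linear_compose[OF assms(1,5)]
      bounded_linear_scaleR_left assms(1))

lemma coord_tendsto [tendsto_intros]: "(f \<longlongrightarrow> l) F \<Longrightarrow> ((\<lambda>x. coord B i (f x)) \<longlongrightarrow> coord B i l) F"
  by (rule bounded_linear.tendsto[OF coord_linear])

lemma coord_continuous_on [continuous_intros]: "continuous_on A f \<Longrightarrow> continuous_on A (\<lambda>x. coord B i (f x))"
  by (rule bounded_linear.continuous_on[OF coord_linear])

lemma affine_pt_eq_iff: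
  assumes "invertible B"
  shows "affine_pt B p = affine_pt B q \<longleftrightarrow> p = q"
proof -
  obtain x y z x' y' z' where "p = (x, y, z)" "q = (x', y', z')" by (metis prod.exhaust)
  then show ?thesis
    by (auto simp: affine_pt_hom proj_eq_iff hom_eq_0_iff[OF assms] hom_scale hom_eq_iff[OF assms])
qed

lemma proj_affine_pt:
  assumes "invertible B" "coord B 4 v \<noteq> 0"
  shows "proj v = affine_pt B (coord B 1 v / coord B 4 v, coord B 2 v / coord B 4 v, coord B 3 v / coord B 4 v)"
proof -
  have "v = coord B 4 v *\<^sub>R hom B (coord B 1 v / coord B 4 v) (coord B 2 v / coord B 4 v) (coord B 3 v / coord B 4 v) 1"
    using assms(2) by (simp add: hom_scale hom_coord[OF assms(1)])
  then show ?thesis unfolding affine_pt_hom by (metis proj_scale assms(2))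
qed

lemma proj_eq_affine_pt_iff:
  assumes "invertible B" "v \<noteq> 0"
  shows "proj v = affine_pt B (x, y, z) \<longleftrightarrow> (\<exists>c. c \<noteq> 0 \<and> v = c *\<^sub>R hom B x y z 1)"
  using assms by (simp add: affine_pt_hom proj_eq_iff hom_eq_0_iff)

text \<open>The topology of \<open>rp3\<close> is a quotient topology, so openness is tested on the
  cone of the image, which is described by a nonvanishing fourth coordinate and by continuous
  quotients lying in V.\<close>

lemma open_affine_pt_image:
  assumes "invertible B" "open V"
  shows "open (affine_pt B ` V)"
proof -
  let ?c = "\<lambda>v. (coord B 1 v / coord B 4 v, coord B 2 v / coord B 4 v, coord B 3 v / coord B 4 v)"
  have eq: "{v. v \<noteq> 0 \<and> proj v \<in> affine_pt B ` V} = {v \<in> {v. coord B 4 v \<noteq> 0}. ?c v \<in> V}" (is "?L = ?R")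
  proof (intro equalityI subsetI)
    fix v assume "v \<in> ?L"
    then obtain x y z where v: "v \<noteq> 0" "(x, y, z) \<in> V" "proj v = affine_pt B (x, y, z)" by auto
    then obtain c where "c \<noteq> 0" "v = c *\<^sub>R hom B x y z 1" using proj_eq_affine_pt_iff[OF assms(1)] by blast
    then show "v \<in> ?R" using v(2) by (simp add: hom_scale coord_hom[OF assms(1)])
  next
    fix v assume v: "v \<in> ?R"
    moreover have "v \<noteq> 0" using v coord_scale[of B 4 0 0] by auto
    ultimately show "v \<in> ?L" using proj_affine_pt[OF assms(1)] by auto
  qed
  have "open {v. coord B 4 v \<noteq> 0}"
    by (intro open_Collect_neq continuous_intros)
  moreover have "continuous_on {v. coord B 4 v \<noteq> 0} ?c"
    by (intro continuous_on_Pair continuous_on_divide coord_continuous_on continuous_on_id) auto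
  ultimately have "open {v \<in> {v. coord B 4 v \<noteq> 0}. ?c v \<in> V}"
    using continuous_open_preimage[of "{v. coord B 4 v \<noteq> 0}" ?c V, OF _ _ assms(2)]
    by (simp add: vimage_def Int_def)
  then show ?thesis using eq by (simp add: open_rp3_def)
qed

lemma open_affine_pt_vimage:
  assumes "invertible B" "open W"
  shows "open (affine_pt B -` W)"
proof -
  have "affine_pt B -` W = (\<lambda>p. hom B (fst p) (fst (snd p)) (snd (snd p)) 1) -` {v. v \<noteq> 0 \<and> proj v \<in> W}"
    by (auto simp: affine_pt_hom hom_eq_0_iff[OF assms(1)])
  then show ?thesis
    using open_vimage[OF open_proj_vimage[OF assms(2)], of "\<lambda>p. hom B (fst p) (fst (snd p)) (snd (snd p)) 1"]
    by (simp add: continuous_on_hom continuous_on_fst continuous_on_snd)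
qed

lemma continuous_on_affine_pt: "invertible B \<Longrightarrow> continuous_on A (affine_pt B)"
  using continuous_on_open_vimage[of UNIV "affine_pt B"] open_affine_pt_vimage[of B]
  by (auto intro: continuous_on_subset)

section \<open>Surfaces that are graphs in a chart\<close>

text \<open>The condition of \<open>smooth_surface\<close> at a single point, for some
  representative vector; in this form it passes to open pieces of a surface.\<close>

definition has_local_equation :: "rp3 set \<Rightarrow> rp3 \<Rightarrow> bool" where
  "has_local_equation S p \<longleftrightarrow> (\<exists>v W F. v \<noteq> 0 \<and> p = proj v \<and> local_equation S v W F)"

text \<open>An equation composed with a curve on the cone over S is locally zero. Explicit curves
  then determine the kernel of the derivative of any equation.\<close>

lemma derivative_along_surface_curve:
  fixes F :: "real^4 \<Rightarrow> real"
  assumes F: "local_equation S v W F" "(F has_derivative D) (at v)"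
    and c: "c 0 = v" "(c has_vector_derivative w) (at (0::real))" "\<forall>\<^sub>F t in nhds 0. proj (c t) \<in> S"
  shows "D w = 0"
proof -
  have W: "open W" "v \<in> W" "\<And>w. w \<in> W \<Longrightarrow> proj w \<in> S \<longleftrightarrow> F w = 0"
    using F(1) by (auto simp: local_equation_def)
  have "isCont c 0" using c(2) has_vector_derivative_continuous by blast
  then have "(c \<longlongrightarrow> v) (nhds 0)"
    using c(1) by (metis continuous_at tendsto_at_iff_tendsto_nhds)
  then have "\<forall>\<^sub>F t in nhds 0. c t \<in> W"
    using W(1,2) topological_tendstoD by blast
  with c(3) have zero: "\<forall>\<^sub>F t in nhds 0. F (c t) = 0"
    by eventually_elim (use W(3) in blast)
  have "(F \<circ> c has_derivative D \<circ> (\<lambda>t. t *\<^sub>R w)) (at 0)"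
    using c(2) F(2) by (intro diff_chain_at) (auto simp: has_vector_derivative_def c(1))
  moreover have "(D \<circ> (\<lambda>t. t *\<^sub>R w)) = (*) (D w)"
    using linear_scale[OF has_derivative_linear[OF F(2)]] by (auto simp: fun_eq_iff)
  ultimately have "((\<lambda>t. F (c t)) has_real_derivative D w) (at 0)"
    by (simp add: has_field_derivative_def o_def)
  then have "((\<lambda>t::real. 0) has_real_derivative D w) (at 0)"
    using DERIV_cong_ev[OF refl zero refl] by simp
  then show ?thesis using DERIV_unique[OF _ DERIV_const] by blast
qed

lemma arg_cong4: "a = a' \<Longrightarrow> b = b' \<Longrightarrow> c = c' \<Longrightarrow> d = d' \<Longrightarrow> f a b c d = f a' b' c' d'"
  by simp

lemma span_scaled_pair:
  assumes "l \<noteq> 0"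
  shows "span {l *\<^sub>R h, m *\<^sub>R h + u} = span {h, u :: 'a::real_vector}"
proof (rule span_eq[THEN iffD2], intro conjI subsetI)
  show "x \<in> span {h, u}" if "x \<in> {l *\<^sub>R h, m *\<^sub>R h + u}" for x
    using that by (auto intro!: span_add span_scale intro: span_base)
  have h: "h \<in> span {l *\<^sub>R h, m *\<^sub>R h + u}"
    using span_scale[OF span_base, of "l *\<^sub>R h" "{l *\<^sub>R h, m *\<^sub>R h + u}" "inverse l"] assms by simp
  have "u = (m *\<^sub>R h + u) - m *\<^sub>R h" by simp
  then have "u \<in> span {l *\<^sub>R h, m *\<^sub>R h + u}"
    by (metis h span_diff span_scale span_base insertI1 insertI2)
  with h show "x \<in> span {l *\<^sub>R h, m *\<^sub>R h + u}" if "x \<in> {h, u}" for x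
    using that by blast
qed

text \<open>Inside V the surface is exactly the graph of f, so no second sheet meets V; nothing is
  known outside. With S and V abstract, the same facts apply to small pieces of a surface.\<close>

locale graph_chart =
  fixes S :: "rp3 set" and B :: "real^4^4" and f :: "real \<times> real \<Rightarrow> real"
    and U :: "(real \<times> real) set" and V :: "(real \<times> real \<times> real) set"
  assumes inv: "invertible B" and openU: "open U" and openV: "open V" and smooth: "smooth_on U f"
    and graph: "\<And>x y z. (x, y, z) \<in> V \<Longrightarrow> affine_pt B (x, y, z) \<in> S \<longleftrightarrow> z = f (x, y)"
    and domain: "\<And>x y z. (x, y, z) \<in> V \<Longrightarrow> (x, y) \<in> U"
begin

definition affine_coords :: "real^4 \<Rightarrow> real \<times> real \<times> real" where
  "affine_coords Q = (coord B 1 Q / coord B 4 Q, coord B 2 Q / coord B 4 Q, coord B 3 Q / coord B 4 Q)"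

text \<open>A defining function of degree 0 for the cone over the graph; arbitrary local equations
  are compared with it.\<close>

definition height :: "real^4 \<Rightarrow> real" where
  "height Q = coord B 3 Q / coord B 4 Q - f (coord B 1 Q / coord B 4 Q, coord B 2 Q / coord B 4 Q)"

lemma affine_hom: "t \<noteq> 0 \<Longrightarrow> affine_coords (t *\<^sub>R hom B x y z 1) = (x, y, z)"
  by (simp add: affine_coords_def hom_scale coord_hom[OF inv])

lemma tendsto_affine:
  assumes "coord B 4 v \<noteq> 0" shows "(affine_coords \<longlongrightarrow> affine_coords v) (nhds v)"
  unfolding affine_coords_def by (intro tendsto_intros assms filterlim_ident)

lemma eventually_in_chart:
  assumes "coord B 4 v \<noteq> 0" "affine_coords v \<in> V"
  shows "\<forall>\<^sub>F Q in nhds v. coord B 4 Q \<noteq> 0 \<and> affine_coords Q \<in> V"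
proof -
  have "((\<lambda>Q. coord B 4 Q) \<longlongrightarrow> coord B 4 v) (nhds v)"
    by (intro tendsto_intros filterlim_ident)
  then have "\<forall>\<^sub>F Q in nhds v. coord B 4 Q \<noteq> 0"
    using assms(1) by (simp add: tendsto_imp_eventually_ne)
  moreover have "\<forall>\<^sub>F Q in nhds v. affine_coords Q \<in> V"
    using tendsto_affine[OF assms(1)] openV assms(2) by (rule topological_tendstoD)
  ultimately show ?thesis by (rule eventually_conj)
qed

lemma proj_in_surface:
  assumes "coord B 4 Q \<noteq> 0" "affine_coords Q \<in> V"
  shows "proj Q \<in> S \<longleftrightarrow> height Q = 0"
  using graph[of "coord B 1 Q / coord B 4 Q" "coord B 2 Q / coord B 4 Q" "coord B 3 Q / coord B 4 Q"] assms
    proj_affine_pt[OF inv assms(1)]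
  by (simp add: affine_coords_def height_def)

context
  fixes x y z :: real and v :: "real^4" and W :: "(real^4) set" and F :: "real^4 \<Rightarrow> real" and l :: real
  assumes p: "(x, y, z) \<in> V" "z = f (x, y)" and l: "l \<noteq> 0" "v = l *\<^sub>R hom B x y z 1"
    and F: "local_equation S v W F"
begin

lemma v_coord: "coord B 4 v = l" "affine_coords v = (x, y, z)"
  using l affine_hom[OF l(1)] by (simp_all add: hom_scale coord_hom[OF inv])

lemma f_derivative: "(f has_derivative (\<lambda>u. dir_deriv [u] f (x, y))) (at (x, y))"
  using smooth_on_has_derivative[OF smooth openU domain[OF p(1)], of "[]"] by simp

lemma equation_derivative:
  "(F has_derivative frechet_derivative F (at v)) (at v)"
  using frechet_derivative_smooth[of W F v] F by (auto simp: local_equation_def)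

text \<open>F need not be homogeneous, so Euler's relation is replaced by the remark that the ray
  through the point lies on the cone over S.\<close>

lemma equation_derivative_point: "frechet_derivative F (at v) (hom B x y z 1) = 0"
proof (rule derivative_along_surface_curve[OF F equation_derivative, where c = "\<lambda>t. v + t *\<^sub>R hom B x y z 1"])
  show "((\<lambda>t. v + t *\<^sub>R hom B x y z 1) has_vector_derivative hom B x y z 1) (at 0)"
    by (auto intro!: derivative_eq_intros)
  have "\<forall>\<^sub>F t in nhds 0. l + t \<noteq> 0"
    by (rule eventually_mono[OF eventually_nhds_in_open[of "- {- l}" 0]]) (use l in auto)
  then show "\<forall>\<^sub>F t in nhds 0. proj (v + t *\<^sub>R hom B x y z 1) \<in> S"
  proof eventually_elim
    case (elim t)
    have "v + t *\<^sub>R hom B x y z 1 = (l + t) *\<^sub>R hom B x y z 1" by (simp add: l scaleR_add_left)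
    then show ?case using proj_scale[OF elim] graph[OF p(1)] p(2) by (simp add: affine_pt_hom)
  qed
qed simp

lemma equation_derivative_tangent:
  "frechet_derivative F (at v) (hom B a b (dir_deriv [(a, b)] f (x, y)) 0) = 0"
proof -
  let ?q = "\<lambda>t. (x, y) + t *\<^sub>R (a, b)"
  have f0: "((\<lambda>t. f (?q t)) has_real_derivative dir_deriv [(a, b)] f (x, y)) (at 0)"
    using smooth_on_line_derivative[OF smooth openU, of "(x, y)" 0 "(a, b)" "[]"] domain[OF p(1)] by simp
  have q: "((\<lambda>t. x + t * a) has_derivative (\<lambda>t. t * a)) (at 0)" "((\<lambda>t. y + t * b) has_derivative (\<lambda>t. t * b)) (at 0)"
    by (auto intro!: derivative_eq_intros)
  have "((\<lambda>t. hom B (x + t * a) (y + t * b) (f (?q t)) 1) has_derivative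
      (\<lambda>t. hom B (t * a) (t * b) (t * dir_deriv [(a, b)] f (x, y)) 0)) (at 0)"
    using has_derivative_hom[OF q f0[unfolded has_field_derivative_def] has_derivative_const[of 1]]
    by (simp add: mult.commute)
  then have d: "((\<lambda>t. hom B (x + t * a) (y + t * b) (f (?q t)) 1) has_vector_derivative
      hom B a b (dir_deriv [(a, b)] f (x, y)) 0) (at 0)"
    by (simp add: has_vector_derivative_def hom_scale)
  have "frechet_derivative F (at v) (l *\<^sub>R hom B a b (dir_deriv [(a, b)] f (x, y)) 0) = 0"
  proof (rule derivative_along_surface_curve[OF F equation_derivative,
        where c = "\<lambda>t. l *\<^sub>R hom B (x + t * a) (y + t * b) (f (?q t)) 1"])
    show "((\<lambda>t. l *\<^sub>R hom B (x + t * a) (y + t * b) (f (?q t)) 1) has_vector_derivative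
        l *\<^sub>R hom B a b (dir_deriv [(a, b)] f (x, y)) 0) (at 0)"
      using d by (auto intro!: derivative_eq_intros)
    have "((\<lambda>t. (x + t * a, y + t * b, f (?q t))) \<longlongrightarrow> (x + 0 * a, y + 0 * b, f (?q 0))) (nhds 0)"
    proof -
      have "((\<lambda>t. f (?q t)) \<longlongrightarrow> f (?q 0)) (nhds 0)"
        using DERIV_isCont[OF f0] by (metis continuous_at tendsto_at_iff_tendsto_nhds)
      then show ?thesis by (intro tendsto_intros filterlim_ident)
    qed
    then have "\<forall>\<^sub>F t in nhds 0. (x + t * a, y + t * b, f (?q t)) \<in> V"
      by (rule topological_tendstoD) (use openV p in auto)
    then show "\<forall>\<^sub>F t in nhds 0. proj (l *\<^sub>R hom B (x + t * a) (y + t * b) (f (?q t)) 1) \<in> S"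
      by eventually_elim (use proj_scale[OF l(1)] graph in \<open>auto simp: affine_pt_hom\<close>)
  qed (use l p in auto)
  then show ?thesis
    using linear_scale[OF has_derivative_linear[OF equation_derivative]] l by simp
qed

text \<open>Q is decomposed along the point itself, the two tangent vectors over (1, 0) and (0, 1),
  and the vertical vector. The derivative kills the first three, so every local equation has the
  same derivative up to a factor.\<close>

lemma equation_derivative_formula:
  "frechet_derivative F (at v) Q = frechet_derivative F (at v) (hom B 0 0 1 0) *
    (coord B 3 Q - dir_deriv [(1, 0)] f (x, y) * coord B 1 Q - dir_deriv [(0, 1)] f (x, y) * coord B 2 Q
     - (z - x * dir_deriv [(1, 0)] f (x, y) - y * dir_deriv [(0, 1)] f (x, y)) * coord B 4 Q)"
proof -
  let ?D = "frechet_derivative F (at v)"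
  have lin: "linear ?D" by (rule has_derivative_linear[OF equation_derivative])
  define q1 q2 q3 q4 fx fy where q: "q1 = coord B 1 Q" "q2 = coord B 2 Q" "q3 = coord B 3 Q" "q4 = coord B 4 Q"
    "fx = dir_deriv [(1, 0)] f (x, y)" "fy = dir_deriv [(0, 1)] f (x, y)"
  have "hom B q1 q2 q3 q4 = q4 *\<^sub>R hom B x y z 1 + (q1 - x * q4) *\<^sub>R hom B 1 0 fx 0 + (q2 - y * q4) *\<^sub>R hom B 0 1 fy 0 +
      (q3 - fx * q1 - fy * q2 - (z - x * fx - y * fy) * q4) *\<^sub>R hom B 0 0 1 0"
    unfolding hom_add hom_scale by (rule arg_cong4[where f = "hom B"]) (simp_all add: algebra_simps)
  moreover have "Q = hom B q1 q2 q3 q4" by (simp add: q hom_coord[OF inv])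
  ultimately have "?D Q = q4 * ?D (hom B x y z 1) + (q1 - x * q4) * ?D (hom B 1 0 fx 0) + (q2 - y * q4) * ?D (hom B 0 1 fy 0) +
      (q3 - fx * q1 - fy * q2 - (z - x * fx - y * fy) * q4) * ?D (hom B 0 0 1 0)"
    by (simp only: linear_add[OF lin] linear_scale[OF lin] real_scaleR_def)
  then show ?thesis
    using equation_derivative_point equation_derivative_tangent[of 1 0] equation_derivative_tangent[of 0 1]
    by (simp add: q)
qed

lemma equation_derivative_vertical: "frechet_derivative F (at v) (hom B 0 0 1 0) \<noteq> 0"
proof
  assume 0: "frechet_derivative F (at v) (hom B 0 0 1 0) = 0"
  have "frechet_derivative F (at v) = (\<lambda>_. 0)"
  proof
    show "frechet_derivative F (at v) Q = 0" for Q
      by (subst equation_derivative_formula) (simp add: 0)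
  qed
  then show False using F by (auto simp: local_equation_def)
qed

text \<open>The mean value theorem along the vertical direction compares the equation with the height.\<close>

lemma equation_comparable_height:
  obtains c C where "0 < c" "0 < C"
    "\<forall>\<^sub>F Q in nhds v. c * \<bar>height Q\<bar> \<le> \<bar>F Q\<bar> \<and> \<bar>F Q\<bar> \<le> C * \<bar>height Q\<bar>"
proof -
  define e where "e = hom B 0 0 1 0"
  define d where "d = \<bar>dir_deriv [e] F v\<bar>"
  have d: "0 < d" using equation_derivative_vertical by (simp add: d_def e_def)
  have W: "open W" "v \<in> W" "smooth_on W F" "\<And>w. w \<in> W \<Longrightarrow> proj w \<in> S \<longleftrightarrow> F w = 0"
    using F by (auto simp: local_equation_def)
  have "((\<lambda>Q. \<bar>dir_deriv [e] F Q\<bar>) \<longlongrightarrow> d) (nhds v)"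
    using smooth_on_continuous[OF W(3,1,2), of "[e]"] unfolding d_def
    by (intro tendsto_rabs) (metis continuous_at tendsto_at_iff_tendsto_nhds)
  then have "\<forall>\<^sub>F Q in nhds v. d / 2 < \<bar>dir_deriv [e] F Q\<bar> \<and> \<bar>dir_deriv [e] F Q\<bar> < 2 * d"
    using d by (intro eventually_conj order_tendstoD) auto
  moreover have "\<forall>\<^sub>F Q in nhds v. Q \<in> W" using W eventually_nhds_in_open by blast
  ultimately have "\<forall>\<^sub>F Q in nhds v. Q \<in> W \<and> d / 2 < \<bar>dir_deriv [e] F Q\<bar> \<and> \<bar>dir_deriv [e] F Q\<bar> < 2 * d"
    using eventually_conj by blast
  then obtain r where r: "0 < r" "\<And>Q. Q \<in> ball v r \<Longrightarrow> Q \<in> W \<and> d / 2 < \<bar>dir_deriv [e] F Q\<bar> \<and> \<bar>dir_deriv [e] F Q\<bar> < 2 * d"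
    unfolding eventually_nhds_metric by (auto simp: dist_commute)
  \<comment> \<open>The foot of Q lies on the cone over the graph and has the same first, second and
    fourth coordinates. Hence Q is reached from it vertically, by the multiple
    \<open>coord B 4 Q * height Q\<close> of e, and F vanishes at the foot.\<close>
  define foot where "foot Q = hom B (coord B 1 Q) (coord B 2 Q)
      (coord B 4 Q * f (coord B 1 Q / coord B 4 Q, coord B 2 Q / coord B 4 Q)) (coord B 4 Q)" for Q
  have fcont: "((\<lambda>Q. f (coord B 1 Q / coord B 4 Q, coord B 2 Q / coord B 4 Q)) \<longlongrightarrow> f (x, y)) (nhds v)"
  proof (rule isCont_tendsto_compose[where g = f])
    show "isCont f (x, y)" using f_derivative has_derivative_continuous by blast
    have "((\<lambda>Q. (coord B 1 Q / coord B 4 Q, coord B 2 Q / coord B 4 Q)) \<longlongrightarrow>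
        (coord B 1 v / coord B 4 v, coord B 2 v / coord B 4 v)) (nhds v)"
      by (intro tendsto_intros filterlim_ident) (use v_coord l in auto)
    then show "((\<lambda>Q. (coord B 1 Q / coord B 4 Q, coord B 2 Q / coord B 4 Q)) \<longlongrightarrow> (x, y)) (nhds v)"
      using v_coord(2) by (simp add: affine_coords_def)
  qed
  have "(foot \<longlongrightarrow> hom B (coord B 1 v) (coord B 2 v) (coord B 4 v * f (x, y)) (coord B 4 v)) (nhds v)"
    unfolding foot_def by (intro tendsto_intros filterlim_ident fcont)
  moreover have "hom B (coord B 1 v) (coord B 2 v) (coord B 4 v * f (x, y)) (coord B 4 v) = v"
    using l p by (simp add: hom_scale coord_hom[OF inv])
  ultimately have foot: "(foot \<longlongrightarrow> v) (nhds v)" by simp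
  have "((\<lambda>Q. \<bar>coord B 4 Q\<bar>) \<longlongrightarrow> \<bar>l\<bar>) (nhds v)"
    unfolding v_coord(1)[symmetric] by (intro tendsto_intros filterlim_ident)
  then have ev4: "\<forall>\<^sub>F Q in nhds v. \<bar>l\<bar> / 2 < \<bar>coord B 4 Q\<bar> \<and> \<bar>coord B 4 Q\<bar> < 2 * \<bar>l\<bar>"
    using l by (intro eventually_conj order_tendstoD) auto
  have evf: "\<forall>\<^sub>F Q in nhds v. foot Q \<in> ball v r"
    by (rule topological_tendstoD[OF foot]) (use r in auto)
  have "\<forall>\<^sub>F Q in nhds v. coord B 4 (foot Q) \<noteq> 0 \<and> affine_coords (foot Q) \<in> V"
    using eventually_in_chart[of v] foot v_coord l p unfolding filterlim_iff by auto
  moreover have "\<forall>\<^sub>F Q in nhds v. Q \<in> ball v r"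
    using r by (intro eventually_nhds_in_open) auto
  ultimately have "\<forall>\<^sub>F Q in nhds v. \<bar>l\<bar> / 2 * (d / 2) * \<bar>height Q\<bar> \<le> \<bar>F Q\<bar> \<and> \<bar>F Q\<bar> \<le> 2 * \<bar>l\<bar> * (2 * d) * \<bar>height Q\<bar>"
    using ev4 evf
  proof eventually_elim
    case (elim Q)
    have q4: "coord B 4 Q \<noteq> 0" using elim l by auto
    have ft: "F (foot Q) = 0"
    proof -
      have "height (foot Q) = 0"
        using q4 by (simp add: height_def foot_def coord_hom[OF inv])
      then show ?thesis using proj_in_surface[of "foot Q"] elim W(4) r(2) by blast
    qed
    define m where "m = coord B 4 Q * height Q"
    have Q: "Q = foot Q + m *\<^sub>R e"
    proof -
      have "foot Q + m *\<^sub>R e = hom B (coord B 1 Q) (coord B 2 Q) (coord B 3 Q) (coord B 4 Q)"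
        using q4 by (simp add: foot_def e_def m_def height_def hom_add hom_scale hom_eq_iff[OF inv] field_simps)
      then show ?thesis by (simp add: hom_coord[OF inv])
    qed
    have seg: "foot Q + s *\<^sub>R m *\<^sub>R e \<in> ball v r" if "0 \<le> s" "s \<le> 1" for s
    proof -
      have "foot Q + s *\<^sub>R m *\<^sub>R e = (1 - s) *\<^sub>R foot Q + s *\<^sub>R Q"
        by (subst (2) Q) (simp add: algebra_simps)
      then show ?thesis using convexD_alt[OF convex_ball, of "foot Q" v r Q s] elim that by auto
    qed
    have "\<exists>s>0. s < 1 \<and> F (foot Q + 1 *\<^sub>R m *\<^sub>R e) - F (foot Q + 0 *\<^sub>R m *\<^sub>R e)
        = (1 - 0) * dir_deriv [m *\<^sub>R e] F (foot Q + s *\<^sub>R m *\<^sub>R e)"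
      using smooth_on_line_derivative[OF W(3,1), of "foot Q" _ "m *\<^sub>R e" "[]"] r(2)[OF seg]
      by (intro MVT2) auto
    then obtain s where s: "0 < s" "s < 1" "F Q = dir_deriv [m *\<^sub>R e] F (foot Q + s *\<^sub>R m *\<^sub>R e)"
      using ft Q by auto
    have P: "foot Q + s *\<^sub>R m *\<^sub>R e \<in> ball v r" using s by (intro seg) auto
    have "F Q = m * dir_deriv [e] F (foot Q + s *\<^sub>R m *\<^sub>R e)"
      using s(3) linear_scale[OF has_derivative_linear[OF smooth_on_has_derivative[OF W(3,1), of _ "[]"]], of _ m e]
        r(2)[OF P] by simp
    then have eq: "\<bar>F Q\<bar> = \<bar>coord B 4 Q\<bar> * \<bar>dir_deriv [e] F (foot Q + s *\<^sub>R m *\<^sub>R e)\<bar> * \<bar>height Q\<bar>"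
      by (simp add: m_def abs_mult)
    show ?case
      unfolding eq using r(2)[OF P] elim d
      by (intro conjI mult_right_mono mult_mono) auto
  qed
  then show thesis using that[of "\<bar>l\<bar> / 2 * (d / 2)" "2 * \<bar>l\<bar> * (2 * d)"] d l by simp
qed

end

end

section \<open>Tangent planes and contact with lines, read off from the graph function\<close>

lemma inner_eq_imp_eq: "(\<And>Q. \<xi> \<bullet> Q = \<eta> \<bullet> Q) \<Longrightarrow> \<xi> = \<eta>"
  by (metis vector_eq_rdot inner_commute)

lemma span_pair_dim:
  fixes h u :: "'a::euclidean_space"
  assumes "h \<noteq> 0" "u \<notin> span {h}"
  shows "dim (span {h, u}) = 2"
proof -
  have "independent {u, h}" using assms by (simp add: independent_insert)
  moreover have "u \<noteq> h" using assms span_base by blast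
  ultimately show ?thesis
    using dim_span_eq_card_independent[of "{u, h}"] by (simp add: insert_commute)
qed

lemma eventually_compose_nhds:
  assumes "(g \<longlongrightarrow> b) (nhds a)" "\<forall>\<^sub>F y in nhds b. P y"
  shows "\<forall>\<^sub>F x in nhds a. P (g x)"
  using assms unfolding filterlim_iff by blast

text \<open>The reparametrisation between affine and homogeneous parameters of a line,
  \<open>s = t / (l + t m)\<close> and \<open>t = l s / (1 - s m)\<close>, does not change orders of vanishing.\<close>

lemma bigo_mobius_substitution:
  fixes g :: "real \<Rightarrow> real"
  assumes "l \<noteq> 0"
  shows "(\<exists>C. \<forall>\<^sub>F t in nhds 0. \<bar>g (t / (l + t * m))\<bar> \<le> C * \<bar>t\<bar> ^ k) \<longleftrightarrow>
         (\<exists>C. \<forall>\<^sub>F s in nhds 0. \<bar>g s\<bar> \<le> C * \<bar>s\<bar> ^ k)"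
proof
  assume "\<exists>C. \<forall>\<^sub>F t in nhds 0. \<bar>g (t / (l + t * m))\<bar> \<le> C * \<bar>t\<bar> ^ k"
  then obtain C where C: "\<forall>\<^sub>F t in nhds 0. \<bar>g (t / (l + t * m))\<bar> \<le> C * \<bar>t\<bar> ^ k" by blast
  have "((\<lambda>s. l * s / (1 - s * m)) \<longlongrightarrow> l * 0 / (1 - 0 * m)) (nhds 0)"
    by (intro tendsto_intros filterlim_ident) simp
  then have lim: "((\<lambda>s. l * s / (1 - s * m)) \<longlongrightarrow> 0) (nhds 0)" by simp
  have "((\<lambda>s. \<bar>1 - s * m\<bar>) \<longlongrightarrow> \<bar>1 - 0 * m\<bar>) (nhds 0)"
    by (intro tendsto_intros filterlim_ident)
  then have "\<forall>\<^sub>F s in nhds 0. 1/2 < \<bar>1 - s * m\<bar>"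
    by (intro order_tendstoD) auto
  with eventually_compose_nhds[OF lim C]
  have "\<forall>\<^sub>F s in nhds 0. \<bar>g s\<bar> \<le> (\<bar>C\<bar> * (2 * \<bar>l\<bar>) ^ k) * \<bar>s\<bar> ^ k"
  proof eventually_elim
    case (elim s)
    let ?t = "l * s / (1 - s * m)"
    have nz: "1 - s * m \<noteq> 0" using elim by auto
    have "l + ?t * m = l / (1 - s * m)" using nz by (simp add: field_simps)
    then have "?t / (l + ?t * m) = s" using nz assms by (simp add: field_simps)
    then have "\<bar>g s\<bar> \<le> C * \<bar>?t\<bar> ^ k" using elim by simp
    also have "\<dots> \<le> \<bar>C\<bar> * (2 * \<bar>l\<bar> * \<bar>s\<bar>) ^ k"
    proof (intro mult_mono power_mono)
      have "\<bar>?t\<bar> = \<bar>l\<bar> * \<bar>s\<bar> / \<bar>1 - s * m\<bar>" by (simp add: abs_mult)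
      also have "\<dots> \<le> \<bar>l\<bar> * \<bar>s\<bar> / (1/2)" using elim by (intro divide_left_mono) auto
      finally show "\<bar>?t\<bar> \<le> 2 * \<bar>l\<bar> * \<bar>s\<bar>" by simp
    qed auto
    finally show ?case by (simp add: power_mult_distrib)
  qed
  then show "\<exists>C. \<forall>\<^sub>F s in nhds 0. \<bar>g s\<bar> \<le> C * \<bar>s\<bar> ^ k" by blast
next
  assume "\<exists>C. \<forall>\<^sub>F s in nhds 0. \<bar>g s\<bar> \<le> C * \<bar>s\<bar> ^ k"
  then obtain C where C: "\<forall>\<^sub>F s in nhds 0. \<bar>g s\<bar> \<le> C * \<bar>s\<bar> ^ k" by blast
  have "((\<lambda>t. t / (l + t * m)) \<longlongrightarrow> 0 / (l + 0 * m)) (nhds 0)"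
    by (intro tendsto_intros filterlim_ident) (use assms in simp)
  then have lim: "((\<lambda>t. t / (l + t * m)) \<longlongrightarrow> 0) (nhds 0)" by simp
  have "((\<lambda>t. \<bar>l + t * m\<bar>) \<longlongrightarrow> \<bar>l + 0 * m\<bar>) (nhds 0)"
    by (intro tendsto_intros filterlim_ident)
  then have "\<forall>\<^sub>F t in nhds 0. \<bar>l\<bar> / 2 < \<bar>l + t * m\<bar>"
    by (rule order_tendstoD) (use assms in auto)
  with eventually_compose_nhds[OF lim C]
  have "\<forall>\<^sub>F t in nhds 0. \<bar>g (t / (l + t * m))\<bar> \<le> (\<bar>C\<bar> * (2 / \<bar>l\<bar>) ^ k) * \<bar>t\<bar> ^ k"
  proof eventually_elim
    case (elim t)
    have "\<bar>g (t / (l + t * m))\<bar> \<le> C * \<bar>t / (l + t * m)\<bar> ^ k" using elim by blast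
    also have "\<dots> \<le> \<bar>C\<bar> * (2 / \<bar>l\<bar> * \<bar>t\<bar>) ^ k"
    proof (intro mult_mono power_mono)
      have "\<bar>t / (l + t * m)\<bar> = \<bar>t\<bar> / \<bar>l + t * m\<bar>" by simp
      also have "\<dots> \<le> \<bar>t\<bar> / (\<bar>l\<bar> / 2)" using elim assms
        by (intro divide_left_mono mult_pos_pos) (auto intro: order.strict_trans)
      finally show "\<bar>t / (l + t * m)\<bar> \<le> 2 / \<bar>l\<bar> * \<bar>t\<bar>" by (simp add: field_simps)
    qed auto
    finally show ?case by (simp add: power_mult_distrib power_divide)
  qed
  then show "\<exists>C. \<forall>\<^sub>F t in nhds 0. \<bar>g (t / (l + t * m))\<bar> \<le> C * \<bar>t\<bar> ^ k" by blast
qed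

context graph_chart
begin

lemma proj_eq_chart_point:
  assumes "v \<noteq> 0" "affine_pt B (x, y, z) = proj v"
  obtains l where "l \<noteq> 0" "v = l *\<^sub>R hom B x y z 1"
  using assms proj_eq_affine_pt_iff[OF inv assms(1)] by metis

text \<open>The linear form whose kernel is the tangent plane, normalised to take the value 1 on the
  vertical vector \<open>hom B 0 0 1 0\<close>.\<close>

definition conormal :: "real \<times> real \<Rightarrow> real^4 \<Rightarrow> real" where
  "conormal = (\<lambda>(x, y) Q. coord B 3 Q - dir_deriv [(1, 0)] f (x, y) * coord B 1 Q - dir_deriv [(0, 1)] f (x, y) * coord B 2 Q
     - (f (x, y) - x * dir_deriv [(1, 0)] f (x, y) - y * dir_deriv [(0, 1)] f (x, y)) * coord B 4 Q)"

text \<open>The description by THE is justified here: all local equations at all representatives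
  have derivatives proportional to \<open>conormal\<close>, hence one projective class, and a local
  equation exists by hypothesis.\<close>

lemma tangential_map_eq:
  assumes p: "(x, y, f (x, y)) \<in> V" and leq: "has_local_equation S (affine_pt B (x, y, f (x, y)))"
    and \<xi>: "k \<noteq> 0" "\<And>Q. \<xi> \<bullet> Q = k * conormal (x, y) Q"
  shows "tangential_map S (affine_pt B (x, y, f (x, y))) = proj \<xi>"
  unfolding tangential_map_def
proof (rule the_equality)
  let ?p = "affine_pt B (x, y, f (x, y))"
  have *: "proj \<eta> = proj \<xi>" if "v \<noteq> 0" "?p = proj v" "local_equation S v W F" "(F has_derivative (\<lambda>h. \<eta> \<bullet> h)) (at v)" for v W F \<eta>
  proof -
    note F = that
    obtain l where l: "l \<noteq> 0" "v = l *\<^sub>R hom B x y (f (x, y)) 1"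
      using proj_eq_chart_point F(1,2) by metis
    let ?d = "frechet_derivative F (at v) (hom B 0 0 1 0)"
    have fd: "frechet_derivative F (at v) = (\<lambda>h. \<eta> \<bullet> h)"
      using frechet_derivative_at[OF F(4)] by simp
    have "\<eta> \<bullet> Q = ?d * conormal (x, y) Q" for Q
      using equation_derivative_formula[OF p refl l F(3), of Q] by (simp add: fd conormal_def)
    then have "\<eta> \<bullet> Q = ((?d / k) *\<^sub>R \<xi>) \<bullet> Q" for Q
      using \<xi> by simp
    then have "\<eta> = (?d / k) *\<^sub>R \<xi>" by (rule inner_eq_imp_eq)
    then show ?thesis
      using proj_scale[of "?d / k" \<xi>] equation_derivative_vertical[OF p refl l F(3)] \<xi>(1) by simp
  qed
  then show "q = proj \<xi>" if "\<exists>v W F \<eta>. v \<noteq> 0 \<and> ?p = proj v \<and> local_equation S v W F \<and> (F has_derivative (\<lambda>h. \<eta> \<bullet> h)) (at v) \<and> q = proj \<eta>" for q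
    using that by blast
  obtain v W F where F: "v \<noteq> 0" "?p = proj v" "local_equation S v W F"
    using leq by (auto simp: has_local_equation_def)
  then have D: "(F has_derivative frechet_derivative F (at v)) (at v)"
    using frechet_derivative_smooth[of W F v] by (auto simp: local_equation_def)
  \<comment> \<open>The adjoint applied to 1 is the vector representing the linear functional
    through the inner product.\<close>
  then have "frechet_derivative F (at v) = (\<lambda>h. adjoint (frechet_derivative F (at v)) 1 \<bullet> h)"
    using adjoint_works[OF has_derivative_linear[OF D], of _ 1] by (auto simp: inner_commute fun_eq_iff)
  with D have D': "(F has_derivative (\<lambda>h. adjoint (frechet_derivative F (at v)) 1 \<bullet> h)) (at v)" by simp
  show "\<exists>v W F \<eta>. v \<noteq> 0 \<and> ?p = proj v \<and> local_equation S v W F \<and> (F has_derivative (\<lambda>h. \<eta> \<bullet> h)) (at v) \<and> proj \<xi> = proj \<eta>"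
    using F D' *[OF F D'] by metis
qed

lemma conormal_vector:
  obtains \<xi> where "\<xi> \<noteq> 0" "\<And>Q. \<xi> \<bullet> Q = conormal p Q"
proof -
  obtain x y where p: "p = (x, y)" by (metis prod.exhaust)
  have "linear (conormal p)"
    unfolding p by (rule linearI) (simp_all add: conormal_def coord_add coord_scale algebra_simps)
  then have *: "adjoint (conormal p) 1 \<bullet> Q = conormal p Q" for Q
    using adjoint_works[of "conormal p" Q 1] by (simp add: inner_commute)
  moreover have "adjoint (conormal p) 1 \<noteq> 0"
    using *[of "hom B 0 0 1 0"] by (auto simp: p conormal_def coord_hom[OF inv])
  ultimately show thesis using that by blast
qed

text \<open>Equal planes give proportional conormals, and the common value 1 on the vertical vector
  forces the factor to be 1. The remaining basis vectors yield the two partial derivatives and the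
  intercept of the tangent plane.\<close>

lemma tangential_map_eqD:
  assumes p: "(x, y, f (x, y)) \<in> V" "has_local_equation S (affine_pt B (x, y, f (x, y)))"
    and q: "(x', y', f (x', y')) \<in> V" "has_local_equation S (affine_pt B (x', y', f (x', y')))"
    and eq: "tangential_map S (affine_pt B (x, y, f (x, y))) = tangential_map S (affine_pt B (x', y', f (x', y')))"
  shows "dir_deriv [(1, 0)] f (x, y) = dir_deriv [(1, 0)] f (x', y')"
    and "dir_deriv [(0, 1)] f (x, y) = dir_deriv [(0, 1)] f (x', y')"
    and "f (x, y) - x * dir_deriv [(1, 0)] f (x, y) - y * dir_deriv [(0, 1)] f (x, y) =
      f (x', y') - x' * dir_deriv [(1, 0)] f (x', y') - y' * dir_deriv [(0, 1)] f (x', y')"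
proof -
  obtain \<xi> where \<xi>: "\<xi> \<noteq> 0" "\<And>Q. \<xi> \<bullet> Q = conormal (x, y) Q" using conormal_vector by blast
  obtain \<eta> where \<eta>: "\<eta> \<noteq> 0" "\<And>Q. \<eta> \<bullet> Q = conormal (x', y') Q" using conormal_vector by blast
  have "proj \<xi> = proj \<eta>"
    using eq tangential_map_eq[OF p, of 1 \<xi>] tangential_map_eq[OF q, of 1 \<eta>] \<xi> \<eta> by simp
  then obtain c where "\<xi> = c *\<^sub>R \<eta>" using proj_eq_iff \<xi> \<eta> by blast
  then have *: "conormal (x, y) Q = c * conormal (x', y') Q" for Q
    using \<xi> \<eta> by (metis inner_scaleR_left)
  have "c = 1"
    using *[of "hom B 0 0 1 0"] by (simp add: conormal_def coord_hom[OF inv])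
  with *[of "hom B 1 0 0 0"] *[of "hom B 0 1 0 0"] *[of "hom B 0 0 0 1"]
  show "dir_deriv [(1, 0)] f (x, y) = dir_deriv [(1, 0)] f (x', y')"
    "dir_deriv [(0, 1)] f (x, y) = dir_deriv [(0, 1)] f (x', y')"
    "f (x, y) - x * dir_deriv [(1, 0)] f (x, y) - y * dir_deriv [(0, 1)] f (x, y) =
      f (x', y') - x' * dir_deriv [(1, 0)] f (x', y') - y' * dir_deriv [(0, 1)] f (x', y')"
    by (simp_all add: conormal_def coord_hom[OF inv])
qed

text \<open>Vanishing derivatives of F become a bound O(|t|^k) for F, then for the height, then in
  the affine parameter of the line, and finally vanishing derivatives of z + s c - f. The
  \<open>if\<close> lists the derivatives at 0 of the affine function z + s c.\<close>

lemma equation_contact_iff: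
  assumes p: "(x, y, z) \<in> V" "z = f (x, y)" and l: "l \<noteq> 0" "v = l *\<^sub>R hom B x y z 1"
    and F: "local_equation S v W F" and w: "w = m *\<^sub>R hom B x y z 1 + hom B a b c 0"
  shows "(\<forall>j<k. (deriv ^^ j) (\<lambda>t. F (v + t *\<^sub>R w)) 0 = 0) \<longleftrightarrow>
    (\<forall>j<k. (if j = 0 then z else if j = 1 then c else 0) = dir_deriv (replicate j (a, b)) f (x, y))"
proof -
  have W: "open W" "v \<in> W" "smooth_on W F" using F by (auto simp: local_equation_def)
  have "open ((\<lambda>t. v + t *\<^sub>R w) -` W)"
    by (intro open_vimage W continuous_intros)
  moreover have "0 \<in> (\<lambda>t. v + t *\<^sub>R w) -` W" using W by simp
  ultimately have "(\<forall>j<k. dir_deriv (replicate j w) F (v + 0 *\<^sub>R w) = 0) \<longleftrightarrow>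
      (\<exists>C. \<forall>\<^sub>F t in nhds 0. \<bar>dir_deriv (replicate 0 w) F (v + t *\<^sub>R w)\<bar> \<le> C * \<bar>t\<bar> ^ k)"
    by (rule vanishing_derivatives_iff_bigo)
      (use smooth_on_line_derivative[OF W(3,1), of v _ w] in auto)
  moreover have "(deriv ^^ j) (\<lambda>t. F (v + t *\<^sub>R w)) 0 = dir_deriv (replicate j w) F (v + 0 *\<^sub>R w)" for j
    using funpow_deriv_line[OF W(3,1), of v 0 w j] W(2) by simp
  ultimately have 1: "(\<forall>j<k. (deriv ^^ j) (\<lambda>t. F (v + t *\<^sub>R w)) 0 = 0) \<longleftrightarrow>
      (\<exists>C. \<forall>\<^sub>F t in nhds 0. \<bar>F (v + t *\<^sub>R w)\<bar> \<le> C * \<bar>t\<bar> ^ k)"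
    by simp
  define g where "g s = z + s * c - f ((x, y) + s *\<^sub>R (a, b))" for s
  have "((\<lambda>t. v + t *\<^sub>R w) \<longlongrightarrow> v + 0 *\<^sub>R w) (nhds 0)"
    by (intro tendsto_intros filterlim_ident)
  then have lim: "((\<lambda>t. v + t *\<^sub>R w) \<longlongrightarrow> v) (nhds 0)" by simp
  obtain c1 C1 where cC: "0 < c1" "0 < C1" "\<forall>\<^sub>F Q in nhds v. c1 * \<bar>height Q\<bar> \<le> \<bar>F Q\<bar> \<and> \<bar>F Q\<bar> \<le> C1 * \<bar>height Q\<bar>"
    using equation_comparable_height[OF p l F] .
  have "((\<lambda>t. l + t * m) \<longlongrightarrow> l + 0 * m) (nhds 0)"
    by (intro tendsto_intros filterlim_ident)
  then have ne: "\<forall>\<^sub>F t in nhds 0. l + t * m \<noteq> 0"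
    by (rule tendsto_imp_eventually_ne) (use l in simp)
  \<comment> \<open>Dividing by the fourth coordinate l + t m turns the homogeneous line into the
    affine one through (x, y, z) with direction (a, b, c) and parameter t / (l + t m).\<close>
  have ht: "height (v + t *\<^sub>R w) = g (t / (l + t * m))" if "l + t * m \<noteq> 0" for t
  proof -
    have "v + t *\<^sub>R w = hom B ((l + t * m) * x + t * a) ((l + t * m) * y + t * b) ((l + t * m) * z + t * c) (l + t * m)"
      unfolding l(2) w by (simp add: hom_scale hom_add scaleR_add_right) (simp add: algebra_simps)
    with that show ?thesis
      by (simp add: height_def coord_hom[OF inv] g_def add_divide_distrib)
  qed
  have bounds: "\<forall>\<^sub>F t in nhds 0. c1 * \<bar>g (t / (l + t * m))\<bar> \<le> \<bar>F (v + t *\<^sub>R w)\<bar> \<and> \<bar>F (v + t *\<^sub>R w)\<bar> \<le> C1 * \<bar>g (t / (l + t * m))\<bar>"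
    using eventually_compose_nhds[OF lim cC(3)] ne
    by eventually_elim (use ht in simp)
  have 2: "(\<exists>C. \<forall>\<^sub>F t in nhds 0. \<bar>F (v + t *\<^sub>R w)\<bar> \<le> C * \<bar>t\<bar> ^ k) \<longleftrightarrow>
      (\<exists>C. \<forall>\<^sub>F t in nhds 0. \<bar>g (t / (l + t * m))\<bar> \<le> C * \<bar>t\<bar> ^ k)"
  proof
    assume "\<exists>C. \<forall>\<^sub>F t in nhds 0. \<bar>F (v + t *\<^sub>R w)\<bar> \<le> C * \<bar>t\<bar> ^ k"
    then obtain C where "\<forall>\<^sub>F t in nhds 0. \<bar>F (v + t *\<^sub>R w)\<bar> \<le> C * \<bar>t\<bar> ^ k" by blast
    with bounds have "\<forall>\<^sub>F t in nhds 0. \<bar>g (t / (l + t * m))\<bar> \<le> (C / c1) * \<bar>t\<bar> ^ k"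
      by eventually_elim (use cC(1) in \<open>simp add: field_simps\<close>)
    then show "\<exists>C. \<forall>\<^sub>F t in nhds 0. \<bar>g (t / (l + t * m))\<bar> \<le> C * \<bar>t\<bar> ^ k" by blast
  next
    assume "\<exists>C. \<forall>\<^sub>F t in nhds 0. \<bar>g (t / (l + t * m))\<bar> \<le> C * \<bar>t\<bar> ^ k"
    then obtain C where "\<forall>\<^sub>F t in nhds 0. \<bar>g (t / (l + t * m))\<bar> \<le> C * \<bar>t\<bar> ^ k" by blast
    with bounds have "\<forall>\<^sub>F t in nhds 0. \<bar>F (v + t *\<^sub>R w)\<bar> \<le> (C1 * C) * \<bar>t\<bar> ^ k"
    proof eventually_elim
      case (elim t)
      then have "\<bar>F (v + t *\<^sub>R w)\<bar> \<le> C1 * \<bar>g (t / (l + t * m))\<bar>" by simp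
      also have "\<dots> \<le> C1 * (C * \<bar>t\<bar> ^ k)" using elim cC(2) by (intro mult_left_mono) auto
      finally show ?case by (simp add: mult.assoc)
    qed
    then show "\<exists>C. \<forall>\<^sub>F t in nhds 0. \<bar>F (v + t *\<^sub>R w)\<bar> \<le> C * \<bar>t\<bar> ^ k" by blast
  qed
  define D where "D j s = (if j = 0 then z + s * c else if j = 1 then c else 0) - dir_deriv (replicate j (a, b)) f ((x, y) + s *\<^sub>R (a, b))" for j s
  have "open ((\<lambda>t. (x, y) + t *\<^sub>R (a, b)) -` U)"
    by (intro open_vimage openU continuous_intros)
  moreover have "0 \<in> (\<lambda>t. (x, y) + t *\<^sub>R (a, b)) -` U" using domain[OF p(1)] by (simp add: zero_prod_def)
  ultimately have "(\<forall>j<k. D j 0 = 0) \<longleftrightarrow> (\<exists>C. \<forall>\<^sub>F s in nhds 0. \<bar>D 0 s\<bar> \<le> C * \<bar>s\<bar> ^ k)"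
  proof (rule vanishing_derivatives_iff_bigo)
    fix j s assume "s \<in> (\<lambda>t. (x, y) + t *\<^sub>R (a, b)) -` U"
    then have "((\<lambda>s. dir_deriv (replicate j (a, b)) f ((x, y) + s *\<^sub>R (a, b))) has_real_derivative
        dir_deriv (replicate (Suc j) (a, b)) f ((x, y) + s *\<^sub>R (a, b))) (at s)"
      using smooth_on_line_derivative[OF smooth openU, of "(x, y)" s "(a, b)" "replicate j (a, b)"] by simp
    moreover have "((\<lambda>s. if j = 0 then z + s * c else if j = 1 then c else 0) has_real_derivative (if Suc j = 1 then c else 0)) (at s)"
      by (auto intro!: derivative_eq_intros)
    ultimately show "(D j has_real_derivative D (Suc j) s) (at s)"
      unfolding D_def[abs_def] using DERIV_diff by fastforce
  qed
  moreover have "D 0 = g" by (simp add: D_def g_def fun_eq_iff)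
  moreover have "D j 0 = 0 \<longleftrightarrow> (if j = 0 then z else if j = 1 then c else 0) = dir_deriv (replicate j (a, b)) f (x, y)" for j
    by (simp add: D_def zero_prod_def[symmetric] del: scaleR_Pair)
  ultimately have 3: "(\<exists>C. \<forall>\<^sub>F s in nhds 0. \<bar>g s\<bar> \<le> C * \<bar>s\<bar> ^ k) \<longleftrightarrow>
     (\<forall>j<k. (if j = 0 then z else if j = 1 then c else 0) = dir_deriv (replicate j (a, b)) f (x, y))"
    by simp
  show ?thesis
    unfolding 1 2 bigo_mobius_substitution[OF l(1)] 3 ..
qed

text \<open>The direction of a line matters only modulo the point, so its fourth coordinate may be
  made 0. Since k is at least 2, the first-order condition is present and fixes the vertical
  component; only the orders from 2 on remain.\<close>

lemma has_contact_iff: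
  assumes p: "(x, y, f (x, y)) \<in> V" and leq: "has_local_equation S (affine_pt B (x, y, f (x, y)))"
    and k: "2 \<le> k"
  shows "has_contact k S (affine_pt B (x, y, f (x, y))) L \<longleftrightarrow>
    (\<exists>a b. (a, b) \<noteq> (0, 0) \<and> L = span {hom B x y (f (x, y)) 1, hom B a b (dir_deriv [(a, b)] f (x, y)) 0} \<and>
      (\<forall>j\<in>{2..<k}. dir_deriv (replicate j (a, b)) f (x, y) = 0))" (is "?L \<longleftrightarrow> ?R")
proof
  let ?z = "f (x, y)"
  assume ?L
  then obtain v w W F where c: "v \<noteq> 0" "affine_pt B (x, y, ?z) = proj v" "L = span {v, w}" "dim L = 2"
    "local_equation S v W F" "\<forall>j<k. (deriv ^^ j) (\<lambda>t. F (v + t *\<^sub>R w)) 0 = 0"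
    unfolding has_contact_def by blast
  obtain l where l: "l \<noteq> 0" "v = l *\<^sub>R hom B x y ?z 1"
    using proj_eq_chart_point c(1,2) by metis
  \<comment> \<open>Subtracting \<open>m = coord B 4 w\<close> times the point removes the fourth
    coordinate of w.\<close>
  define m a b c' where m: "m = coord B 4 w" "a = coord B 1 w - m * x" "b = coord B 2 w - m * y" "c' = coord B 3 w - m * ?z"
  have w: "w = m *\<^sub>R hom B x y ?z 1 + hom B a b c' 0"
    by (subst hom_coord[OF inv, of w, symmetric]) (simp add: hom_scale hom_add hom_eq_iff[OF inv] m)
  have *: "(if j = 0 then ?z else if j = 1 then c' else 0) = dir_deriv (replicate j (a, b)) f (x, y)" if "j < k" for j
    using c(6) equation_contact_iff[OF p refl l c(5) w, of k] that by blast
  have c': "c' = dir_deriv [(a, b)] f (x, y)" using *[of 1] k by simp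
  have L: "L = span {hom B x y ?z 1, hom B a b c' 0}"
    unfolding c(3) l(2) w by (rule span_scaled_pair[OF l(1)])
  \<comment> \<open>A vanishing (a, b) would make the vertical component 0 too, and L would shrink
    to the span of a single vector.\<close>
  have "(a, b) \<noteq> (0, 0)"
  proof
    assume 0: "(a, b) = (0, 0)"
    then have "c' = 0"
      using c' linear_0[OF has_derivative_linear[OF smooth_on_has_derivative[OF smooth openU domain[OF p], of "[]"]]] by (simp add: zero_prod_def)
    with 0 L have "L = span {hom B x y ?z 1}"
      by (simp add: insert_commute)
    moreover have "dim {hom B x y ?z 1} \<le> card {hom B x y ?z 1}" by (intro dim_le_card') auto
    ultimately show False using c(4) by simp
  qed
  moreover have "dir_deriv (replicate j (a, b)) f (x, y) = 0" if "j \<in> {2..<k}" for j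
    using *[of j] that by simp
  ultimately show ?R using L unfolding c' by blast
next
  let ?z = "f (x, y)"
  assume ?R
  then obtain a b where ab: "(a, b) \<noteq> (0, 0)"
    "L = span {hom B x y (f (x, y)) 1, hom B a b (dir_deriv [(a, b)] f (x, y)) 0}"
    "\<forall>j\<in>{2..<k}. dir_deriv (replicate j (a, b)) f (x, y) = 0" by blast
  obtain v W F where F: "v \<noteq> 0" "affine_pt B (x, y, ?z) = proj v" "local_equation S v W F"
    using leq by (auto simp: has_local_equation_def)
  obtain l where l: "l \<noteq> 0" "v = l *\<^sub>R hom B x y ?z 1"
    using proj_eq_chart_point F(1,2) by metis
  define c where "c = dir_deriv [(a, b)] f (x, y)"
  let ?w = "hom B a b c 0"
  have w: "?w = 0 *\<^sub>R hom B x y ?z 1 + hom B a b c 0" by simp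
  have "\<forall>j<k. (if j = 0 then ?z else if j = 1 then c else 0) = dir_deriv (replicate j (a, b)) f (x, y)"
    using ab(3) by (auto simp: c_def)
  then have van: "\<forall>j<k. (deriv ^^ j) (\<lambda>t. F (v + t *\<^sub>R ?w)) 0 = 0"
    using equation_contact_iff[OF p refl l F(3) w, of k] by blast
  have "span {v, ?w} = span {hom B x y ?z 1, hom B a b c 0}"
    using span_scaled_pair[OF l(1), of "hom B x y ?z 1" 0 ?w] by (simp add: l(2))
  moreover have "dim (span {hom B x y ?z 1, hom B a b c 0}) = 2"
  proof (rule span_pair_dim)
    show "hom B x y ?z 1 \<noteq> 0" by (simp add: hom_eq_0_iff[OF inv])
    show "hom B a b c 0 \<notin> span {hom B x y ?z 1}"
      using ab(1) by (auto simp: span_singleton hom_scale hom_eq_iff[OF inv])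
  qed
  ultimately have "L = span {v, ?w}" "dim L = 2" using ab(2) by (simp_all add: c_def)
  then show ?L unfolding has_contact_def using F van by blast
qed

end

section \<open>Asymptotic directions of a graph\<close>

lemma dir_deriv_cong_open:
  assumes "open U" "\<And>x. x \<in> U \<Longrightarrow> f x = g x" "x \<in> U"
  shows "dir_deriv vs f x = dir_deriv vs g x"
  using assms(3)
proof (induction vs arbitrary: x)
  case (Cons v vs)
  have "frechet_derivative (dir_deriv vs f) (at x) = frechet_derivative (dir_deriv vs g) (at x)"
    using Cons by (intro frechet_derivative_cong_open[OF assms(1)])
  then show ?case by simp
qed (use assms(2) in simp)

lemma dir_deriv_lincomb:
  fixes g h :: "'a::real_normed_vector \<Rightarrow> real"
  assumes "open U" "smooth_on U g" "smooth_on U h" "x \<in> U"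
  shows "dir_deriv vs (\<lambda>x. a * g x + b * h x) x = a * dir_deriv vs g x + b * dir_deriv vs h x"
  using assms(4)
proof (induction vs arbitrary: x)
  case (Cons v vs)
  have "((\<lambda>x. a * dir_deriv vs g x + b * dir_deriv vs h x) has_derivative
      (\<lambda>v. a * dir_deriv (v # vs) g x + b * dir_deriv (v # vs) h x)) (at x)"
    using smooth_on_has_derivative[OF assms(2,1) Cons.prems] smooth_on_has_derivative[OF assms(3,1) Cons.prems]
    by (intro has_derivative_add has_derivative_mult_right)
  from frechet_derivative_at[OF this, symmetric]
  have "dir_deriv [v] (\<lambda>x. a * dir_deriv vs g x + b * dir_deriv vs h x) x =
      a * dir_deriv (v # vs) g x + b * dir_deriv (v # vs) h x"
    by simp
  moreover have "dir_deriv (v # vs) (\<lambda>x. a * g x + b * h x) x =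
      dir_deriv [v] (\<lambda>x. a * dir_deriv vs g x + b * dir_deriv vs h x) x"
    using frechet_derivative_cong_open[OF assms(1) Cons.prems Cons.IH] by simp
  ultimately show ?case by simp
qed simp

lemma dir_deriv_add:
  fixes g h :: "'a::real_normed_vector \<Rightarrow> real"
  assumes "open U" "smooth_on U g" "smooth_on U h" "x \<in> U"
  shows "dir_deriv vs (\<lambda>x. g x + h x) x = dir_deriv vs g x + dir_deriv vs h x"
  using dir_deriv_lincomb[OF assms, of vs 1 1] by simp

text \<open>Linearity in one slot, with arbitrary lists on either side. Expansions by it keep the
  mixed derivatives in both orders, so later formulas carry their sum instead of appealing to
  symmetry.\<close>

lemma dir_deriv_linear_arg:
  fixes f :: "real \<times> real \<Rightarrow> real"
  assumes "open U" "smooth_on U f" "p \<in> U"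
  shows "dir_deriv (vs @ (a, b) # ws) f p = a * dir_deriv (vs @ (1, 0) # ws) f p + b * dir_deriv (vs @ (0, 1) # ws) f p"
proof -
  have *: "dir_deriv ((a, b) # ws) f q = a * dir_deriv ((1, 0) # ws) f q + b * dir_deriv ((0, 1) # ws) f q" if "q \<in> U" for q
  proof -
    have lin: "linear (\<lambda>v. dir_deriv (v # ws) f q)"
      by (rule has_derivative_linear[OF smooth_on_has_derivative[OF assms(2,1) that]])
    have "(a, b) = a *\<^sub>R (1, 0) + b *\<^sub>R (0, 1::real)" by simp
    then show ?thesis
      using linear_add[OF lin, of "a *\<^sub>R (1, 0)" "b *\<^sub>R (0, 1)"] linear_scale[OF lin] by (metis real_scaleR_def)
  qed
  have "dir_deriv vs (dir_deriv ((a, b) # ws) f) p =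
      dir_deriv vs (\<lambda>q. a * dir_deriv ((1, 0) # ws) f q + b * dir_deriv ((0, 1) # ws) f q) p"
    by (rule dir_deriv_cong_open[OF assms(1) * assms(3)])
  also have "\<dots> = a * dir_deriv vs (dir_deriv ((1, 0) # ws) f) p + b * dir_deriv vs (dir_deriv ((0, 1) # ws) f) p"
    by (intro dir_deriv_lincomb[OF assms(1) _ _ assms(3)] smooth_on_dir_deriv assms)
  finally show ?thesis by (simp only: dir_deriv_append)
qed

lemma dir_deriv_replicate_scale:
  fixes f :: "'a::real_normed_vector \<Rightarrow> real"
  assumes "open U" "smooth_on U f" "p \<in> U"
  shows "dir_deriv (replicate j (c *\<^sub>R v)) f p = c ^ j * dir_deriv (replicate j v) f p"
  using assms(3)
proof (induction j arbitrary: p)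
  case (Suc j)
  have "dir_deriv (replicate (Suc j) (c *\<^sub>R v)) f p = frechet_derivative (dir_deriv (replicate j (c *\<^sub>R v)) f) (at p) (c *\<^sub>R v)"
    by simp
  also have "\<dots> = dir_deriv [c *\<^sub>R v] (\<lambda>q. c ^ j * dir_deriv (replicate j v) f q + 0 * f q) p"
    using frechet_derivative_cong_open[OF assms(1) Suc.prems Suc.IH] by simp
  also have "\<dots> = c ^ j * dir_deriv ((c *\<^sub>R v) # replicate j v) f p"
    by (subst dir_deriv_lincomb[OF assms(1) smooth_on_dir_deriv assms(2)]) (use assms Suc.prems in auto)
  also have "dir_deriv ((c *\<^sub>R v) # replicate j v) f p = c * dir_deriv (v # replicate j v) f p"
    using linear_scale[OF has_derivative_linear[OF smooth_on_has_derivative[OF assms(2,1) Suc.prems]]] by simp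
  finally show ?case by simp
qed simp

lemma ex1_iff_card: "(\<exists>!x. P x) \<longleftrightarrow> card {x. P x} = 1"
  unfolding One_nat_def card_1_singleton_iff set_eq_iff by auto

lemma quadratic_roots:
  fixes a b c :: real
  assumes "c \<noteq> 0"
  shows "(\<exists>!m. a + b * m + c * m\<^sup>2 = 0) \<longleftrightarrow> b\<^sup>2 = 4 * a * c"
    and "card {m. a + b * m + c * m\<^sup>2 = 0} = 2 \<longleftrightarrow> b\<^sup>2 > 4 * a * c"
proof -
  define d where "d = b\<^sup>2 - 4 * a * c"
  have sq: "a + b * m + c * m\<^sup>2 = 0 \<longleftrightarrow> (2 * c * m + b)\<^sup>2 = d" for m
  proof -
    have "(2 * c * m + b)\<^sup>2 - d = 4 * c * (a + b * m + c * m\<^sup>2)"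
      by (simp add: d_def power2_eq_square algebra_simps)
    then show ?thesis using assms by (metis eq_iff_diff_eq_0 mult_eq_0_iff zero_neq_numeral)
  qed
  have roots: "{m. a + b * m + c * m\<^sup>2 = 0} = {(- b + sqrt d) / (2 * c), (- b - sqrt d) / (2 * c)}" if "d \<ge> 0"
  proof -
    have "(2 * c * m + b)\<^sup>2 = d \<longleftrightarrow> 2 * c * m + b = sqrt d \<or> 2 * c * m + b = - sqrt d" for m
      using that by (metis real_sqrt_pow2 power2_eq_iff)
    moreover have "2 * c * m + b = s \<longleftrightarrow> m = (- b + s) / (2 * c)" for m s
      using assms by (auto simp: field_simps)
    ultimately show ?thesis unfolding sq by auto
  qed
  have none: "{m. a + b * m + c * m\<^sup>2 = 0} = {}" if "d < 0"
    unfolding sq using that by (auto simp: not_less[symmetric])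
  have ne: "(- b + sqrt d) / (2 * c) = (- b - sqrt d) / (2 * c) \<longleftrightarrow> d = 0"
    using assms by (auto simp: field_simps)
  have 1: "card {m. a + b * m + c * m\<^sup>2 = 0} = (if d < 0 then 0 else if d = 0 then 1 else 2)"
    using roots none ne by (auto simp: card_insert_if)
  then show "(\<exists>!m. a + b * m + c * m\<^sup>2 = 0) \<longleftrightarrow> b\<^sup>2 = 4 * a * c"
    unfolding ex1_iff_card by (auto simp: d_def)
  from 1 show "card {m. a + b * m + c * m\<^sup>2 = 0} = 2 \<longleftrightarrow> b\<^sup>2 > 4 * a * c"
    by (auto simp: d_def)
qed

context graph_chart
begin

text \<open>Tangent lines over directions (1, m). The direction (0, 1) is left out; it is not
  asymptotic wherever the second y-derivative of f is nonzero, which holds near the origin of a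
  normal form.\<close>

definition tangent_line :: "real \<times> real \<Rightarrow> real \<Rightarrow> (real^4) set" where
  "tangent_line p m = span {hom B (fst p) (snd p) (f p) 1, hom B 1 m (dir_deriv [(1, m)] f p) 0}"

lemma tangent_line_inj: "tangent_line p m = tangent_line p n \<longleftrightarrow> m = n"
proof
  assume "tangent_line p m = tangent_line p n"
  then have "hom B 1 m (dir_deriv [(1, m)] f p) 0 \<in> tangent_line p n"
    unfolding tangent_line_def by (metis insertI1 insertI2 span_base)
  then obtain k l where "hom B 1 m (dir_deriv [(1, m)] f p) 0 =
      k *\<^sub>R hom B (fst p) (snd p) (f p) 1 + l *\<^sub>R hom B 1 n (dir_deriv [(1, n)] f p) 0"
    unfolding tangent_line_def span_breakdown_eq by (auto simp: span_singleton algebra_simps)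
  then show "m = n" by (auto simp: hom_scale hom_add hom_eq_iff[OF inv])
qed simp

text \<open>As k is at least 3, the second-order condition is available; by \<open>nd\<close> it
  fails for (0, 1), so every admissible direction can be scaled to (1, m).\<close>

lemma has_contact_slope_iff:
  assumes p: "(x, y, f (x, y)) \<in> V" and leq: "has_local_equation S (affine_pt B (x, y, f (x, y)))"
    and k: "3 \<le> k" and nd: "dir_deriv [(0, 1), (0, 1)] f (x, y) \<noteq> 0"
  shows "has_contact k S (affine_pt B (x, y, f (x, y))) L \<longleftrightarrow>
    (\<exists>m. L = tangent_line (x, y) m \<and> (\<forall>j\<in>{2..<k}. dir_deriv (replicate j (1, m)) f (x, y) = 0))" (is "?L \<longleftrightarrow> ?R")
proof
  have k2: "2 \<le> k" using k by simp
  show ?L if ?R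
    using that unfolding has_contact_iff[OF p leq k2] tangent_line_def by fastforce
  assume ?L
  then obtain a b where ab: "(a, b) \<noteq> (0, 0)"
    "L = span {hom B x y (f (x, y)) 1, hom B a b (dir_deriv [(a, b)] f (x, y)) 0}"
    "\<And>j. j \<in> {2..<k} \<Longrightarrow> dir_deriv (replicate j (a, b)) f (x, y) = 0"
    unfolding has_contact_iff[OF p leq k2] by blast
  note scale = dir_deriv_replicate_scale[OF openU smooth domain[OF p]]
  have "a \<noteq> 0"
  proof
    assume "a = 0"
    then have "dir_deriv (replicate 2 (b *\<^sub>R (0, 1))) f (x, y) = 0" using ab(3)[of 2] k by simp
    then have "b ^ 2 * dir_deriv (replicate 2 (0, 1)) f (x, y) = 0" by (simp only: scale)
    then show False using nd ab(1) \<open>a = 0\<close> by (simp add: numeral_2_eq_2)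
  qed
  then have ab_eq: "(a, b) = a *\<^sub>R (1, b / a)" by simp
  have "dir_deriv (replicate j (1, b / a)) f (x, y) = 0" if "j \<in> {2..<k}" for j
    using ab(3)[OF that] \<open>a \<noteq> 0\<close> unfolding ab_eq scale by simp
  moreover have "L = tangent_line (x, y) (b / a)"
  proof -
    have "dir_deriv [(a, b)] f (x, y) = a * dir_deriv [(1, b / a)] f (x, y)"
      using scale[of 1 a "(1, b / a)"] ab_eq by simp
    then have "hom B a b (dir_deriv [(a, b)] f (x, y)) 0 = a *\<^sub>R hom B 1 (b / a) (dir_deriv [(1, b / a)] f (x, y)) 0"
      using \<open>a \<noteq> 0\<close> by (simp add: hom_scale)
    then show ?thesis
      using ab(2) span_scaled_pair[OF \<open>a \<noteq> 0\<close>, of "hom B 1 (b / a) (dir_deriv [(1, b / a)] f (x, y)) 0" 0 "hom B x y (f (x, y)) 1"]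
      by (simp add: tangent_line_def insert_commute)
  qed
  ultimately show ?R by blast
qed

lemma second_form_expand:
  assumes "p \<in> U"
  shows "dir_deriv [(1, m), (1, m)] f p = dir_deriv [(1, 0), (1, 0)] f p +
    (dir_deriv [(1, 0), (0, 1)] f p + dir_deriv [(0, 1), (1, 0)] f p) * m + dir_deriv [(0, 1), (0, 1)] f p * m\<^sup>2"
  using dir_deriv_linear_arg[OF openU smooth assms, of "[]" 1 m "[(1, m)]"]
    dir_deriv_linear_arg[OF openU smooth assms, of "[(1, 0)]" 1 m "[]"]
    dir_deriv_linear_arg[OF openU smooth assms, of "[(0, 1)]" 1 m "[]"]
  by (simp add: algebra_simps power2_eq_square)

lemma asymptotic_lines_iff:
  assumes p: "(x, y, f (x, y)) \<in> V" and leq: "has_local_equation S (affine_pt B (x, y, f (x, y)))"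
    and nd: "dir_deriv [(0, 1), (0, 1)] f (x, y) \<noteq> 0"
  shows "L \<in> asymptotic_lines S (affine_pt B (x, y, f (x, y))) \<longleftrightarrow>
     (\<exists>m. L = tangent_line (x, y) m \<and> dir_deriv [(1, m), (1, m)] f (x, y) = 0)"
proof -
  have "{2..<3::nat} = {2}" by auto
  then show ?thesis
    unfolding asymptotic_lines_def mem_Collect_eq has_contact_slope_iff[OF p leq order_refl nd]
    by (simp add: numeral_2_eq_2)
qed

text \<open>Asymptotic lines correspond injectively to the roots m of a quadratic with nonzero
  leading coefficient, and \<open>h\<close> is its discriminant.\<close>

lemma asymptotic_count:
  assumes p: "(x, y, f (x, y)) \<in> V" and leq: "has_local_equation S (affine_pt B (x, y, f (x, y)))"
    and nd: "dir_deriv [(0, 1), (0, 1)] f (x, y) \<noteq> 0"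
  defines "h \<equiv> (dir_deriv [(1, 0), (0, 1)] f (x, y) + dir_deriv [(0, 1), (1, 0)] f (x, y))\<^sup>2
    - 4 * dir_deriv [(1, 0), (1, 0)] f (x, y) * dir_deriv [(0, 1), (0, 1)] f (x, y)"
  shows "affine_pt B (x, y, f (x, y)) \<in> parabolic_curve S \<longleftrightarrow> h = 0"
    and "affine_pt B (x, y, f (x, y)) \<in> hyperbolic_domain S \<longleftrightarrow> h > 0"
proof -
  let ?p = "affine_pt B (x, y, f (x, y))"
  have S: "?p \<in> S" using graph[OF p] by simp
  let ?R = "{m. dir_deriv [(1, m), (1, m)] f (x, y) = 0}"
  have A: "asymptotic_lines S ?p = tangent_line (x, y) ` ?R"
    using asymptotic_lines_iff[OF p leq nd] by auto
  have card: "card (asymptotic_lines S ?p) = card ?R"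
    unfolding A by (intro card_image) (simp add: inj_on_def tangent_line_inj)
  define a b c where abc: "a = dir_deriv [(1, 0), (1, 0)] f (x, y)"
    "b = dir_deriv [(1, 0), (0, 1)] f (x, y) + dir_deriv [(0, 1), (1, 0)] f (x, y)"
    "c = dir_deriv [(0, 1), (0, 1)] f (x, y)"
  have q: "dir_deriv [(1, m), (1, m)] f (x, y) = a + b * m + c * m\<^sup>2" for m
    unfolding abc by (rule second_form_expand[OF domain[OF p]])
  have c: "c \<noteq> 0" using nd by (simp only: abc not_False_eq_True)
  have h: "h = b\<^sup>2 - 4 * a * c" by (simp only: abc h_def)
  have "?p \<in> parabolic_curve S \<longleftrightarrow> card (asymptotic_lines S ?p) = 1"
    using S by (auto simp: parabolic_curve_def card_1_singleton_iff)
  also have "\<dots> \<longleftrightarrow> (\<exists>!m. dir_deriv [(1, m), (1, m)] f (x, y) = 0)"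
    unfolding card ex1_iff_card ..
  also have "\<dots> \<longleftrightarrow> h = 0"
    unfolding q quadratic_roots(1)[OF c] h by simp
  finally show "?p \<in> parabolic_curve S \<longleftrightarrow> h = 0" .
  have "?p \<in> hyperbolic_domain S \<longleftrightarrow> card ?R = 2"
    using S by (simp add: hyperbolic_domain_def card)
  also have "\<dots> \<longleftrightarrow> h > 0"
    unfolding q quadratic_roots(2)[OF c] h by simp
  finally show "?p \<in> hyperbolic_domain S \<longleftrightarrow> h > 0" .
qed

end

section \<open>Derivatives of the normal form\<close>

definition nf_poly :: "real \<Rightarrow> real \<times> real \<Rightarrow> real" where
  "nf_poly r = normal_form_fun r (\<lambda>_. 0)"

lemma nf_poly_smooth: "open U \<Longrightarrow> smooth_on U (nf_poly r)"
  unfolding nf_poly_def normal_form_fun_def case_prod_beta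
  by (intro smooth_on_intros smooth_on_fst smooth_on_snd)

lemma nf_poly_deriv1:
  "dir_deriv [(a, b)] (nf_poly r) = (\<lambda>p. snd p * b - 2 * fst p * a * snd p - (fst p)\<^sup>2 * b + 2 * r * fst p ^ 3 * a)"
proof
  fix p :: "real \<times> real"
  have "(nf_poly r has_derivative (\<lambda>v. snd p * snd v - 2 * fst p * fst v * snd p - (fst p)\<^sup>2 * snd v + 2 * r * fst p ^ 3 * fst v)) (at p)"
    unfolding nf_poly_def normal_form_fun_def case_prod_beta
    by (auto intro!: derivative_eq_intros simp: fun_eq_iff algebra_simps power2_eq_square power3_eq_cube)
  from frechet_derivative_at[OF this, symmetric]
  show "dir_deriv [(a, b)] (nf_poly r) p = snd p * b - 2 * fst p * a * snd p - (fst p)\<^sup>2 * b + 2 * r * fst p ^ 3 * a"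
    by simp
qed

lemma nf_poly_deriv2:
  "dir_deriv [(c, d), (a, b)] (nf_poly r) =
    (\<lambda>p. d * b - 2 * c * a * snd p - 2 * fst p * a * d - 2 * fst p * c * b + 6 * r * (fst p)\<^sup>2 * a * c)"
proof
  fix p :: "real \<times> real"
  have "(dir_deriv [(a, b)] (nf_poly r) has_derivative (\<lambda>v. snd v * b - 2 * fst v * a * snd p - 2 * fst p * a * snd v
      - 2 * fst p * fst v * b + 6 * r * (fst p)\<^sup>2 * a * fst v)) (at p)"
    unfolding nf_poly_deriv1
    by (auto intro!: derivative_eq_intros simp: fun_eq_iff algebra_simps power2_eq_square power3_eq_cube)
  from frechet_derivative_at[OF this, symmetric]
  show "dir_deriv [(c, d), (a, b)] (nf_poly r) p =
      d * b - 2 * c * a * snd p - 2 * fst p * a * d - 2 * fst p * c * b + 6 * r * (fst p)\<^sup>2 * a * c"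
    unfolding dir_deriv.simps(2)[of "(c, d)" "[(a, b)]"] by simp
qed

lemma nf_poly_deriv3:
  "dir_deriv [(e, g), (c, d), (a, b)] (nf_poly r) =
    (\<lambda>p. - 2 * c * a * g - 2 * e * a * d - 2 * e * c * b + 12 * r * fst p * e * a * c)"
proof
  fix p :: "real \<times> real"
  have "(dir_deriv [(c, d), (a, b)] (nf_poly r) has_derivative (\<lambda>v. - 2 * c * a * snd v - 2 * fst v * a * d
      - 2 * fst v * c * b + 12 * r * fst p * a * c * fst v)) (at p)"
    unfolding nf_poly_deriv2
    by (auto intro!: derivative_eq_intros simp: fun_eq_iff algebra_simps power2_eq_square)
  from frechet_derivative_at[OF this, symmetric]
  show "dir_deriv [(e, g), (c, d), (a, b)] (nf_poly r) p =
      - 2 * c * a * g - 2 * e * a * d - 2 * e * c * b + 12 * r * fst p * e * a * c"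
    unfolding dir_deriv.simps(2)[of "(e, g)"] by simp
qed

lemma normal_form_fun_split: "normal_form_fun r \<phi> = (\<lambda>p. nf_poly r p + \<phi> p)"
  by (auto simp: normal_form_fun_def nf_poly_def)

lemma normal_form_smooth: "open U \<Longrightarrow> smooth_on U \<phi> \<Longrightarrow> smooth_on U (normal_form_fun r \<phi>)"
  unfolding normal_form_fun_split by (intro smooth_on_add nf_poly_smooth)

lemma normal_form_derivs:
  assumes "open U" "smooth_on U \<phi>" "p \<in> U"
  shows "dir_deriv vs (normal_form_fun r \<phi>) p = dir_deriv vs (nf_poly r) p + dir_deriv vs \<phi> p"
  unfolding normal_form_fun_split by (intro dir_deriv_add[OF assms(1)] nf_poly_smooth assms)

section \<open>The parabolic and flecnodal coefficients\<close>

lemma eventually_zero_limit: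
  fixes f :: "real \<Rightarrow> real"
  assumes "(f \<longlongrightarrow> l) (at a)" "\<forall>\<^sub>F x in at a. f x = 0"
  shows "l = 0"
  using tendsto_unique[OF trivial_limit_at assms(1)] tendsto_cong[OF assms(2)] tendsto_const by metis

text \<open>Downward induction on the order of the derivative. At order n continuity gives
  smallness; below it, the mean value theorem on the segment from the origin gains one power of the
  norm, because the derivative vanishes at the origin.\<close>

lemma vanishing_jet_bound:
  fixes \<phi> :: "real \<times> real \<Rightarrow> real"
  assumes "open U" "smooth_on U \<phi>" "0 \<in> U" and jet: "\<And>vs. length vs \<le> n \<Longrightarrow> dir_deriv vs \<phi> 0 = 0"
    and "length vs \<le> n" "0 < \<epsilon>"
  shows "\<forall>\<^sub>F q in nhds 0. \<bar>dir_deriv vs \<phi> q\<bar> \<le> \<epsilon> * norm q ^ (n - length vs)"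
  using assms(5,6)
proof (induction "n - length vs" arbitrary: vs \<epsilon>)
  case 0
  have "(dir_deriv vs \<phi> \<longlongrightarrow> dir_deriv vs \<phi> 0) (nhds 0)"
    using smooth_on_continuous[OF assms(2,1,3), of vs] by (metis continuous_at tendsto_at_iff_tendsto_nhds)
  then have "\<forall>\<^sub>F q in nhds 0. dist (dir_deriv vs \<phi> q) 0 < \<epsilon>"
    using jet[of vs] 0 by (intro tendstoD) auto
  then show ?case
    by eventually_elim (use 0 in auto)
next
  case (Suc k)
  have k: "k = n - length (v # vs)" "length (v # vs) \<le> n" for v :: "real \<times> real" using Suc.hyps(2) by auto
  \<comment> \<open>One half for each partial derivative, since both coordinates of q are bounded by
    its norm.\<close>
  have "0 < \<epsilon> / 2" using Suc.prems by simp
  from eventually_conj[OF Suc.hyps(1)[OF k this, of "(1, 0)"] Suc.hyps(1)[OF k this, of "(0, 1)"]]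
  have "\<forall>\<^sub>F q in nhds 0. q \<in> U \<and> \<bar>dir_deriv ((1, 0) # vs) \<phi> q\<bar> \<le> \<epsilon> / 2 * norm q ^ k \<and>
      \<bar>dir_deriv ((0, 1) # vs) \<phi> q\<bar> \<le> \<epsilon> / 2 * norm q ^ k"
    using eventually_nhds_in_open[OF assms(1,3)] k by (auto elim: eventually_elim2)
  then obtain d where d: "d > 0" "\<And>q. norm q < d \<Longrightarrow> q \<in> U \<and> \<bar>dir_deriv ((1, 0) # vs) \<phi> q\<bar> \<le> \<epsilon> / 2 * norm q ^ k \<and>
      \<bar>dir_deriv ((0, 1) # vs) \<phi> q\<bar> \<le> \<epsilon> / 2 * norm q ^ k"
    unfolding eventually_nhds_metric by (auto simp: dist_norm)
  have "\<bar>dir_deriv vs \<phi> q\<bar> \<le> \<epsilon> * norm q ^ Suc k" if q: "norm q < d" for q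
  proof -
    have seg: "norm (0 + s *\<^sub>R q) < d" if "0 \<le> s" "s \<le> 1" for s
      using q that mult_left_le_one_le[of "norm q" s] by simp
    have "\<exists>s>0. s < 1 \<and> dir_deriv vs \<phi> (0 + 1 *\<^sub>R q) - dir_deriv vs \<phi> (0 + 0 *\<^sub>R q) =
        (1 - 0) * dir_deriv (q # vs) \<phi> (0 + s *\<^sub>R q)"
      using smooth_on_line_derivative[OF assms(2,1), of 0 _ q vs] d(2)[OF seg] by (intro MVT2) auto
    then obtain s where s: "0 < s" "s < 1" "dir_deriv vs \<phi> q = dir_deriv (q # vs) \<phi> (s *\<^sub>R q)"
      using jet[of vs] Suc.prems by auto
    have sq: "norm (s *\<^sub>R q) < d" using seg[of s] s by simp
    have "norm (s *\<^sub>R q) \<le> norm q" using s mult_left_le_one_le[of "norm q" s] by simp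
    then have le: "\<epsilon> / 2 * norm (s *\<^sub>R q) ^ k \<le> \<epsilon> / 2 * norm q ^ k"
      using Suc.prems by (intro mult_left_mono power_mono) auto
    obtain a b where ab: "q = (a, b)" by (metis prod.exhaust)
    have "dir_deriv vs \<phi> q = a * dir_deriv ((1, 0) # vs) \<phi> (s *\<^sub>R q) + b * dir_deriv ((0, 1) # vs) \<phi> (s *\<^sub>R q)"
      using dir_deriv_linear_arg[OF assms(1,2), of "s *\<^sub>R q" "[]" a b vs] d(2)[OF sq] s(3) unfolding ab by simp
    also have "\<bar>\<dots>\<bar> \<le> \<bar>a\<bar> * (\<epsilon> / 2 * norm q ^ k) + \<bar>b\<bar> * (\<epsilon> / 2 * norm q ^ k)"
      unfolding abs_mult[symmetric]
      by (intro order_trans[OF abs_triangle_ineq] add_mono)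
        (simp_all only: abs_mult, (intro mult_left_mono order_trans[OF _ le] abs_ge_zero; use d(2)[OF sq] in blast)+)
    also have "\<dots> \<le> norm q * (\<epsilon> / 2 * norm q ^ k) + norm q * (\<epsilon> / 2 * norm q ^ k)"
      using norm_fst_le[of a b] norm_snd_le[of b a] Suc.prems by (intro add_mono mult_right_mono) (auto simp: ab)
    finally show ?thesis by (simp add: algebra_simps)
  qed
  then have "\<forall>\<^sub>F q in nhds 0. \<bar>dir_deriv vs \<phi> q\<bar> \<le> \<epsilon> * norm q ^ Suc k"
    unfolding eventually_nhds_metric using d(1) by (auto simp: dist_norm)
  then show ?case using Suc.hyps(2) by simp
qed

lemma two_jet_bound:
  fixes h :: "real \<Rightarrow> real"
  assumes "0 < \<epsilon>" "smooth_on {-\<epsilon><..<\<epsilon>} h" "h 0 = 0" "deriv h 0 = 0" "deriv (deriv h) 0 = 2 * c"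
  obtains C where "\<forall>\<^sub>F x in nhds 0. \<bar>h x - c * x\<^sup>2\<bar> \<le> C * \<bar>x\<bar> ^ 3"
proof -
  let ?T = "{-\<epsilon><..<\<epsilon>}"
  \<comment> \<open>The successive derivatives of \<open>c * x\<^sup>2\<close>. The difference D
    then has zero 2-jet, which is exactly the three conditions j < 3.\<close>
  define P where "P j x = (if j = 0 then c * x\<^sup>2 else if j = 1 then 2 * c * x else if j = 2 then 2 * c else 0)" for j :: nat and x
  have P: "(P j has_real_derivative P (Suc j) x) (at x)" for j x
  proof -
    consider "j = 0" | "j = 1" | "j = 2" | "j > 2" by linarith
    then show ?thesis by cases (auto simp: P_def[abs_def] intro!: derivative_eq_intros)
  qed
  define D where "D j x = dir_deriv (replicate j 1) h x - P j x" for j x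
  have D: "(D j has_real_derivative D (Suc j) x) (at x)" if "x \<in> ?T" for j x
    unfolding D_def[abs_def]
    using smooth_on_line_derivative[OF assms(2) _, of 0 x 1 "replicate j 1"] that P
    by (intro DERIV_diff) auto
  have dh: "(deriv ^^ j) h 0 = dir_deriv (replicate j 1) h 0" for j
    using funpow_deriv_line[OF assms(2), of 0 0 1 j] assms(1) by simp
  have "D j 0 = 0" if "j < 3" for j
  proof -
    have "j = 0 \<or> j = 1 \<or> j = 2" using that by auto
    then show ?thesis
      using dh[of j] assms(3-5) by (auto simp: D_def P_def numeral_2_eq_2)
  qed
  then obtain C where "\<forall>\<^sub>F t in nhds 0. \<bar>D 0 t\<bar> \<le> C * \<bar>t\<bar> ^ 3"
    using vanishing_derivatives_iff_bigo[of ?T D 3] D assms(1) by auto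
  then show thesis using that by (simp add: D_def P_def)
qed

text \<open>What the later limits need from a curve with a given 2-jet: its leading coefficient, and
  a bound converting powers of the norm of (x, h x) into powers of x.\<close>

lemma two_jet_limits:
  fixes h :: "real \<Rightarrow> real"
  assumes "0 < \<epsilon>" "smooth_on {-\<epsilon><..<\<epsilon>} h" "h 0 = 0" "deriv h 0 = 0" "deriv (deriv h) 0 = 2 * c"
  shows "((\<lambda>x. h x / x\<^sup>2) \<longlongrightarrow> c) (at 0)" "(h \<longlongrightarrow> 0) (at 0)"
    "\<forall>\<^sub>F x in at 0. norm (x, h x) \<le> 2 * \<bar>x\<bar>" "((\<lambda>x. (x, h x)) \<longlongrightarrow> 0) (at 0)"
proof -
  obtain C where C: "\<forall>\<^sub>F x in nhds 0. \<bar>h x - c * x\<^sup>2\<bar> \<le> C * \<bar>x\<bar> ^ 3"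
    using two_jet_bound[OF assms] .
  have ne: "\<forall>\<^sub>F x::real in at 0. x \<noteq> 0" by (simp add: eventually_at_filter)
  have "\<forall>\<^sub>F x in at 0. \<bar>h x / x\<^sup>2 - c\<bar> \<le> C * \<bar>x\<bar>"
    using eventually_nhds_conv_at[THEN iffD1, OF C, THEN conjunct1] ne
  proof eventually_elim
    case (elim x)
    have "h x / x\<^sup>2 - c = (h x - c * x\<^sup>2) / x\<^sup>2" using elim by (simp add: field_simps)
    then have "\<bar>h x / x\<^sup>2 - c\<bar> = \<bar>h x - c * x\<^sup>2\<bar> / \<bar>x\<bar>\<^sup>2" by simp
    also have "\<dots> \<le> C * \<bar>x\<bar> ^ 3 / \<bar>x\<bar>\<^sup>2" using elim by (intro divide_right_mono) auto
    also have "\<dots> = C * \<bar>x\<bar>" using elim by (simp add: power3_eq_cube power2_eq_square)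
    finally show ?case .
  qed
  moreover have "((\<lambda>x::real. C * \<bar>x\<bar>) \<longlongrightarrow> 0) (at 0)"
    using tendsto_mult[OF tendsto_const[of C] tendsto_rabs[OF tendsto_ident_at[of 0 UNIV]]] by simp
  ultimately have "((\<lambda>x. h x / x\<^sup>2 - c) \<longlongrightarrow> 0) (at 0)"
    using Lim_null_comparison[of "\<lambda>x. h x / x\<^sup>2 - c" "\<lambda>x. C * \<bar>x\<bar>" "at 0"] by simp
  then show 1: "((\<lambda>x. h x / x\<^sup>2) \<longlongrightarrow> c) (at 0)" using LIM_zero_iff by blast
  have "((\<lambda>x. h x / x\<^sup>2 * x) \<longlongrightarrow> c * 0) (at 0)" by (intro tendsto_intros 1)
  moreover have "\<forall>\<^sub>F x in at 0. h x / x\<^sup>2 * x = h x / x"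
    using ne by eventually_elim (simp add: power2_eq_square)
  ultimately have hx: "((\<lambda>x. h x / x) \<longlongrightarrow> 0) (at 0)"
    by (simp add: tendsto_cong)
  then have "((\<lambda>x. h x / x * x) \<longlongrightarrow> 0 * 0) (at 0)" by (intro tendsto_intros)
  moreover have "\<forall>\<^sub>F x in at 0. h x / x * x = h x"
    using ne by eventually_elim simp
  ultimately show 2: "(h \<longlongrightarrow> 0) (at 0)"
    by (simp add: tendsto_cong)
  have "((\<lambda>x. (x, h x)) \<longlongrightarrow> (0, 0)) (at 0)" by (intro tendsto_intros 2)
  then show "((\<lambda>x. (x, h x)) \<longlongrightarrow> 0) (at 0)" by (simp add: zero_prod_def)
  have "\<forall>\<^sub>F x in at 0. dist (h x / x) 0 < 1" by (rule tendstoD[OF hx]) simp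
  then show "\<forall>\<^sub>F x in at 0. norm (x, h x) \<le> 2 * \<bar>x\<bar>"
    using ne
  proof eventually_elim
    case (elim x)
    then have "\<bar>h x\<bar> \<le> \<bar>x\<bar>" by (simp add: field_simps)
    then show ?case using norm_Pair_le[of x "h x"] by simp
  qed
qed

text \<open>The condition \<open>surface\<close> provides local equations at all points of S, not
  only at g, and it is inherited by S intersected with an open set. The locale can therefore be
  instantiated again for the neighbourhoods in \<open>germ_conodal\<close>.\<close>

locale normal_chart = graph_chart S B "normal_form_fun r \<phi>" U V for S B r \<phi> U V +
  assumes smooth_phi: "smooth_on U \<phi>" and jet: "\<And>vs. length vs \<le> 4 \<Longrightarrow> dir_deriv vs \<phi> (0, 0) = 0"
    and origin: "(0, 0, 0) \<in> V" and surface: "\<And>p. p \<in> S \<Longrightarrow> has_local_equation S p"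
begin

abbreviation "nf \<equiv> normal_form_fun r \<phi>"

lemma origin_U: "0 \<in> U" using domain[OF origin] by (simp add: zero_prod_def)

lemma phi_bound:
  assumes "length vs \<le> 4" "0 < \<epsilon>"
  shows "\<forall>\<^sub>F q in nhds 0. \<bar>dir_deriv vs \<phi> q\<bar> \<le> \<epsilon> * norm q ^ (4 - length vs)"
  using vanishing_jet_bound[OF openU smooth_phi origin_U _ assms] jet by (simp add: zero_prod_def)

lemma nf_derivs: "p \<in> U \<Longrightarrow> dir_deriv vs nf p = dir_deriv vs (nf_poly r) p + dir_deriv vs \<phi> p"
  by (rule normal_form_derivs[OF openU smooth_phi])

lemma graph_point_in_chart:
  "\<forall>\<^sub>F q in nhds 0. (fst q, snd q, nf q) \<in> V"
proof -
  have "isCont nf 0" using smooth_on_continuous[OF smooth openU origin_U, of "[]"] by simp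
  then have "(nf \<longlongrightarrow> nf 0) (nhds 0)" by (metis continuous_at tendsto_at_iff_tendsto_nhds)
  then have "((\<lambda>q. (fst q, snd q, nf q)) \<longlongrightarrow> (fst (0::real \<times> real), snd (0::real \<times> real), nf 0)) (nhds 0)"
    by (intro tendsto_Pair tendsto_fst[OF filterlim_ident] tendsto_snd[OF filterlim_ident])
  moreover have "nf 0 = 0"
    using jet[of "[]"] by (simp add: normal_form_fun_def zero_prod_def)
  ultimately show ?thesis
    using topological_tendstoD[OF _ openV] origin by fastforce
qed

lemma point_in_surface:
  assumes "(x, y, nf (x, y)) \<in> V"
  shows "affine_pt B (x, y, nf (x, y)) \<in> S" "has_local_equation S (affine_pt B (x, y, nf (x, y)))"
  using graph[OF assms] surface by auto

context
  fixes h :: "real \<Rightarrow> real" and \<epsilon> c :: real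
  assumes h: "0 < \<epsilon>" "smooth_on {-\<epsilon><..<\<epsilon>} h" "h 0 = 0" "deriv h 0 = 0" "deriv (deriv h) 0 = 2 * c"
begin

text \<open>The bound o(norm^k) of \<open>phi_bound\<close> becomes o(x^k) because the norm of (x, h
  x) is at most 2 |x| near 0.\<close>

lemma phi_along_curve:
  assumes "length vs \<le> 4"
  shows "((\<lambda>x. dir_deriv vs \<phi> (x, h x) / x ^ (4 - length vs)) \<longlongrightarrow> 0) (at 0)"
proof (rule tendstoI)
  fix e :: real assume "e > 0"
  define k where "k = 4 - length vs"
  \<comment> \<open>The factor 2^k absorbs the power of 2 |x|; the additional 2 makes the final
    inequality strict.\<close>
  have "\<forall>\<^sub>F q in nhds 0. \<bar>dir_deriv vs \<phi> q\<bar> \<le> (e / (2 * 2 ^ k)) * norm q ^ k"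
    unfolding k_def by (rule phi_bound[OF assms]) (use \<open>e > 0\<close> in simp)
  then have "\<forall>\<^sub>F x in at 0. \<bar>dir_deriv vs \<phi> (x, h x)\<bar> \<le> (e / (2 * 2 ^ k)) * norm (x, h x) ^ k"
    using two_jet_limits(4)[OF h] unfolding filterlim_iff by blast
  moreover have "\<forall>\<^sub>F x::real in at 0. x \<noteq> 0" by (simp add: eventually_at_filter)
  ultimately show "\<forall>\<^sub>F x in at 0. dist (dir_deriv vs \<phi> (x, h x) / x ^ (4 - length vs)) 0 < e"
    using two_jet_limits(3)[OF h]
  proof eventually_elim
    case (elim x)
    have "\<bar>dir_deriv vs \<phi> (x, h x)\<bar> \<le> (e / (2 * 2 ^ k)) * (2 * \<bar>x\<bar>) ^ k"
      by (rule order_trans[OF elim(1)]) (use elim(3) \<open>e > 0\<close> in \<open>intro mult_left_mono power_mono, auto\<close>)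
    also have "\<dots> = e / 2 * \<bar>x\<bar> ^ k" by (simp add: power_mult_distrib)
    also have "\<dots> < e * \<bar>x\<bar> ^ k" using elim \<open>e > 0\<close> by simp
    finally show ?case using elim by (simp add: k_def[symmetric] power_abs field_simps)
  qed
qed

text \<open>The weighted leading parts: f_xx is 6 r x^2 - 2 y, each mixed derivative is -2 x, and
  f_yy is 1. Second derivatives of \<open>\<phi>\<close> are o(x^2) and disappear in every
  limit.\<close>

lemma second_order_limits:
  shows "((\<lambda>x. dir_deriv [(1, 0), (1, 0)] nf (x, h x) / x\<^sup>2) \<longlongrightarrow> 6 * r - 2 * c) (at 0)"
    and "((\<lambda>x. (dir_deriv [(1, 0), (0, 1)] nf (x, h x) + dir_deriv [(0, 1), (1, 0)] nf (x, h x)) / x) \<longlongrightarrow> - 4) (at 0)"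
    and "((\<lambda>x. dir_deriv [(0, 1), (0, 1)] nf (x, h x)) \<longlongrightarrow> 1) (at 0)"
    and "\<forall>\<^sub>F x in at 0. (x, h x) \<in> U" "\<forall>\<^sub>F x in at 0. (x, h x, nf (x, h x)) \<in> V"
proof -
  have ne: "\<forall>\<^sub>F x::real in at 0. x \<noteq> 0" by (simp add: eventually_at_filter)
  show V: "\<forall>\<^sub>F x in at 0. (x, h x, nf (x, h x)) \<in> V"
    using two_jet_limits(4)[OF h] graph_point_in_chart unfolding filterlim_iff by fastforce
  then show U: "\<forall>\<^sub>F x in at 0. (x, h x) \<in> U"
    by eventually_elim (use domain in blast)
  have \<phi>: "((\<lambda>x. dir_deriv [u, v] \<phi> (x, h x) / x\<^sup>2) \<longlongrightarrow> 0) (at 0)" for u v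
    using phi_along_curve[of "[u, v]"] by (simp del: dir_deriv.simps)
  have "((\<lambda>x. 6 * r - 2 * (h x / x\<^sup>2) + dir_deriv [(1, 0), (1, 0)] \<phi> (x, h x) / x\<^sup>2) \<longlongrightarrow> 6 * r - 2 * c + 0) (at 0)"
    by (intro tendsto_intros \<phi> two_jet_limits(1)[OF h])
  moreover have "\<forall>\<^sub>F x in at 0. 6 * r - 2 * (h x / x\<^sup>2) + dir_deriv [(1, 0), (1, 0)] \<phi> (x, h x) / x\<^sup>2 =
      dir_deriv [(1, 0), (1, 0)] nf (x, h x) / x\<^sup>2"
    using U ne
  proof eventually_elim
    case (elim x)
    show ?case unfolding nf_derivs[OF elim(1)] nf_poly_deriv2 using elim(2) by (simp add: field_simps del: dir_deriv.simps)
  qed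
  ultimately show "((\<lambda>x. dir_deriv [(1, 0), (1, 0)] nf (x, h x) / x\<^sup>2) \<longlongrightarrow> 6 * r - 2 * c) (at 0)"
    by (simp add: tendsto_cong del: dir_deriv.simps)
  have "((\<lambda>x. - 4 + (dir_deriv [(1, 0), (0, 1)] \<phi> (x, h x) / x\<^sup>2 + dir_deriv [(0, 1), (1, 0)] \<phi> (x, h x) / x\<^sup>2) * x) \<longlongrightarrow> - 4 + (0 + 0) * 0) (at 0)"
    by (intro tendsto_intros \<phi>)
  moreover have "\<forall>\<^sub>F x in at 0. - 4 + (dir_deriv [(1, 0), (0, 1)] \<phi> (x, h x) / x\<^sup>2 + dir_deriv [(0, 1), (1, 0)] \<phi> (x, h x) / x\<^sup>2) * x =
      (dir_deriv [(1, 0), (0, 1)] nf (x, h x) + dir_deriv [(0, 1), (1, 0)] nf (x, h x)) / x"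
    using U ne
  proof eventually_elim
    case (elim x)
    show ?case unfolding nf_derivs[OF elim(1)] nf_poly_deriv2 using elim(2)
      by (simp add: field_simps power2_eq_square del: dir_deriv.simps)
  qed
  ultimately show "((\<lambda>x. (dir_deriv [(1, 0), (0, 1)] nf (x, h x) + dir_deriv [(0, 1), (1, 0)] nf (x, h x)) / x) \<longlongrightarrow> - 4) (at 0)"
    by (simp add: tendsto_cong del: dir_deriv.simps)
  have "((\<lambda>x. 1 + dir_deriv [(0, 1), (0, 1)] \<phi> (x, h x) / x\<^sup>2 * x * x) \<longlongrightarrow> 1 + 0 * 0 * 0) (at 0)"
    by (intro tendsto_intros \<phi>)
  moreover have "\<forall>\<^sub>F x in at 0. 1 + dir_deriv [(0, 1), (0, 1)] \<phi> (x, h x) / x\<^sup>2 * x * x =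
      dir_deriv [(0, 1), (0, 1)] nf (x, h x)"
    using U ne
  proof eventually_elim
    case (elim x)
    show ?case unfolding nf_derivs[OF elim(1)] nf_poly_deriv2 using elim(2)
      by (simp add: power2_eq_square del: dir_deriv.simps)
  qed
  ultimately show "((\<lambda>x. dir_deriv [(0, 1), (0, 1)] nf (x, h x)) \<longlongrightarrow> 1) (at 0)"
    by (simp add: tendsto_cong del: dir_deriv.simps)
qed

text \<open>The discriminant divided by x^2 vanishes along the curve and tends to 16 - 4 (6 r - 2
  c).\<close>

lemma parabolic_coefficient_aux:
  assumes C: "\<forall>\<^sub>F x in at 0. affine_pt B (x, h x, nf (x, h x)) \<in> parabolic_curve S"
  shows "c = 3 * r - 2"
proof -
  note lim = second_order_limits
  define a b d where abd: "a x = dir_deriv [(1, 0), (1, 0)] nf (x, h x)"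
    "b x = dir_deriv [(1, 0), (0, 1)] nf (x, h x) + dir_deriv [(0, 1), (1, 0)] nf (x, h x)"
    "d x = dir_deriv [(0, 1), (0, 1)] nf (x, h x)" for x
  note lim' = lim(1-3)[folded abd]
  have "((\<lambda>x. (b x / x)\<^sup>2 - 4 * (a x / x\<^sup>2) * d x) \<longlongrightarrow> (- 4)\<^sup>2 - 4 * (6 * r - 2 * c) * 1) (at 0)"
    by (intro tendsto_intros lim')
  moreover have "\<forall>\<^sub>F x in at 0. d x \<noteq> 0"
    by (rule tendsto_imp_eventually_ne[OF lim'(3)]) simp
  then have "\<forall>\<^sub>F x in at 0. (b x / x)\<^sup>2 - 4 * (a x / x\<^sup>2) * d x = 0"
    using C lim(5)
  proof eventually_elim
    case (elim x)
    have "(b x)\<^sup>2 - 4 * a x * d x = 0"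
      using asymptotic_count(1)[OF elim(3) point_in_surface(2)[OF elim(3)]] elim(1,2) unfolding abd by blast
    then have "((b x)\<^sup>2 - 4 * a x * d x) / x\<^sup>2 = 0" by simp
    then show ?case by (simp add: power_divide diff_divide_distrib)
  qed
  ultimately have "(- 4)\<^sup>2 - 4 * (6 * r - 2 * c) * 1 = 0"
    by (rule eventually_zero_limit)
  then show ?thesis by simp
qed

text \<open>The third-order condition reads 12 r x - 6 m + o(x) = 0 and suggests m / x -> 2 r. Its
  error is a cubic form in (1, m), so m must be bounded beforehand; the second-order condition
  provides this. With the limit of m / x known, the second-order condition divided by x^2 gives
  c.\<close>

lemma flecnodal_coefficient_aux:
  assumes C: "\<forall>\<^sub>F x in at 0. \<exists>L. has_contact 4 S (affine_pt B (x, h x, nf (x, h x))) L"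
  shows "c = 2 * r\<^sup>2 - r"
proof -
  note lim = second_order_limits
  define a b d where abd: "a x = dir_deriv [(1, 0), (1, 0)] nf (x, h x)"
    "b x = dir_deriv [(1, 0), (0, 1)] nf (x, h x) + dir_deriv [(0, 1), (1, 0)] nf (x, h x)"
    "d x = dir_deriv [(0, 1), (0, 1)] nf (x, h x)" for x
  note lim' = lim(1-3)[folded abd]
  have ne: "\<forall>\<^sub>F x::real in at 0. x \<noteq> 0" by (simp add: eventually_at_filter)
  let ?E = "{(1, 0), (0, 1)} :: (real \<times> real) set"
  \<comment> \<open>The sum of all eight third partial derivatives in absolute value bounds the
    third derivative in direction (1, m) uniformly for |m| at most 1.\<close>
  define T where "T x = (\<Sum>u\<in>?E. \<Sum>v\<in>?E. \<Sum>w\<in>?E. \<bar>dir_deriv [u, v, w] \<phi> (x, h x)\<bar>)" for x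
  have T: "((\<lambda>x. T x / \<bar>x\<bar>) \<longlongrightarrow> 0) (at 0)"
  proof -
    have "((\<lambda>x. \<bar>dir_deriv [u, v, w] \<phi> (x, h x) / x\<bar>) \<longlongrightarrow> 0) (at 0)" for u v w
      using tendsto_rabs[OF phi_along_curve[of "[u, v, w]"]] by (simp del: dir_deriv.simps)
    then have "((\<lambda>x. \<Sum>u\<in>?E. \<Sum>v\<in>?E. \<Sum>w\<in>?E. \<bar>dir_deriv [u, v, w] \<phi> (x, h x) / x\<bar>) \<longlongrightarrow> (\<Sum>u\<in>?E. \<Sum>v\<in>?E. \<Sum>w\<in>?E. 0)) (at 0)"
      by (intro tendsto_sum)
    then show ?thesis by (simp add: T_def add_divide_distrib del: dir_deriv.simps)
  qed
  have third: "\<bar>dir_deriv [(1, m), (1, m), (1, m)] \<phi> (x, h x)\<bar> \<le> T x" if "(x, h x) \<in> U" "\<bar>m\<bar> \<le> 1" for x m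
  proof -
    have step: "\<bar>dir_deriv (us @ (1, m) # ws) \<phi> (x, h x)\<bar> \<le> \<bar>dir_deriv (us @ (1, 0) # ws) \<phi> (x, h x)\<bar> + \<bar>dir_deriv (us @ (0, 1) # ws) \<phi> (x, h x)\<bar>" for us ws
    proof -
      have "\<bar>m * dir_deriv (us @ (0, 1) # ws) \<phi> (x, h x)\<bar> \<le> \<bar>dir_deriv (us @ (0, 1) # ws) \<phi> (x, h x)\<bar>"
        using that(2) by (simp add: abs_mult mult_left_le_one_le)
      then show ?thesis
        unfolding dir_deriv_linear_arg[OF openU smooth_phi that(1), of us 1 m ws] by linarith
    qed
    note s1 = step[of "[]", unfolded append_Nil]
    note s2 = step[of "[u]" for u, unfolded append_Cons append_Nil]
    note s3 = step[of "[u, v]" for u v, unfolded append_Cons append_Nil]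
    show ?thesis
      using s1[of "[(1, m), (1, m)]"] s2[of "(1, 0)" "[(1, m)]"] s2[of "(0, 1)" "[(1, m)]"]
        s3[of "(1, 0)" "(1, 0)" "[]"] s3[of "(1, 0)" "(0, 1)" "[]"] s3[of "(0, 1)" "(1, 0)" "[]"] s3[of "(0, 1)" "(0, 1)" "[]"]
      by (simp add: T_def del: dir_deriv.simps)
  qed
  define K where "K = \<bar>6 * r - 2 * c\<bar> + 1"
  have nz: "\<forall>\<^sub>F x in at 0. 1/2 < d x" by (rule order_tendstoD(1)[OF lim'(3)]) simp
  define good where "good x m \<longleftrightarrow> a x + b x * m + d x * m\<^sup>2 = 0 \<and>
      12 * r * x - 6 * m + dir_deriv [(1, m), (1, m), (1, m)] \<phi> (x, h x) = 0" for x m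
  have "\<forall>\<^sub>F x in at 0. \<exists>m. good x m"
    using nz C lim(4,5)
  proof eventually_elim
    case (elim x)
    have d: "dir_deriv [(0, 1), (0, 1)] nf (x, h x) \<noteq> 0" using elim(1) unfolding abd by linarith
    obtain m where m: "\<And>j. j \<in> {2..<4} \<Longrightarrow> dir_deriv (replicate j (1, m)) nf (x, h x) = 0"
      using elim(2) has_contact_slope_iff[OF elim(4) point_in_surface(2)[OF elim(4)] _ d, of 4] by fastforce
    have "dir_deriv [(1, m), (1, m)] nf (x, h x) = 0"
      using m[of 2] by (simp add: numeral_2_eq_2)
    then have 1: "a x + b x * m + d x * m\<^sup>2 = 0"
      unfolding second_form_expand[OF elim(3), of m] abd .
    have "dir_deriv [(1, m), (1, m), (1, m)] nf (x, h x) = 0"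
      using m[of 3] by (simp add: numeral_3_eq_3)
    then have 2: "12 * r * x - 6 * m + dir_deriv [(1, m), (1, m), (1, m)] \<phi> (x, h x) = 0"
      unfolding nf_derivs[OF elim(3)] nf_poly_deriv3 by (simp del: dir_deriv.simps)
    show ?case using 1 2 unfolding good_def by blast
  qed
  \<comment> \<open>A slope with four-point contact is chosen at each x. No continuity in x is
    known, so all further facts about it come from the two equations in \<open>good\<close>.\<close>
  then have good: "\<forall>\<^sub>F x in at 0. good x (SOME m. good x m)"
    by eventually_elim (rule someI_ex)
  define m where "m x = (SOME m. good x m)" for x
  have A: "\<forall>\<^sub>F x in at 0. \<bar>a x / x\<^sup>2\<bar> < K"
    using tendsto_rabs[OF lim'(1)] by (rule order_tendstoD) (simp add: K_def)
  have Bb: "\<forall>\<^sub>F x in at 0. \<bar>b x / x\<bar> < 5"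
    using tendsto_rabs[OF lim'(2)] by (rule order_tendstoD) simp
  \<comment> \<open>A root bound for the quadratic in the scaled variable m / x. Where |m| exceeds
    |x|, both lower terms are at most a multiple of |x| |m|; cancelling |m| leaves |m| at most 2 (K
    + 5) |x|. The case |m| at most |x| is immediate.\<close>
  have m_bound: "\<forall>\<^sub>F x in at 0. \<bar>m x\<bar> \<le> (2 * K + 11) * \<bar>x\<bar>"
    using good A Bb nz ne
  proof eventually_elim
    case (elim x)
    have eq: "a x + b x * m x + d x * (m x)\<^sup>2 = 0" using elim(1) by (simp add: good_def m_def)
    show ?case
    proof (cases "\<bar>m x\<bar> \<le> \<bar>x\<bar>")
      case True
      moreover have "1 * \<bar>x\<bar> \<le> (2 * K + 11) * \<bar>x\<bar>" by (intro mult_right_mono) (auto simp: K_def)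
      ultimately show ?thesis by simp
    next
      case False
      have ax: "\<bar>a x\<bar> \<le> K * \<bar>x\<bar> * \<bar>x\<bar>" 
      proof -
        have "\<bar>a x\<bar> = \<bar>a x / x\<^sup>2\<bar> * (\<bar>x\<bar> * \<bar>x\<bar>)" using elim(5) by (simp add: power2_eq_square)
        also have "\<dots> \<le> K * (\<bar>x\<bar> * \<bar>x\<bar>)" using elim(2) by (intro mult_right_mono) auto
        finally show ?thesis by (simp add: mult.assoc)
      qed
      have "\<bar>a x\<bar> \<le> K * \<bar>x\<bar> * \<bar>m x\<bar>"
        by (rule order_trans[OF ax]) (use False in \<open>intro mult_left_mono, auto simp: K_def\<close>)
      moreover have "\<bar>b x * m x\<bar> \<le> 5 * \<bar>x\<bar> * \<bar>m x\<bar>"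
        using elim(3,5) unfolding abs_mult by (intro mult_right_mono) (auto simp: field_simps)
      moreover have "1/2 * \<bar>m x\<bar> * \<bar>m x\<bar> \<le> d x * (m x)\<^sup>2"
        using elim(4) mult_right_mono[of "1/2" "d x" "(m x)\<^sup>2"] by (simp add: power2_eq_square)
      ultimately have "1/2 * \<bar>m x\<bar> * \<bar>m x\<bar> \<le> K * \<bar>x\<bar> * \<bar>m x\<bar> + 5 * \<bar>x\<bar> * \<bar>m x\<bar>"
        using eq by linarith
      then have "1/2 * \<bar>m x\<bar> * \<bar>m x\<bar> \<le> (K + 5) * \<bar>x\<bar> * \<bar>m x\<bar>"
        by (simp only: distrib_right)
      then have "1/2 * \<bar>m x\<bar> \<le> (K + 5) * \<bar>x\<bar>"
        by (rule mult_right_le_imp_le) (use False in linarith)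
      then show ?thesis by (simp add: algebra_simps)
    qed
  qed
  have "((\<lambda>x. (2 * K + 11) * \<bar>x\<bar>) \<longlongrightarrow> (2 * K + 11) * \<bar>0\<bar>) (at 0)" by (intro tendsto_intros)
  then have "\<forall>\<^sub>F x in at 0. (2 * K + 11) * \<bar>x\<bar> < 1" by (rule order_tendstoD) simp
  with m_bound have m1: "\<forall>\<^sub>F x in at 0. \<bar>m x\<bar> \<le> 1" by eventually_elim simp
  have "\<forall>\<^sub>F x in at 0. \<bar>m x / x - 2 * r\<bar> \<le> T x / \<bar>x\<bar>"
    using good m1 lim(4) ne
  proof eventually_elim
    case (elim x)
    have "12 * r * x - 6 * m x + dir_deriv [(1, m x), (1, m x), (1, m x)] \<phi> (x, h x) = 0"
      using elim(1) by (simp add: good_def m_def del: dir_deriv.simps)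
    then have "\<bar>m x - 2 * r * x\<bar> \<le> T x" using third[OF elim(3,2)] by linarith
    then have "\<bar>m x - 2 * r * x\<bar> / \<bar>x\<bar> \<le> T x / \<bar>x\<bar>" by (intro divide_right_mono) auto
    moreover have "\<bar>m x - 2 * r * x\<bar> / \<bar>x\<bar> = \<bar>m x / x - 2 * r\<bar>"
      using elim(4) by (simp add: diff_divide_distrib flip: abs_divide)
    ultimately show ?case by simp
  qed
  then have "((\<lambda>x. m x / x - 2 * r) \<longlongrightarrow> 0) (at 0)"
    using Lim_null_comparison[OF _ T, of "\<lambda>x. m x / x - 2 * r"] by simp
  then have mlim: "((\<lambda>x. m x / x) \<longlongrightarrow> 2 * r) (at 0)" using LIM_zero_iff by blast
  \<comment> \<open>Passing to the limit turns the second-order condition into 6 r - 2 c - 8 r + 4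
    r^2 = 0.\<close>
  have "((\<lambda>x. a x / x\<^sup>2 + b x / x * (m x / x) + d x * (m x / x)\<^sup>2) \<longlongrightarrow> (6 * r - 2 * c) + (- 4) * (2 * r) + 1 * (2 * r)\<^sup>2) (at 0)"
    by (intro tendsto_intros lim' mlim)
  moreover have "\<forall>\<^sub>F x in at 0. a x / x\<^sup>2 + b x / x * (m x / x) + d x * (m x / x)\<^sup>2 = 0"
    using good ne
  proof eventually_elim
    case (elim x)
    have "a x / x\<^sup>2 + b x / x * (m x / x) + d x * (m x / x)\<^sup>2 = (a x + b x * m x + d x * (m x)\<^sup>2) / x\<^sup>2"
      by (simp add: power_divide add_divide_distrib) (simp add: power2_eq_square)
    then show ?case using elim(1) by (simp add: good_def m_def)
  qed
  ultimately have "(6 * r - 2 * c) + (- 4) * (2 * r) + 1 * (2 * r)\<^sup>2 = 0"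
    by (rule eventually_zero_limit)
  then show ?thesis by (simp add: power2_eq_square)
qed

lemma eventually_curve:
  assumes "\<forall>x\<in>{-\<epsilon><..<\<epsilon>}. \<forall>y\<in>{-\<epsilon><..<\<epsilon>}. affine_pt B (x, y, nf (x, y)) \<in> C \<longleftrightarrow> y = h x"
  shows "\<forall>\<^sub>F x in at 0. affine_pt B (x, h x, nf (x, h x)) \<in> C"
proof -
  have "\<forall>\<^sub>F x in at 0. dist (h x) 0 < \<epsilon>" by (rule tendstoD[OF two_jet_limits(2)[OF h] h(1)])
  moreover have "\<forall>\<^sub>F x in at 0. dist x 0 < \<epsilon>" by (rule tendstoD[OF tendsto_ident_at h(1)])
  ultimately show ?thesis
    by eventually_elim (use assms in \<open>auto simp: dist_real_def abs_less_iff\<close>)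
qed

end

lemma parabolic_coefficient:
  assumes "has_2jet B nf (parabolic_curve S) c"
  shows "c = 3 * r - 2"
  using assms parabolic_coefficient_aux eventually_curve unfolding has_2jet_def by blast

lemma flecnodal_coefficient:
  assumes "has_2jet B nf (flecnodal_curve S) c"
  shows "c = 2 * r\<^sup>2 - r"
proof -
  obtain h \<epsilon> where h: "0 < \<epsilon>" "smooth_on {-\<epsilon><..<\<epsilon>} h" "h 0 = 0" "deriv h 0 = 0" "deriv (deriv h) 0 = 2 * c"
    and C: "\<forall>x\<in>{-\<epsilon><..<\<epsilon>}. \<forall>y\<in>{-\<epsilon><..<\<epsilon>}. affine_pt B (x, y, nf (x, y)) \<in> flecnodal_curve S \<longleftrightarrow> y = h x"
    using assms unfolding has_2jet_def by blast
  have "\<forall>\<^sub>F x in at 0. \<exists>L. has_contact 4 S (affine_pt B (x, h x, nf (x, h x))) L"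
    using eventually_curve[OF h C] by eventually_elim (auto simp: flecnodal_curve_def)
  then show ?thesis by (rule flecnodal_coefficient_aux[OF h])
qed

end

section \<open>The conodal coefficient\<close>

text \<open>Taylor expansion of \<open>D 0\<close> to third and of \<open>D 1\<close> to second
  order: the terms up to second order cancel, leaving one sixth and one fourth of values of
  \<open>D 3\<close>, together below K. Applied along a chord, this expresses bitangency without
  comparing two separate expansions at the origin.\<close>

lemma trapezoid_error:
  fixes D :: "nat \<Rightarrow> real \<Rightarrow> real"
  assumes D: "\<And>j t. 0 \<le> t \<Longrightarrow> t \<le> 1 \<Longrightarrow> (D j has_real_derivative D (Suc j) t) (at t)"
    and K: "\<And>t. 0 \<le> t \<Longrightarrow> t \<le> 1 \<Longrightarrow> \<bar>D 3 t\<bar> \<le> K"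
  shows "\<bar>D 0 1 - D 0 0 - (D 1 0 + D 1 1) / 2\<bar> \<le> K"
proof -
  obtain s where s: "0 < s" "s < 1" "D 0 1 = (\<Sum>m<3. D m 0 / fact m * 1 ^ m) + D 3 s / fact 3 * 1 ^ 3"
    using Maclaurin[of 1 3 D "D 0"] D by auto
  obtain u where u: "0 < u" "u < 1" "D 1 1 = (\<Sum>m<2. D (Suc m) 0 / fact m * 1 ^ m) + D 3 u / fact 2 * 1 ^ 2"
    using Maclaurin[of 1 2 "\<lambda>m. D (Suc m)" "D 1"] D by (auto simp: numeral_3_eq_3 numeral_2_eq_2)
  have "D 0 1 = D 0 0 + D 1 0 + D 2 0 / 2 + D 3 s / 6"
    using s(3) by (simp add: numeral_3_eq_3 numeral_2_eq_2)
  moreover have "D 1 1 = D 1 0 + D 2 0 + D 3 u / 2"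
    using u(3) by (simp add: numeral_2_eq_2)
  ultimately have "D 0 1 - D 0 0 - (D 1 0 + D 1 1) / 2 = D 3 s / 6 - D 3 u / 4"
    by (simp add: field_simps)
  then show ?thesis using K[of s] K[of u] s u by linarith
qed

text \<open>Hypothesis \<open>c\<close> is the trapezoidal rule for the polynomial part of the normal form; it
  forces \<open>x1 + x2\<close> to be small, after which \<open>b\<close> gives \<open>y1\<close>.\<close>

lemma bitangent_arithmetic:
  fixes x1 y1 x2 y2 r e M :: real
  assumes M: "M = max \<bar>x1\<bar> \<bar>x2\<bar>" "M \<le> 1" and ne: "x1 \<noteq> x2" and e: "0 < e" "6 * e \<le> \<bar>1 - r\<bar>" and r: "r \<noteq> 1"
    and a: "\<bar>(y2 - y1) - (x2\<^sup>2 - x1\<^sup>2)\<bar> \<le> e * M\<^sup>2 * \<bar>x2 - x1\<bar>"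
    and b: "\<bar>- 2 * (x2 * y2 - x1 * y1) + 2 * r * (x2 ^ 3 - x1 ^ 3)\<bar> \<le> e * M\<^sup>2 * \<bar>x2 - x1\<bar>"
    and c: "\<bar>(x2 - x1)\<^sup>2 * ((y2 - y1) - r * (x1 + x2) * (x2 - x1)) / 2\<bar> \<le> e * M * \<bar>x2 - x1\<bar> ^ 3"
  shows "\<bar>y1 - r * x1\<^sup>2\<bar> \<le> 20 * e * x1\<^sup>2"
proof -
  define d where "d = x2 - x1"
  \<comment> \<open>\<open>al\<close> is the defect in the equality of the y-derivatives, and
    \<open>be\<close> below is the defect in that of the x-derivatives.\<close>
  define al where "al = (y2 - y1) - (x1 + x2) * d"
  have d: "0 < \<bar>d\<bar>" using ne by (simp add: d_def)
  have M0: "0 \<le> M" "\<bar>x1\<bar> \<le> M" "\<bar>x2\<bar> \<le> M" using M by auto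
  have "(x1 + x2) * d = x2\<^sup>2 - x1\<^sup>2" by (simp add: d_def power2_eq_square algebra_simps)
  then have al: "\<bar>al\<bar> \<le> e * M\<^sup>2 * \<bar>d\<bar>" using a by (simp add: al_def d_def)
  have "M\<^sup>2 \<le> M" using M0 M(2) by (simp add: power2_eq_square mult_left_le)
  then have "e * M\<^sup>2 * \<bar>d\<bar> \<le> e * M * \<bar>d\<bar>" using e by (intro mult_right_mono mult_left_mono) auto
  then have al': "\<bar>al\<bar> \<le> e * M * \<bar>d\<bar>" using al by linarith
  have c1: "\<bar>(y2 - y1) - r * (x1 + x2) * d\<bar> \<le> 2 * e * M * \<bar>d\<bar>"
  proof -
    have "\<bar>(y2 - y1) - r * (x1 + x2) * d\<bar> * \<bar>d\<bar>\<^sup>2 \<le> (2 * e * M * \<bar>d\<bar>) * \<bar>d\<bar>\<^sup>2"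
    proof -
      have "\<bar>d\<^sup>2 * X / 2\<bar> = \<bar>X\<bar> * \<bar>d\<bar>\<^sup>2 / 2" for X by (simp add: abs_mult)
      from c[folded d_def, unfolded this]
      have "\<bar>(y2 - y1) - r * (x1 + x2) * d\<bar> * \<bar>d\<bar>\<^sup>2 \<le> 2 * (e * M * \<bar>d\<bar> ^ 3)" by simp
      also have "\<dots> = (2 * e * M * \<bar>d\<bar>) * \<bar>d\<bar>\<^sup>2" by (simp only: power3_eq_cube power2_eq_square mult.assoc)
      finally show ?thesis .
    qed
    then show ?thesis by (rule mult_right_le_imp_le) (use d in simp)
  qed
  \<comment> \<open>Hypothesis \<open>a\<close> compares y2 - y1 with (x1 + x2) d, hypothesis
    \<open>c\<close> with r (x1 + x2) d. Their difference isolates x1 + x2, and this is where r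
    different from 1 enters.\<close>
  have "(1 - r) * (x1 + x2) * d = ((y2 - y1) - r * (x1 + x2) * d) - al"
    by (simp add: al_def algebra_simps)
  then have "\<bar>(1 - r) * (x1 + x2) * d\<bar> \<le> 3 * e * M * \<bar>d\<bar>" using c1 al' by linarith
  then have "\<bar>1 - r\<bar> * \<bar>x1 + x2\<bar> * \<bar>d\<bar> \<le> 3 * e * M * \<bar>d\<bar>" by (simp add: abs_mult)
  then have sum: "\<bar>1 - r\<bar> * \<bar>x1 + x2\<bar> \<le> 3 * e * M" by (rule mult_right_le_imp_le) (use d in simp)
  \<comment> \<open>The condition \<open>6 * e \<le> \<bar>1 - r\<bar>\<close> is tailored to this
    comparison of 3 e M with half of |1 - r| M.\<close>
  have "\<bar>1 - r\<bar> * \<bar>x1 + x2\<bar> \<le> \<bar>1 - r\<bar> * (M / 2)"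
    using sum mult_right_mono[OF e(2) M0(1)] by simp
  then have "\<bar>x1 + x2\<bar> \<le> M / 2" by (rule mult_left_le_imp_le) (use r in simp)
  \<comment> \<open>The abscissas are nearly opposite, hence of comparable size: if |x2| is the
    larger one, |x1| is still at least M - M / 2.\<close>
  then have M2: "M \<le> 2 * \<bar>x1\<bar>" using M(1) by linarith
  define be where "be = - 2 * (x2 * y2 - x1 * y1) + 2 * r * (x2 ^ 3 - x1 ^ 3)"
  \<comment> \<open>Adding 2 x2 al eliminates y2 from \<open>be\<close>; the rest is divisible by d
    and contains y1 - r x1^2 up to a multiple of the small quantity x1 + x2.\<close>
  have "2 * (r * x1\<^sup>2 - y1 + (r - 1) * x2 * (x1 + x2)) * d = be + 2 * x2 * al"
    by (simp add: be_def al_def d_def power2_eq_square power3_eq_cube algebra_simps)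
  then have "\<bar>2 * (r * x1\<^sup>2 - y1 + (r - 1) * x2 * (x1 + x2)) * d\<bar> \<le> \<bar>be\<bar> + \<bar>2 * x2 * al\<bar>" by linarith
  also have "\<bar>2 * x2 * al\<bar> = 2 * (\<bar>x2\<bar> * \<bar>al\<bar>)" by (simp add: abs_mult)
  also have "\<bar>x2\<bar> * \<bar>al\<bar> \<le> 1 * (e * M\<^sup>2 * \<bar>d\<bar>)" using M0 M(2) al by (intro mult_mono) auto
  also have "\<bar>be\<bar> \<le> e * M\<^sup>2 * \<bar>d\<bar>" using b by (simp add: be_def d_def)
  finally have "2 * \<bar>r * x1\<^sup>2 - y1 + (r - 1) * x2 * (x1 + x2)\<bar> * \<bar>d\<bar> \<le> (4 * e * M\<^sup>2) * \<bar>d\<bar>"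
    by (simp add: abs_mult) (use e d in \<open>simp add: algebra_simps\<close>)
  then have "2 * \<bar>r * x1\<^sup>2 - y1 + (r - 1) * x2 * (x1 + x2)\<bar> \<le> 4 * e * M\<^sup>2"
    by (rule mult_right_le_imp_le) (use d in simp)
  moreover have "\<bar>(r - 1) * x2 * (x1 + x2)\<bar> \<le> 3 * e * M\<^sup>2"
  proof -
    have "\<bar>(r - 1) * x2 * (x1 + x2)\<bar> = \<bar>x2\<bar> * (\<bar>1 - r\<bar> * \<bar>x1 + x2\<bar>)"
      by (simp add: abs_mult abs_minus_commute)
    also have "\<dots> \<le> M * (3 * e * M)" by (rule mult_mono) (use M0 sum in auto)
    finally show ?thesis by (simp add: power2_eq_square algebra_simps)
  qed
  moreover have "\<bar>y1 - r * x1\<^sup>2\<bar> \<le> \<bar>r * x1\<^sup>2 - y1 + (r - 1) * x2 * (x1 + x2)\<bar> + \<bar>(r - 1) * x2 * (x1 + x2)\<bar>"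
    using abs_triangle_ineq4[of "(r - 1) * x2 * (x1 + x2)" "r * x1\<^sup>2 - y1 + (r - 1) * x2 * (x1 + x2)"] by simp
  \<comment> \<open>The bounds 2 e M^2 and 3 e M^2 add up to 5 e M^2; M at most 2 |x1| makes this 20
    e x1^2.\<close>
  ultimately have "\<bar>y1 - r * x1\<^sup>2\<bar> \<le> 5 * (e * M\<^sup>2)" by simp
  then have "\<bar>y1 - r * x1\<^sup>2\<bar> \<le> 5 * e * M\<^sup>2" by simp
  also have "\<dots> \<le> 5 * e * (2 * \<bar>x1\<bar>)\<^sup>2" using M2 M0 e by (intro mult_left_mono power_mono) auto
  finally show ?thesis by (simp add: power_mult_distrib)
qed

lemma has_local_equation_Int:
  assumes "has_local_equation S p" "open W" "p \<in> W"
  shows "has_local_equation (S \<inter> W) p"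
proof -
  obtain v W' F where v: "v \<noteq> 0" "p = proj v" "local_equation S v W' F"
    using assms(1) by (auto simp: has_local_equation_def)
  have "local_equation (S \<inter> W) v (W' \<inter> {v. v \<noteq> 0 \<and> proj v \<in> W}) F"
    using v assms open_proj_vimage[OF assms(2)]
    by (auto simp: local_equation_def intro: open_Int smooth_on_subset)
  then show ?thesis using v by (auto simp: has_local_equation_def)
qed

context normal_chart
begin

lemma phi_gradient_difference:
  assumes seg: "\<And>s. 0 \<le> s \<Longrightarrow> s \<le> 1 \<Longrightarrow> p + s *\<^sub>R (a, b) \<in> U"
    and bound: "\<And>s u v. 0 \<le> s \<Longrightarrow> s \<le> 1 \<Longrightarrow> u \<in> {(1, 0), (0, 1)} \<Longrightarrow> v \<in> {(1, 0), (0, 1)} \<Longrightarrow>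
      \<bar>dir_deriv [u, v] \<phi> (p + s *\<^sub>R (a, b))\<bar> \<le> K"
    and v: "v \<in> {(1, 0), (0, 1)}"
  shows "\<bar>dir_deriv [v] \<phi> (p + (a, b)) - dir_deriv [v] \<phi> p\<bar> \<le> K * (\<bar>a\<bar> + \<bar>b\<bar>)"
proof -
  have "\<exists>s>0. s < 1 \<and> dir_deriv [v] \<phi> (p + 1 *\<^sub>R (a, b)) - dir_deriv [v] \<phi> (p + 0 *\<^sub>R (a, b)) =
      (1 - 0) * dir_deriv [(a, b), v] \<phi> (p + s *\<^sub>R (a, b))"
    using smooth_on_line_derivative[OF smooth_phi openU seg, of _ "[v]"] by (intro MVT2) auto
  then obtain s where s: "0 < s" "s < 1"
    "dir_deriv [v] \<phi> (p + (a, b)) - dir_deriv [v] \<phi> p = dir_deriv [(a, b), v] \<phi> (p + s *\<^sub>R (a, b))"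
    by (auto simp: zero_prod_def[symmetric] simp del: dir_deriv.simps)
  have "dir_deriv [(a, b), v] \<phi> (p + s *\<^sub>R (a, b)) = a * dir_deriv [(1, 0), v] \<phi> (p + s *\<^sub>R (a, b)) + b * dir_deriv [(0, 1), v] \<phi> (p + s *\<^sub>R (a, b))"
    using dir_deriv_linear_arg[OF openU smooth_phi seg, of s "[]" a b "[v]"] s by simp
  also have "\<bar>\<dots>\<bar> \<le> \<bar>a\<bar> * K + \<bar>b\<bar> * K"
    using bound[of s "(1, 0)" v] bound[of s "(0, 1)" v] s v unfolding abs_mult[symmetric]
    by (intro order_trans[OF abs_triangle_ineq] add_mono) (simp_all add: abs_mult mult_left_mono del: dir_deriv.simps)
  finally show ?thesis using s(3) by (simp add: algebra_simps del: dir_deriv.simps)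
qed

text \<open>The trapezoidal error of \<open>\<phi>\<close> on the chord from p to p + (a, b). The
  third derivative along the chord is bounded by expanding one slot at a time, each costing a factor
  |a| + |b|.\<close>

lemma phi_trapezoid:
  assumes seg: "\<And>s. 0 \<le> s \<Longrightarrow> s \<le> 1 \<Longrightarrow> p + s *\<^sub>R (a, b) \<in> U"
    and bound: "\<And>s u v w. 0 \<le> s \<Longrightarrow> s \<le> 1 \<Longrightarrow> u \<in> {(1, 0), (0, 1)} \<Longrightarrow> v \<in> {(1, 0), (0, 1)} \<Longrightarrow> w \<in> {(1, 0), (0, 1)} \<Longrightarrow>
      \<bar>dir_deriv [u, v, w] \<phi> (p + s *\<^sub>R (a, b))\<bar> \<le> K"
  shows "\<bar>\<phi> (p + (a, b)) - \<phi> p - (dir_deriv [(a, b)] \<phi> p + dir_deriv [(a, b)] \<phi> (p + (a, b))) / 2\<bar> \<le> K * (\<bar>a\<bar> + \<bar>b\<bar>) ^ 3"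
proof -
  define D where "D j t = dir_deriv (replicate j (a, b)) \<phi> (p + t *\<^sub>R (a, b))" for j t
  have "(D j has_real_derivative D (Suc j) t) (at t)" if "0 \<le> t" "t \<le> 1" for j t
    unfolding D_def[abs_def] using smooth_on_line_derivative[OF smooth_phi openU seg[OF that], of "replicate j (a, b)"] by simp
  moreover have "\<bar>D 3 t\<bar> \<le> K * (\<bar>a\<bar> + \<bar>b\<bar>) ^ 3" if t: "0 \<le> t" "t \<le> 1" for t
  proof -
    let ?q = "p + t *\<^sub>R (a, b)"
    have step: "\<bar>dir_deriv (us @ (a, b) # ws) \<phi> ?q\<bar> \<le> (\<bar>a\<bar> + \<bar>b\<bar>) * L"
      if "\<bar>dir_deriv (us @ (1, 0) # ws) \<phi> ?q\<bar> \<le> L" "\<bar>dir_deriv (us @ (0, 1) # ws) \<phi> ?q\<bar> \<le> L" for us ws L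
    proof -
      have "\<bar>dir_deriv (us @ (a, b) # ws) \<phi> ?q\<bar> \<le> \<bar>a\<bar> * L + \<bar>b\<bar> * L"
        unfolding dir_deriv_linear_arg[OF openU smooth_phi seg[OF t], of us a b ws]
        by (rule order_trans[OF abs_triangle_ineq]) (use that in \<open>intro add_mono; simp add: abs_mult mult_left_mono\<close>)
      then show ?thesis by (simp add: algebra_simps)
    qed
    note s1 = step[of "[]", unfolded append_Nil]
    note s2 = step[of "[u]" for u, unfolded append_Cons append_Nil]
    note s3 = step[of "[u, v]" for u v, unfolded append_Cons append_Nil]
    have 3: "\<bar>dir_deriv [u, v, (a, b)] \<phi> ?q\<bar> \<le> (\<bar>a\<bar> + \<bar>b\<bar>) * K" if "u \<in> {(1, 0), (0, 1)}" "v \<in> {(1, 0), (0, 1)}" for u v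
      by (rule s3) (use bound[OF t that] in blast)+
    have 2: "\<bar>dir_deriv [u, (a, b), (a, b)] \<phi> ?q\<bar> \<le> (\<bar>a\<bar> + \<bar>b\<bar>) * ((\<bar>a\<bar> + \<bar>b\<bar>) * K)" if "u \<in> {(1, 0), (0, 1)}" for u
      by (rule s2) (use 3[OF that] in blast)+
    have "\<bar>dir_deriv [(a, b), (a, b), (a, b)] \<phi> ?q\<bar> \<le> (\<bar>a\<bar> + \<bar>b\<bar>) * ((\<bar>a\<bar> + \<bar>b\<bar>) * ((\<bar>a\<bar> + \<bar>b\<bar>) * K))"
      by (rule s1) (use 2 in blast)+
    then show ?thesis by (simp add: D_def numeral_3_eq_3 algebra_simps del: dir_deriv.simps)
  qed
  ultimately have "\<bar>D 0 1 - D 0 0 - (D 1 0 + D 1 1) / 2\<bar> \<le> K * (\<bar>a\<bar> + \<bar>b\<bar>) ^ 3"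
    by (rule trapezoid_error)
  moreover have "p + (0::real) *\<^sub>R (a, b) = p" "p + 1 *\<^sub>R (a, b) = p + (a, b)"
    by (simp_all add: zero_prod_def[symmetric])
  ultimately show ?thesis unfolding D_def by (simp only: replicate.simps One_nat_def dir_deriv.simps(1))
qed

text \<open>Equality of two tangent planes in coordinates; the third equation says that their
  intercepts on the z-axis agree.\<close>

definition bitangent_pair :: "real \<times> real \<Rightarrow> real \<times> real \<Rightarrow> bool" where
  "bitangent_pair p q \<longleftrightarrow> dir_deriv [(1, 0)] nf p = dir_deriv [(1, 0)] nf q \<and>
    dir_deriv [(0, 1)] nf p = dir_deriv [(0, 1)] nf q \<and>
    nf p - fst p * dir_deriv [(1, 0)] nf p - snd p * dir_deriv [(0, 1)] nf p =
      nf q - fst q * dir_deriv [(1, 0)] nf q - snd q * dir_deriv [(0, 1)] nf q"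

text \<open>The estimate is uniform over all pairs near the origin, since nothing is known about how
  the partner depends on the first point. The wedge |y1| at most |x1| contains any curve y = O(x^2)
  near 0 and lets the size of the pair be measured by the abscissas.\<close>

lemma bitangent_estimate:
  assumes r: "r \<noteq> 1" and eps: "0 < \<epsilon>"
  obtains \<delta> where "0 < \<delta>"
    "\<And>x1 y1 x2 y2. \<bar>x1\<bar> < \<delta> \<Longrightarrow> \<bar>y1\<bar> < \<delta> \<Longrightarrow> \<bar>x2\<bar> < \<delta> \<Longrightarrow> \<bar>y2\<bar> < \<delta> \<Longrightarrow> (x1, y1) \<noteq> (x2, y2) \<Longrightarrow>
      \<bar>y1\<bar> \<le> \<bar>x1\<bar> \<Longrightarrow> bitangent_pair (x1, y1) (x2, y2) \<Longrightarrow> \<bar>y1 - r * x1\<^sup>2\<bar> \<le> \<epsilon> * x1\<^sup>2"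
proof -
  \<comment> \<open>The constants 20 and 6 are those of \<open>bitangent_arithmetic\<close>.\<close>
  define e where "e = min (\<epsilon> / 20) (\<bar>1 - r\<bar> / 6)"
  have e: "0 < e" "6 * e \<le> \<bar>1 - r\<bar>" "20 * e \<le> \<epsilon>" using r eps by (auto simp: e_def min_def)
  \<comment> \<open>216 = 8 * 3^3 comes from R at most 8 M and |a| + |b| at most 3 |a|, cubed; the
    second-order terms need only 8^2 * 3 = 192.\<close>
  define \<eta> where "\<eta> = min (e / 216) (1/2)"
  have eta: "0 < \<eta>" "216 * \<eta> \<le> e" "\<eta> \<le> 1/2" using e by (auto simp: \<eta>_def min_def)
  let ?E = "{(1, 0), (0, 1)} :: (real \<times> real) set"
  have "\<forall>\<^sub>F q in nhds 0. q \<in> U \<and> (\<forall>u\<in>?E. \<forall>v\<in>?E. \<bar>dir_deriv [u, v] \<phi> q\<bar> \<le> \<eta> * norm q ^ 2) \<and>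
      (\<forall>u\<in>?E. \<forall>v\<in>?E. \<forall>w\<in>?E. \<bar>dir_deriv [u, v, w] \<phi> q\<bar> \<le> \<eta> * norm q)"
    using phi_bound[of "[u, v]" \<eta> for u v] phi_bound[of "[u, v, w]" \<eta> for u v w] eta(1) eventually_nhds_in_open[OF openU origin_U]
    by (intro eventually_conj eventually_ball_finite ballI) (auto simp del: dir_deriv.simps)
  then obtain d0 where d0: "0 < d0" "\<And>q. norm q < d0 \<Longrightarrow> q \<in> U \<and> (\<forall>u\<in>?E. \<forall>v\<in>?E. \<bar>dir_deriv [u, v] \<phi> q\<bar> \<le> \<eta> * norm q ^ 2) \<and>
      (\<forall>u\<in>?E. \<forall>v\<in>?E. \<forall>w\<in>?E. \<bar>dir_deriv [u, v, w] \<phi> q\<bar> \<le> \<eta> * norm q)"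
    unfolding eventually_nhds_metric by (auto simp: dist_norm simp del: dir_deriv.simps)
  define \<delta> where "\<delta> = min (d0 / 4) (1/4)"
  have "\<bar>y1 - r * x1\<^sup>2\<bar> \<le> \<epsilon> * x1\<^sup>2"
    if small: "\<bar>x1\<bar> < \<delta>" "\<bar>y1\<bar> < \<delta>" "\<bar>x2\<bar> < \<delta>" "\<bar>y2\<bar> < \<delta>" and ne: "(x1, y1) \<noteq> (x2, y2)"
      and y1: "\<bar>y1\<bar> \<le> \<bar>x1\<bar>" and bit: "bitangent_pair (x1, y1) (x2, y2)" for x1 y1 x2 y2
  proof -
    \<comment> \<open>R bounds the norm on the whole chord, so one number controls all derivatives
      of \<open>\<phi>\<close> there.\<close>
    define R where "R = \<bar>x1\<bar> + \<bar>y1\<bar> + \<bar>x2\<bar> + \<bar>y2\<bar>"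
    have R: "0 \<le> R" "R < d0" "R < 1" using small by (auto simp: R_def \<delta>_def)
    define a b where ab: "a = x2 - x1" "b = y2 - y1"
    have seg_norm: "norm ((x1, y1) + s *\<^sub>R (a, b)) \<le> R" if "0 \<le> s" "s \<le> 1" for s
    proof -
      have "(x1, y1) + s *\<^sub>R (a, b) = (1 - s) *\<^sub>R (x1, y1) + s *\<^sub>R (x2, y2)"
        by (simp add: ab algebra_simps)
      also have "norm \<dots> \<le> (1 - s) * norm (x1, y1) + s * norm (x2, y2)"
        using that by (intro order_trans[OF norm_triangle_ineq]) (simp del: scaleR_Pair)
      also have "\<dots> \<le> 1 * norm (x1, y1) + 1 * norm (x2, y2)"
        using that by (intro add_mono mult_right_mono) auto
      also have "\<dots> \<le> R" using norm_Pair_le[of x1 y1] norm_Pair_le[of x2 y2] by (simp add: R_def)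
      finally show ?thesis .
    qed
    have seg: "(x1, y1) + s *\<^sub>R (a, b) \<in> U" if "0 \<le> s" "s \<le> 1" for s
      using d0(2) seg_norm[OF that] R by auto
    have b2: "\<bar>dir_deriv [u, v] \<phi> ((x1, y1) + s *\<^sub>R (a, b))\<bar> \<le> \<eta> * R\<^sup>2" if "0 \<le> s" "s \<le> 1" "u \<in> ?E" "v \<in> ?E" for s u v
    proof -
      have "\<bar>dir_deriv [u, v] \<phi> ((x1, y1) + s *\<^sub>R (a, b))\<bar> \<le> \<eta> * norm ((x1, y1) + s *\<^sub>R (a, b)) ^ 2"
        using d0(2) seg_norm[OF that(1,2)] R that(3,4) by (meson order.strict_trans1)
      also have "\<dots> \<le> \<eta> * R\<^sup>2" using seg_norm[OF that(1,2)] eta by (intro mult_left_mono power_mono) auto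
      finally show ?thesis .
    qed
    have b3: "\<bar>dir_deriv [u, v, w] \<phi> ((x1, y1) + s *\<^sub>R (a, b))\<bar> \<le> \<eta> * R" if "0 \<le> s" "s \<le> 1" "u \<in> ?E" "v \<in> ?E" "w \<in> ?E" for s u v w
    proof -
      have "\<bar>dir_deriv [u, v, w] \<phi> ((x1, y1) + s *\<^sub>R (a, b))\<bar> \<le> \<eta> * norm ((x1, y1) + s *\<^sub>R (a, b))"
        using d0(2) seg_norm[OF that(1,2)] R that(3-5) by (meson order.strict_trans1)
      also have "\<dots> \<le> \<eta> * R" using seg_norm[OF that(1,2)] eta by (intro mult_left_mono) auto
      finally show ?thesis .
    qed
    have end_pt: "(x1, y1) + (a, b) = (x2, y2)" by (simp add: ab)
    have U12: "(x1, y1) \<in> U" "(x2, y2) \<in> U"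
      using seg[of 0] seg[of 1] end_pt by (auto simp: zero_prod_def[symmetric])
    have gd: "\<bar>dir_deriv [v] \<phi> (x2, y2) - dir_deriv [v] \<phi> (x1, y1)\<bar> \<le> \<eta> * R\<^sup>2 * (\<bar>a\<bar> + \<bar>b\<bar>)" if "v \<in> ?E" for v
      using phi_gradient_difference[OF seg b2 that] unfolding end_pt by blast
    define gx1 gx2 gy1 gy2 where g: "gx1 = dir_deriv [(1, 0)] \<phi> (x1, y1)" "gx2 = dir_deriv [(1, 0)] \<phi> (x2, y2)"
      "gy1 = dir_deriv [(0, 1)] \<phi> (x1, y1)" "gy2 = dir_deriv [(0, 1)] \<phi> (x2, y2)"
    have fx: "dir_deriv [(1, 0)] nf (x1, y1) = - 2 * x1 * y1 + 2 * r * x1 ^ 3 + gx1"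
      "dir_deriv [(1, 0)] nf (x2, y2) = - 2 * x2 * y2 + 2 * r * x2 ^ 3 + gx2"
      and fy: "dir_deriv [(0, 1)] nf (x1, y1) = y1 - x1\<^sup>2 + gy1"
      "dir_deriv [(0, 1)] nf (x2, y2) = y2 - x2\<^sup>2 + gy2"
      unfolding g nf_derivs[OF U12(1)] nf_derivs[OF U12(2)] nf_poly_deriv1 by simp_all
    note eqs = bit[unfolded bitangent_pair_def fst_conv snd_conv fx fy]
    have ex: "\<bar>gx2 - gx1\<bar> \<le> \<eta> * R\<^sup>2 * (\<bar>a\<bar> + \<bar>b\<bar>)" and ey: "\<bar>gy2 - gy1\<bar> \<le> \<eta> * R\<^sup>2 * (\<bar>a\<bar> + \<bar>b\<bar>)"
      using gd[of "(1, 0)"] gd[of "(0, 1)"] unfolding g by blast+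
    have "\<eta> * R\<^sup>2 \<le> 1/2 * 1" using eta R by (intro mult_mono power_le_one) auto
    then have "\<eta> * R\<^sup>2 * (\<bar>a\<bar> + \<bar>b\<bar>) \<le> 1/2 * (\<bar>a\<bar> + \<bar>b\<bar>)" by (intro mult_right_mono) auto
    note half = this
    have "b = (x1 + x2) * a - (gy2 - gy1)"
      using eqs by (simp add: ab power2_eq_square algebra_simps)
    then have "\<bar>b\<bar> \<le> \<bar>(x1 + x2) * a\<bar> + \<bar>gy2 - gy1\<bar>"
      using abs_triangle_ineq4 by metis
    also have "\<dots> \<le> 1/2 * \<bar>a\<bar> + 1/2 * (\<bar>a\<bar> + \<bar>b\<bar>)"
    proof (rule add_mono)
      show "\<bar>(x1 + x2) * a\<bar> \<le> 1/2 * \<bar>a\<bar>"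
        unfolding abs_mult using small abs_triangle_ineq[of x1 x2] by (intro mult_right_mono) (auto simp: \<delta>_def)
      show "\<bar>gy2 - gy1\<bar> \<le> 1/2 * (\<bar>a\<bar> + \<bar>b\<bar>)"
        by (rule order_trans[OF ey half])
    qed
    finally have "\<bar>b\<bar> \<le> 1/2 * \<bar>a\<bar> + 1/2 * (\<bar>a\<bar> + \<bar>b\<bar>)" .
    \<comment> \<open>The equality of the y-derivatives bounds the vertical distance by the
      horizontal one. Distinct points thus have distinct abscissas, and |a| alone measures the
      chord.\<close>
    then have ba: "\<bar>b\<bar> \<le> 2 * \<bar>a\<bar>" by argo
    then have a0: "x1 \<noteq> x2" using ne by (auto simp: ab)
    define M where "M = max \<bar>x1\<bar> \<bar>x2\<bar>"
    have M: "\<bar>x1\<bar> \<le> M" "\<bar>x2\<bar> \<le> M" "0 \<le> M" "M \<le> 1" using small by (auto simp: M_def \<delta>_def)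
    have "\<bar>y2\<bar> \<le> \<bar>y1\<bar> + \<bar>b\<bar>" "\<bar>a\<bar> \<le> \<bar>x1\<bar> + \<bar>x2\<bar>" by (simp_all add: ab)
    \<comment> \<open>|x1|, |x2| and |y1| are at most M, while |y2| is at most |y1| + 2 |a|, hence
      at most 5 M; the total is 8 M.\<close>
    then have RM: "R \<le> 8 * M" unfolding R_def using ba y1 M by argo
    have "\<eta> * R\<^sup>2 * (\<bar>a\<bar> + \<bar>b\<bar>) \<le> \<eta> * (8 * M)\<^sup>2 * (3 * \<bar>a\<bar>)"
      using eta R RM ba by (intro mult_mono power_mono mult_nonneg_nonneg) auto
    also have "\<dots> = (192 * \<eta>) * (M\<^sup>2 * \<bar>a\<bar>)" by (simp add: power_mult_distrib)
    also have "\<dots> \<le> e * (M\<^sup>2 * \<bar>a\<bar>)" using eta by (intro mult_right_mono) auto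
    finally have small2: "\<eta> * R\<^sup>2 * (\<bar>a\<bar> + \<bar>b\<bar>) \<le> e * M\<^sup>2 * \<bar>a\<bar>" by (simp add: mult.assoc)
    have "\<eta> * R * (\<bar>a\<bar> + \<bar>b\<bar>) ^ 3 \<le> \<eta> * (8 * M) * (3 * \<bar>a\<bar>) ^ 3"
      using eta R RM ba by (intro mult_mono power_mono mult_nonneg_nonneg) auto
    also have "\<dots> = (216 * \<eta>) * (M * \<bar>a\<bar> ^ 3)" by (simp add: power_mult_distrib)
    also have "\<dots> \<le> e * (M * \<bar>a\<bar> ^ 3)" using eta M by (intro mult_right_mono) auto
    finally have small3: "\<eta> * R * (\<bar>a\<bar> + \<bar>b\<bar>) ^ 3 \<le> e * M * \<bar>a\<bar> ^ 3" by (simp add: mult.assoc)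
    have 1: "\<bar>(y2 - y1) - (x2\<^sup>2 - x1\<^sup>2)\<bar> \<le> e * M\<^sup>2 * \<bar>x2 - x1\<bar>"
      using eqs ey small2 unfolding ab by linarith
    have 2: "\<bar>- 2 * (x2 * y2 - x1 * y1) + 2 * r * (x2 ^ 3 - x1 ^ 3)\<bar> \<le> e * M\<^sup>2 * \<bar>x2 - x1\<bar>"
    proof -
      have "- 2 * (x2 * y2 - x1 * y1) + 2 * r * (x2 ^ 3 - x1 ^ 3) = - (gx2 - gx1)"
        using eqs by (simp add: algebra_simps)
      then show ?thesis using ex small2 unfolding ab by linarith
    qed
    have da: "dir_deriv [(a, b)] \<phi> q = a * dir_deriv [(1, 0)] \<phi> q + b * dir_deriv [(0, 1)] \<phi> q" if "q \<in> U" for q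
      using dir_deriv_linear_arg[OF openU smooth_phi that, of "[]" a b "[]"] by simp
    have tz: "\<bar>\<phi> (x2, y2) - \<phi> (x1, y1) - ((a * gx1 + b * gy1) + (a * gx2 + b * gy2)) / 2\<bar> \<le> e * M * \<bar>a\<bar> ^ 3"
      using phi_trapezoid[OF seg b3] small3 unfolding end_pt da[OF U12(1)] da[OF U12(2)] g by linarith
    have nfs: "nf (x, y) = y\<^sup>2 / 2 - x\<^sup>2 * y + r / 2 * x ^ 4 + \<phi> (x, y)" for x y
      by (simp add: normal_form_fun_def)
    \<comment> \<open>(G, H) is the common gradient at the two points; it serves to eliminate the
      derivatives of \<open>\<phi>\<close>.\<close>
    define G H where GH: "G = - 2 * x1 * y1 + 2 * r * x1 ^ 3 + gx1" "H = y1 - x1\<^sup>2 + gy1"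
    have gx: "gx1 = G + 2 * x1 * y1 - 2 * r * x1 ^ 3" "gx2 = G + 2 * x2 * y2 - 2 * r * x2 ^ 3"
      "gy1 = H - y1 + x1\<^sup>2" "gy2 = H - y2 + x2\<^sup>2" using eqs by (simp_all add: GH)
    have GH2: "- 2 * x2 * y2 + 2 * r * x2 ^ 3 + gx2 = G" "y2 - x2\<^sup>2 + gy2 = H"
      using eqs by (simp_all add: GH)
    have "nf (x1, y1) - x1 * G - y1 * H = nf (x2, y2) - x2 * G - y2 * H"
      using eqs unfolding GH[symmetric] GH2 by blast
    then have "nf (x2, y2) - nf (x1, y1) = a * G + b * H"
      by (simp add: ab algebra_simps)
    then have "\<phi> (x2, y2) - \<phi> (x1, y1) = a * G + b * H - (y2\<^sup>2 / 2 - x2\<^sup>2 * y2 + r / 2 * x2 ^ 4) + (y1\<^sup>2 / 2 - x1\<^sup>2 * y1 + r / 2 * x1 ^ 4)"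
      unfolding nfs by linarith
    \<comment> \<open>Exactness of the rule for the whole function makes the error for
      \<open>\<phi>\<close> minus that for the polynomial, and the latter is divisible by (x2 -
      x1)^2.\<close>
    then have "\<phi> (x2, y2) - \<phi> (x1, y1) - ((a * gx1 + b * gy1) + (a * gx2 + b * gy2)) / 2 =
        - ((x2 - x1)\<^sup>2 * ((y2 - y1) - r * (x1 + x2) * (x2 - x1)) / 2)"
      unfolding gx ab by (simp add: field_simps power2_eq_square power3_eq_cube power4_eq_xxxx)
    then have 3: "\<bar>(x2 - x1)\<^sup>2 * ((y2 - y1) - r * (x1 + x2) * (x2 - x1)) / 2\<bar> \<le> e * M * \<bar>x2 - x1\<bar> ^ 3"
      using tz unfolding ab by simp
    have "\<bar>y1 - r * x1\<^sup>2\<bar> \<le> 20 * e * x1\<^sup>2"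
      by (rule bitangent_arithmetic[OF M_def M(4) a0 e(1,2) r 1 2 3])
    also have "\<dots> \<le> \<epsilon> * x1\<^sup>2" using e(3) by (intro mult_right_mono) auto
    finally show ?thesis .
  qed
  moreover have "0 < \<delta>" using d0 by (simp add: \<delta>_def)
  ultimately show thesis using that by blast
qed


text \<open>Lets all chart facts be applied to the pieces of S whose own conodal curves enter
  \<open>germ_conodal\<close>.\<close>

lemma restrict_chart:
  assumes "open W" "affine_pt B (0, 0, 0) \<in> W" "open V'" "V' \<subseteq> V" "(0, 0, 0) \<in> V'"
  shows "normal_chart (S \<inter> W) B r \<phi> U (V' \<inter> affine_pt B -` W)"
proof unfold_locales
  show "open (V' \<inter> affine_pt B -` W)"
    using assms open_affine_pt_vimage[OF inv] by blast
  show "affine_pt B (x, y, z) \<in> S \<inter> W \<longleftrightarrow> z = nf (x, y)" if "(x, y, z) \<in> V' \<inter> affine_pt B -` W" for x y z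
    using that graph[of x y z] assms(4) by auto
  show "(x, y) \<in> U" if "(x, y, z) \<in> V' \<inter> affine_pt B -` W" for x y z
    using that domain[of x y z] assms(4) by auto
  show "has_local_equation (S \<inter> W) p" if "p \<in> S \<inter> W" for p
    using that surface has_local_equation_Int assms(1) by blast
qed (use inv openU smooth smooth_phi jet assms in auto)

lemma bitangent_pairI:
  assumes p: "(x, y, nf (x, y)) \<in> V" and q: "(x', y', nf (x', y')) \<in> V"
    and "tangential_map S (affine_pt B (x, y, nf (x, y))) = tangential_map S (affine_pt B (x', y', nf (x', y')))"
  shows "bitangent_pair (x, y) (x', y')"
  using tangential_map_eqD[OF p point_in_surface(2)[OF p] q point_in_surface(2)[OF q] assms(3)]
  by (simp add: bitangent_pair_def del: dir_deriv.simps)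

text \<open>The germ condition holds for every small neighbourhood, so one may be chosen for each
  \<epsilon>. In it all pairs with a common tangent plane obey \<open>bitangent_estimate\<close>,
  whence c differs from r by at most \<epsilon>.\<close>

lemma conodal_coefficient:
  assumes r: "r \<noteq> 1" and D: "germ_conodal S (affine_pt B (0, 0, 0)) (\<lambda>D. has_2jet B nf D c)"
  shows "c = r"
proof -
  let ?g = "affine_pt B (0, 0, 0)"
  obtain W0 where W0: "open W0" "?g \<in> W0"
    "\<And>W. open W \<Longrightarrow> ?g \<in> W \<Longrightarrow> W \<subseteq> W0 \<Longrightarrow> has_2jet B nf (conodal_curve (S \<inter> W)) c"
    using D unfolding germ_conodal_def by blast
  have "\<bar>c - r\<bar> \<le> \<epsilon>" if eps: "0 < \<epsilon>" for \<epsilon>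
  proof -
    obtain \<delta> where \<delta>: "0 < \<delta>"
      "\<And>x1 y1 x2 y2. \<bar>x1\<bar> < \<delta> \<Longrightarrow> \<bar>y1\<bar> < \<delta> \<Longrightarrow> \<bar>x2\<bar> < \<delta> \<Longrightarrow> \<bar>y2\<bar> < \<delta> \<Longrightarrow> (x1, y1) \<noteq> (x2, y2) \<Longrightarrow>
        \<bar>y1\<bar> \<le> \<bar>x1\<bar> \<Longrightarrow> bitangent_pair (x1, y1) (x2, y2) \<Longrightarrow> \<bar>y1 - r * x1\<^sup>2\<bar> \<le> \<epsilon> * x1\<^sup>2"
      using bitangent_estimate[OF r eps] by blast
    define V' where "V' = V \<inter> {-\<delta><..<\<delta>} \<times> {-\<delta><..<\<delta>} \<times> UNIV"
    have V': "open V'" "V' \<subseteq> V" "(0, 0, 0) \<in> V'"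
      using openV origin \<delta>(1) by (auto simp: V'_def intro!: open_Int open_Times)
    \<comment> \<open>W lies over the box of size \<delta>, so the partner of a bitangent point of
      \<open>S \<inter> W\<close> is in the box as well.\<close>
    define W where "W = W0 \<inter> affine_pt B ` V'"
    have W: "open W" "?g \<in> W" "W \<subseteq> W0"
      using W0 V' open_affine_pt_image[OF inv V'(1)] by (auto simp: W_def)
    interpret loc: normal_chart "S \<inter> W" B r \<phi> U "V' \<inter> affine_pt B -` W"
      by (rule restrict_chart[OF W(1,2) V'])
    obtain h \<epsilon>' where h: "0 < \<epsilon>'" "smooth_on {-\<epsilon>'<..<\<epsilon>'} h" "h 0 = 0" "deriv h 0 = 0" "deriv (deriv h) 0 = 2 * c"
      and C: "\<forall>x\<in>{-\<epsilon>'<..<\<epsilon>'}. \<forall>y\<in>{-\<epsilon>'<..<\<epsilon>'}. affine_pt B (x, y, nf (x, y)) \<in> conodal_curve (S \<inter> W) \<longleftrightarrow> y = h x"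
      using W0(3)[OF W] unfolding has_2jet_def by blast
    note lim = two_jet_limits[OF h]
    have ne: "\<forall>\<^sub>F x::real in at 0. x \<noteq> 0" by (simp add: eventually_at_filter)
    have "((\<lambda>x. \<bar>h x / x\<^sup>2 * x\<bar>) \<longlongrightarrow> \<bar>c * 0\<bar>) (at 0)" by (intro tendsto_intros lim(1))
    then have "\<forall>\<^sub>F x in at 0. \<bar>h x / x\<^sup>2 * x\<bar> < 1" by (rule order_tendstoD) simp
    then have "\<forall>\<^sub>F x in at 0. \<bar>h x / x\<^sup>2 - r\<bar> \<le> \<epsilon>"
      using eventually_curve[OF h C] ne
    proof eventually_elim
      case (elim x)
      have hx: "\<bar>h x\<bar> < \<bar>x\<bar>" using elim(1,3) by (simp add: abs_mult power2_eq_square field_simps)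
      have "\<bar>h x - r * x\<^sup>2\<bar> \<le> \<epsilon> * x\<^sup>2"
      proof (rule ccontr)
        assume "\<not> \<bar>h x - r * x\<^sup>2\<bar> \<le> \<epsilon> * x\<^sup>2"
        \<comment> \<open>Affine points in the wedge that violate the estimate. This set is open, so
          a point of the conodal closure in it would force a genuine bitangent point in it.\<close>
        define Q where "Q = {p :: real \<times> real \<times> real. \<epsilon> * (fst p)\<^sup>2 < \<bar>fst (snd p) - r * (fst p)\<^sup>2\<bar> \<and> \<bar>fst (snd p)\<bar> < \<bar>fst p\<bar>}"
        have "open Q" unfolding Q_def
          by (intro open_Collect_conj open_Collect_less continuous_intros)
        then have oQ: "open (affine_pt B ` Q)" by (rule open_affine_pt_image[OF inv])
        have "affine_pt B (x, h x, nf (x, h x)) \<in> affine_pt B ` Q"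
          using hx \<open>\<not> \<bar>h x - r * x\<^sup>2\<bar> \<le> \<epsilon> * x\<^sup>2\<close> by (intro imageI) (simp add: Q_def)
        moreover have "affine_pt B (x, h x, nf (x, h x)) \<in>
            closure {p \<in> S \<inter> W. \<exists>q\<in>S \<inter> W. q \<noteq> p \<and> tangential_map (S \<inter> W) q = tangential_map (S \<inter> W) p}"
          using elim(2) unfolding conodal_curve_def by blast
        ultimately obtain p where p: "p \<in> affine_pt B ` Q" "p \<in> S \<inter> W"
          "\<exists>q\<in>S \<inter> W. q \<noteq> p \<and> tangential_map (S \<inter> W) q = tangential_map (S \<inter> W) p"
          using open_Int_closure_eq_empty[OF oQ] by blast
        then obtain q where q: "q \<in> S \<inter> W" "q \<noteq> p" "tangential_map (S \<inter> W) q = tangential_map (S \<inter> W) p"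
          by blast
        have chart: "\<exists>a b. t = affine_pt B (a, b, nf (a, b)) \<and> (a, b, nf (a, b)) \<in> V' \<inter> affine_pt B -` W"
          if t: "t \<in> S \<inter> W" for t
        proof -
          obtain a b z where abz: "t = affine_pt B (a, b, z)" "(a, b, z) \<in> V'"
            using t by (auto simp: W_def)
          then have "z = nf (a, b)" using graph[of a b z] V'(2) t by blast
          then show ?thesis using abz t by auto
        qed
        obtain x1 y1 where p1: "p = affine_pt B (x1, y1, nf (x1, y1))" "(x1, y1, nf (x1, y1)) \<in> V' \<inter> affine_pt B -` W"
          using chart[OF p(2)] by blast
        obtain x2 y2 where q1: "q = affine_pt B (x2, y2, nf (x2, y2))" "(x2, y2, nf (x2, y2)) \<in> V' \<inter> affine_pt B -` W"
          using chart[OF q(1)] by blast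
        have "bitangent_pair (x1, y1) (x2, y2)"
          using loc.bitangent_pairI[OF p1(2) q1(2)] q(3) p1(1) q1(1) by simp
        moreover have pQ: "(x1, y1, nf (x1, y1)) \<in> Q"
          using p(1) p1(1) by (auto simp: affine_pt_eq_iff[OF inv])
        moreover have "(x1, y1) \<noteq> (x2, y2)" using q(2) p1(1) q1(1) by auto
        ultimately have "\<bar>y1 - r * x1\<^sup>2\<bar> \<le> \<epsilon> * x1\<^sup>2"
          using p1(2) q1(2) by (intro \<delta>(2)[of x1 y1 x2 y2]) (auto simp: V'_def Q_def abs_less_iff)
        then show False using pQ by (simp add: Q_def)
      qed
      then have "\<bar>h x - r * x\<^sup>2\<bar> / x\<^sup>2 \<le> \<epsilon>" using elim(3) by (simp add: pos_divide_le_eq)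
      moreover have "h x / x\<^sup>2 - r = (h x - r * x\<^sup>2) / x\<^sup>2" using elim(3) by (simp add: field_simps)
      ultimately show ?case by (simp add: abs_divide)
    qed
    moreover have "((\<lambda>x. \<bar>h x / x\<^sup>2 - r\<bar>) \<longlongrightarrow> \<bar>c - r\<bar>) (at 0)" by (intro tendsto_intros lim(1))
    ultimately show ?thesis by (intro tendsto_upperbound) auto
  qed
  then have "\<bar>c - r\<bar> \<le> 0" by (rule field_le_epsilon) simp
  then show ?thesis by simp
qed

end

section \<open>Legendrian slopes and the cross-ratio\<close>

lemma curve_tangentE:
  assumes "curve_tangent C p w"
  obtains \<gamma> where "\<gamma> 0 = p" "(\<gamma> has_vector_derivative w) (at (0::real))" "w \<noteq> 0" "\<forall>\<^sub>F t in nhds 0. \<gamma> t \<in> C"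
proof -
  obtain \<gamma> e W \<eta> where \<gamma>: "0 < e" "smooth_on {-e<..<e::real} \<gamma>" "\<forall>t\<in>{-e<..<e}. vector_derivative \<gamma> (at t) \<noteq> 0"
    "homeomorphism {-e<..<e} (C \<inter> W) \<gamma> \<eta>" "\<gamma> 0 = p" "vector_derivative \<gamma> (at 0) = w"
    using assms unfolding curve_tangent_def by blast
  have "(\<gamma> has_derivative frechet_derivative \<gamma> (at 0)) (at 0)"
    by (rule frechet_derivative_smooth[OF \<gamma>(2)]) (use \<gamma>(1) in auto)
  then have "\<gamma> differentiable (at 0)" by (auto simp: differentiable_def)
  then have "(\<gamma> has_vector_derivative w) (at 0)" using vector_derivative_works \<gamma>(6) by blast
  moreover have "\<forall>\<^sub>F t in nhds 0. t \<in> {-e<..<e}" by (rule eventually_nhds_in_open) (use \<gamma>(1) in auto)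
  then have "\<forall>\<^sub>F t in nhds 0. \<gamma> t \<in> C"
    by eventually_elim (use homeomorphism_image1[OF \<gamma>(4)] in blast)
  ultimately show thesis using that \<gamma>(1,3,5,6) by auto
qed

lemma smooth_on_curve_derivative:
  fixes \<psi> :: "'a::real_normed_vector \<Rightarrow> real"
  assumes "smooth_on N \<psi>" "open N" "q t \<in> N" "(q has_vector_derivative w) (at t)"
  shows "((\<lambda>s. dir_deriv vs \<psi> (q s)) has_real_derivative dir_deriv (w # vs) \<psi> (q t)) (at t)"
proof -
  note d = smooth_on_has_derivative[OF assms(1-3), of vs]
  have "(dir_deriv vs \<psi> \<circ> q has_derivative (\<lambda>v. dir_deriv (v # vs) \<psi> (q t)) \<circ> (\<lambda>s. s *\<^sub>R w)) (at t)"
    by (rule diff_chain_at[where f = q and x = t]) (use assms(4) d in \<open>simp_all add: has_vector_derivative_def\<close>)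
  moreover have "(\<lambda>v. dir_deriv (v # vs) \<psi> (q t)) \<circ> (\<lambda>s. s *\<^sub>R w) = (*) (dir_deriv (w # vs) \<psi> (q t))"
    using linear_scale[OF has_derivative_linear[OF d]] by (auto simp: fun_eq_iff)
  ultimately show ?thesis by (simp only: has_field_derivative_def o_def)
qed

lemma DERIV_eventually_zero:
  fixes f :: "real \<Rightarrow> real"
  assumes "(f has_real_derivative d) (at a)" "\<forall>\<^sub>F t in nhds a. f t = 0"
  shows "d = 0"
  using assms DERIV_cong_ev[OF refl assms(2) refl] DERIV_unique[OF _ DERIV_const] by blast

text \<open>An arbitrary parametrisation near g, seen in the normal form chart. N is a neighbourhood
  of the origin with image in the chart; the full domain \<open>U\<sigma>\<close> is kept because
  \<open>pull\<close> refers to it.\<close>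

locale parametrised_chart = normal_chart S B r \<phi> U V for S B r \<phi> U V +
  fixes N :: "(real \<times> real) set" and U\<sigma> and \<sigma> :: "real \<times> real \<Rightarrow> real^4"
  assumes N: "open N" "(0, 0) \<in> N" "N \<subseteq> U\<sigma>" and sm: "smooth_on N \<sigma>"
    and Nchart: "\<And>q. q \<in> N \<Longrightarrow> coord B 4 (\<sigma> q) \<noteq> 0 \<and> affine_coords (\<sigma> q) \<in> V \<and> proj (\<sigma> q) \<in> S"
    and base: "affine_coords (\<sigma> (0, 0)) = (0, 0, 0)"
    and immersion: "dim {\<sigma> (0, 0), frechet_derivative \<sigma> (at (0, 0)) (1, 0), frechet_derivative \<sigma> (at (0, 0)) (0, 1)} = 3"
begin

definition X :: "real \<times> real \<Rightarrow> real" where "X q = coord B 1 (\<sigma> q) * inverse (coord B 4 (\<sigma> q))"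
definition Y :: "real \<times> real \<Rightarrow> real" where "Y q = coord B 2 (\<sigma> q) * inverse (coord B 4 (\<sigma> q))"
definition Z :: "real \<times> real \<Rightarrow> real" where "Z q = coord B 3 (\<sigma> q) * inverse (coord B 4 (\<sigma> q))"

lemma XYZ_smooth: "smooth_on N X" "smooth_on N Y" "smooth_on N Z"
  unfolding X_def[abs_def] Y_def[abs_def] Z_def[abs_def]
  by (intro smooth_on_mult smooth_on_inverse smooth_on_linear_compose[OF N(1) sm coord_linear] N(1) ballI;
      use Nchart in blast)+

lemma affine_sigma: "affine_coords (\<sigma> q) = (X q, Y q, Z q)"
  by (simp add: affine_coords_def X_def Y_def Z_def divide_inverse)

lemma Z_eq: "q \<in> N \<Longrightarrow> Z q = nf (X q, Y q)"
  using proj_in_surface[of "\<sigma> q"] Nchart[of q] by (simp add: height_def X_def Y_def Z_def divide_inverse)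

lemma proj_sigma: "q \<in> N \<Longrightarrow> proj (\<sigma> q) = affine_pt B (X q, Y q, nf (X q, Y q))"
  using proj_affine_pt[OF inv, of "\<sigma> q"] Nchart[of q] Z_eq[of q] by (simp add: X_def Y_def Z_def divide_inverse)

lemma XYZ0: "X (0, 0) = 0" "Y (0, 0) = 0" "Z (0, 0) = 0"
  using base affine_sigma by auto

text \<open>If X and Y are stationary in a direction, so is Z = nf (X, Y). Then all affine
  coordinates are stationary and the derivative of \<sigma> is a multiple of \<sigma>, against the
  rank condition.\<close>

lemma coordinates_immersive:
  assumes "dir_deriv [(a, b)] X (0, 0) = 0" "dir_deriv [(a, b)] Y (0, 0) = 0"
  shows "(a, b) = (0, 0)"
proof (rule ccontr)
  assume ab: "(a, b) \<noteq> (0, 0)"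
  let ?o = "(0, 0) :: real \<times> real"
  let ?D = "frechet_derivative \<sigma> (at ?o)"
  have D: "(\<sigma> has_derivative ?D) (at ?o)" by (rule frechet_derivative_smooth[OF sm N(1,2)])
  define k where "k = coord B 4 (\<sigma> ?o)"
  have k: "k \<noteq> 0" using Nchart[OF N(2)] by (simp add: k_def)
  have q: "((\<lambda>t. t *\<^sub>R (a, b)) has_vector_derivative (a, b)) (at (0::real))"
    by (auto intro!: derivative_eq_intros)
  note chain = smooth_on_curve_derivative[OF _ N(1) _ q, of _ "[]", unfolded dir_deriv.simps(1)]
  have N0: "(0::real) *\<^sub>R (a, b) \<in> N" using N(2) by (simp add: zero_prod_def)
  have nfd: "((\<lambda>t. nf (X (t *\<^sub>R (a, b)), Y (t *\<^sub>R (a, b)))) has_real_derivative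
      dir_deriv [(0, 0)] nf (X (0 *\<^sub>R (a, b)), Y (0 *\<^sub>R (a, b)))) (at 0)"
  proof (rule smooth_on_curve_derivative[OF smooth openU, of "\<lambda>t. (X (t *\<^sub>R (a, b)), Y (t *\<^sub>R (a, b)))" 0 "(0, 0)" "[]", simplified dir_deriv.simps(1)])
    show "(X (0 *\<^sub>R (a, b)), Y (0 *\<^sub>R (a, b))) \<in> U" using XYZ0 origin_U by (simp add: zero_prod_def)
    have "((\<lambda>t. X (t *\<^sub>R (a, b))) has_vector_derivative 0) (at 0)" "((\<lambda>t. Y (t *\<^sub>R (a, b))) has_vector_derivative 0) (at 0)"
      using chain[OF XYZ_smooth(1) N0] chain[OF XYZ_smooth(2) N0] assms
      by (simp_all add: has_real_derivative_iff_has_vector_derivative)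
    then show "((\<lambda>t. (X (t *\<^sub>R (a, b)), Y (t *\<^sub>R (a, b)))) has_vector_derivative (0, 0)) (at 0)"
      by (rule has_vector_derivative_Pair)
  qed
  have nf0: "dir_deriv [(0, 0)] nf p = 0" if "p \<in> U" for p
    using linear_0[OF has_derivative_linear[OF smooth_on_has_derivative[OF smooth openU that, of "[]"]]] by (simp add: zero_prod_def)
  have "(X (0 *\<^sub>R (a, b)), Y (0 *\<^sub>R (a, b))) \<in> U" using XYZ0 origin_U by (simp add: zero_prod_def)
  note nfd = nfd[unfolded nf0[OF this]]
  have "\<forall>\<^sub>F t in nhds 0. t *\<^sub>R (a, b) \<in> N"
  proof -
    have "((\<lambda>t. t *\<^sub>R (a, b)) \<longlongrightarrow> 0 *\<^sub>R (a, b)) (nhds 0)" by (intro tendsto_intros filterlim_ident)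
    then show ?thesis using topological_tendstoD N(1) N0 by blast
  qed
  then have evZ: "\<forall>\<^sub>F t in nhds 0. nf (X (t *\<^sub>R (a, b)), Y (t *\<^sub>R (a, b))) = Z (t *\<^sub>R (a, b))"
    by eventually_elim (simp add: Z_eq)
  have "((\<lambda>t. Z (t *\<^sub>R (a, b))) has_real_derivative 0) (at 0)"
    by (rule DERIV_cong_ev[OF refl evZ refl, THEN iffD1, OF nfd])
  from DERIV_unique[OF chain[OF XYZ_smooth(3) N0] this]
  have dZ: "dir_deriv [(a, b)] Z (0, 0) = 0" by simp
  \<comment> \<open>At the origin the numerators vanish, so the quotient rule reduces to dividing
    the derivative of the numerator by k.\<close>
  have quot: "coord B i (?D (a, b)) = 0"
    if "dir_deriv [(a, b)] (\<lambda>q. coord B i (\<sigma> q) * inverse (coord B 4 (\<sigma> q))) ?o = 0"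
      "coord B i (\<sigma> ?o) * inverse (coord B 4 (\<sigma> ?o)) = 0" for i
  proof -
    have c: "((\<lambda>q. coord B j (\<sigma> q)) has_derivative (\<lambda>w. coord B j (?D w))) (at ?o)" for j
      by (rule bounded_linear.has_derivative[OF coord_linear D])
    have i0: "coord B i (\<sigma> ?o) = 0" using that(2) k by (simp add: k_def)
    have "((\<lambda>q. coord B i (\<sigma> q) * inverse (coord B 4 (\<sigma> q))) has_derivative (\<lambda>w. coord B i (?D w) * inverse k)) (at ?o)"
      using has_derivative_mult[OF c[of i] Deriv.has_derivative_inverse[OF _ c[of 4]]] k i0 by (simp add: k_def)
    from frechet_derivative_at[OF this, symmetric] show ?thesis using that(1) k by simp
  qed
  have "coord B 1 (?D (a, b)) = 0" "coord B 2 (?D (a, b)) = 0" "coord B 3 (?D (a, b)) = 0"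
    using assms dZ XYZ0 by (intro quot; simp add: X_def[abs_def] Y_def[abs_def] Z_def[abs_def])+
  then have w: "?D (a, b) = coord B 4 (?D (a, b)) *\<^sub>R hom B 0 0 0 1"
    using hom_coord[OF inv, of "?D (a, b)"] by (simp add: hom_scale)
  have "\<sigma> ?o = k *\<^sub>R hom B 0 0 0 1"
    using hom_coord[OF inv, of "\<sigma> ?o"] XYZ0 k by (simp add: hom_scale X_def Y_def Z_def k_def)
  then have "hom B 0 0 0 1 = inverse k *\<^sub>R \<sigma> ?o" using k by simp
  with w have w': "?D (a, b) = (coord B 4 (?D (a, b)) * inverse k) *\<^sub>R \<sigma> ?o" by simp
  have lin: "?D (a, b) = a *\<^sub>R ?D (1, 0) + b *\<^sub>R ?D (0, 1)"
    using linear_add[OF has_derivative_linear[OF D], of "a *\<^sub>R (1, 0)" "b *\<^sub>R (0, 1)"]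
      linear_scale[OF has_derivative_linear[OF D], of a "(1, 0)"]
      linear_scale[OF has_derivative_linear[OF D], of b "(0, 1)"] by simp
  from lin w' obtain s where s: "a *\<^sub>R ?D (1, 0) + b *\<^sub>R ?D (0, 1) = s *\<^sub>R \<sigma> ?o" by metis
  have "\<exists>t. dim {\<sigma> ?o, ?D (1, 0), ?D (0, 1)} = dim {\<sigma> ?o, t}"
  proof (cases "a = 0")
    case True
    then have "b \<noteq> 0" using ab by simp
    have "?D (0, 1) = inverse b *\<^sub>R (b *\<^sub>R ?D (0, 1))" using \<open>b \<noteq> 0\<close> by simp
    also have "\<dots> = inverse b *\<^sub>R s *\<^sub>R \<sigma> ?o" using s True by simp
    finally have "?D (0, 1) \<in> span {\<sigma> ?o, ?D (1, 0)}" by (metis insertI1 span_base span_scale)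
    then have "dim {?D (0, 1), \<sigma> ?o, ?D (1, 0)} = dim {\<sigma> ?o, ?D (1, 0)}" by (simp add: dim_insert)
    then show ?thesis by (metis insert_commute)
  next
    case False
    have "a *\<^sub>R ?D (1, 0) = s *\<^sub>R \<sigma> ?o - b *\<^sub>R ?D (0, 1)" using s by (simp add: algebra_simps)
    then have "(1 / a) *\<^sub>R (a *\<^sub>R ?D (1, 0)) = (1 / a) *\<^sub>R (s *\<^sub>R \<sigma> ?o - b *\<^sub>R ?D (0, 1))" by (rule arg_cong)
    then have "?D (1, 0) = (1 / a) *\<^sub>R (s *\<^sub>R \<sigma> ?o - b *\<^sub>R ?D (0, 1))" using False by simp
    moreover have "(1 / a) *\<^sub>R (s *\<^sub>R \<sigma> ?o - b *\<^sub>R ?D (0, 1)) \<in> span {\<sigma> ?o, ?D (0, 1)}"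
      by (intro span_scale span_diff) (auto intro: span_base)
    ultimately have "dim {?D (1, 0), \<sigma> ?o, ?D (0, 1)} = dim {\<sigma> ?o, ?D (0, 1)}" by (simp add: dim_insert)
    then show ?thesis by (metis insert_commute)
  qed
  then obtain t where "dim {\<sigma> ?o, t} = 3" using immersion by auto
  moreover have "dim {\<sigma> ?o, t} \<le> card {\<sigma> ?o, t}" by (intro dim_le_card') auto
  moreover have "card {\<sigma> ?o, t} \<le> 2" by (simp add: card_insert_if)
  ultimately show False by simp
qed

lemma curve_equation:
  assumes "0 < \<epsilon>"
    and C: "\<forall>x\<in>{-\<epsilon><..<\<epsilon>}. \<forall>y\<in>{-\<epsilon><..<\<epsilon>}. affine_pt B (x, y, nf (x, y)) \<in> C \<longleftrightarrow> y = h x"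
    and q: "q \<in> N" "\<bar>X q\<bar> < \<epsilon>" "\<bar>Y q\<bar> < \<epsilon>" "q \<in> pull U\<sigma> \<sigma> C"
  shows "Y q = h (X q)"
  using C[rule_format, of "X q" "Y q"] q proj_sigma[OF q(1)] by (auto simp: pull_def abs_less_iff)

text \<open>Y = h (X) is differentiated twice: once along the curve for its slope, once along the
  lift. As h' (0) = 0 and h'' (0) = 2 c, only c depends on the curve; K, L and Yv belong to the
  parametrisation and the common slope m. Slopes of lifts are thus one affine function of c.\<close>

lemma legendrian_slope:
  assumes jet: "has_2jet B nf C c" and t: "curve_tangent (legendrian_lift (pull U\<sigma> \<sigma> C)) (0, 0, m) w"
  defines "K \<equiv> dir_deriv [(1, m), (1, 0)] Y (0, 0) + m * dir_deriv [(1, m), (0, 1)] Y (0, 0)"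
    and "L \<equiv> dir_deriv [(1, m)] X (0, 0)" and "Yv \<equiv> dir_deriv [(0, 1)] Y (0, 0)"
  shows "Yv \<noteq> 0" "L \<noteq> 0" "fst w \<noteq> 0" "snd (snd w) * Yv + fst w * K = 2 * c * fst w * L\<^sup>2"
proof -
  let ?o = "(0, 0) :: real \<times> real"
  obtain h \<epsilon> where h: "0 < \<epsilon>" "smooth_on {-\<epsilon><..<\<epsilon>} h" "h 0 = 0" "deriv h 0 = 0" "deriv (deriv h) 0 = 2 * c"
    and C: "\<forall>x\<in>{-\<epsilon><..<\<epsilon>}. \<forall>y\<in>{-\<epsilon><..<\<epsilon>}. affine_pt B (x, y, nf (x, y)) \<in> C \<longleftrightarrow> y = h x"
    using jet unfolding has_2jet_def by blast
  let ?I = "{-\<epsilon><..<\<epsilon>}"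
  have dh: "(deriv ^^ j) h 0 = dir_deriv (replicate j 1) h 0" for j
    using funpow_deriv_line[OF h(2), of 0 0 1 j] h(1) by simp
  have h1: "dir_deriv [1] h 0 = 0" using dh[of 1] h(4) by simp
  have h2: "dir_deriv [1, 1] h 0 = 2 * c" using dh[of 2] h(5) by (simp add: numeral_2_eq_2)
  have h_chain: "((\<lambda>s. dir_deriv vs h (k s)) has_real_derivative d * dir_deriv (1 # vs) h (k t)) (at t)"
    if "k t \<in> ?I" "(k has_real_derivative d) (at t)" for k d t vs
  proof -
    have "dir_deriv (d # vs) h (k t) = d * dir_deriv (1 # vs) h (k t)"
      using linear_scale[OF has_derivative_linear[OF smooth_on_has_derivative[OF h(2) _ that(1), of vs]], of d 1] by simp
    then show ?thesis
      using smooth_on_curve_derivative[of ?I h k t d vs] h(2) that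
      by (simp add: has_real_derivative_iff_has_vector_derivative del: dir_deriv.simps)
  qed
  define near where "near q \<longleftrightarrow> q \<in> N \<and> \<bar>X q\<bar> < \<epsilon> \<and> \<bar>Y q\<bar> < \<epsilon>" for q
  have near: "\<forall>\<^sub>F q in nhds ?o. near q"
  proof -
    have "((\<lambda>q. \<bar>X q\<bar>) \<longlongrightarrow> \<bar>X ?o\<bar>) (nhds ?o)" "((\<lambda>q. \<bar>Y q\<bar>) \<longlongrightarrow> \<bar>Y ?o\<bar>) (nhds ?o)"
      using smooth_on_continuous[OF XYZ_smooth(1) N(1,2), of "[]"] smooth_on_continuous[OF XYZ_smooth(2) N(1,2), of "[]"]
      by (auto intro!: tendsto_rabs simp: continuous_at tendsto_at_iff_tendsto_nhds)
    then have "\<forall>\<^sub>F q in nhds ?o. \<bar>X q\<bar> < \<epsilon>" "\<forall>\<^sub>F q in nhds ?o. \<bar>Y q\<bar> < \<epsilon>"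
      using order_tendstoD(2)[where a = \<epsilon>] XYZ0 h(1) by simp_all
    then show ?thesis unfolding near_def
      using eventually_nhds_in_open[OF N(1,2)] by (intro eventually_conj)
  qed
  \<comment> \<open>The slope equation holds at every contact element near the base point, not only
    there, and can therefore be differentiated along \<gamma>.\<close>
  have lift: "Y q = h (X q) \<and> dir_deriv [(1, 0)] Y q + n * dir_deriv [(0, 1)] Y q =
      dir_deriv [1] h (X q) * (dir_deriv [(1, 0)] X q + n * dir_deriv [(0, 1)] X q)"
    if nq: "near q" and l: "(fst q, snd q, n) \<in> legendrian_lift (pull U\<sigma> \<sigma> C)" for q n
  proof -
    have "curve_tangent (pull U\<sigma> \<sigma> C) q (1, n)" using l by (simp add: legendrian_lift_def)
    then obtain k where k: "k 0 = q" "(k has_vector_derivative (1, n)) (at (0::real))" "\<forall>\<^sub>F s in nhds 0. k s \<in> pull U\<sigma> \<sigma> C"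
      using curve_tangentE by blast
    have kc: "(k \<longlongrightarrow> k 0) (nhds 0)"
      using has_vector_derivative_continuous[OF k(2)] by (simp add: continuous_at tendsto_at_iff_tendsto_nhds)
    have q: "q \<in> N" "X q \<in> ?I" "\<bar>X q\<bar> < \<epsilon>" "\<bar>Y q\<bar> < \<epsilon>" using nq by (auto simp: near_def abs_less_iff)
    have nk: "\<forall>\<^sub>F s in nhds 0. near (k s)"
    proof -
      have c: "isCont X q" "isCont Y q"
        using smooth_on_continuous[OF XYZ_smooth(1) N(1) q(1), of "[]"] smooth_on_continuous[OF XYZ_smooth(2) N(1) q(1), of "[]"] by auto
      then have "((\<lambda>s. \<bar>X (k s)\<bar>) \<longlongrightarrow> \<bar>X q\<bar>) (nhds 0)" "((\<lambda>s. \<bar>Y (k s)\<bar>) \<longlongrightarrow> \<bar>Y q\<bar>) (nhds 0)"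
        using tendsto_rabs[OF isCont_tendsto_compose[OF c(1) kc[unfolded k(1)]]]
          tendsto_rabs[OF isCont_tendsto_compose[OF c(2) kc[unfolded k(1)]]] by blast+
      then have "\<forall>\<^sub>F s in nhds 0. \<bar>X (k s)\<bar> < \<epsilon>" "\<forall>\<^sub>F s in nhds 0. \<bar>Y (k s)\<bar> < \<epsilon>"
        using order_tendstoD(2)[where a = \<epsilon>] q by blast+
      moreover have "\<forall>\<^sub>F s in nhds 0. k s \<in> N"
        using topological_tendstoD[OF kc N(1)] k(1) q(1) by simp
      ultimately show ?thesis unfolding near_def by (intro eventually_conj)
    qed
    have ev: "\<forall>\<^sub>F s in nhds 0. Y (k s) - h (X (k s)) = 0"
      using nk k(3) by eventually_elim (use curve_equation[OF h(1) C] in \<open>auto simp: near_def\<close>)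
    have dX: "((\<lambda>s. X (k s)) has_real_derivative dir_deriv [(1, n)] X q) (at 0)"
      and dY: "((\<lambda>s. Y (k s)) has_real_derivative dir_deriv [(1, n)] Y q) (at 0)"
      using smooth_on_curve_derivative[OF XYZ_smooth(1) N(1) _ k(2), of "[]"]
        smooth_on_curve_derivative[OF XYZ_smooth(2) N(1) _ k(2), of "[]"] q(1) k(1) by simp_all
    have "((\<lambda>s. h (X (k s))) has_real_derivative dir_deriv [(1, n)] X q * dir_deriv [1] h (X q)) (at 0)"
      using h_chain[OF _ dX, of "[]"] q(2) k(1) by simp
    from DERIV_eventually_zero[OF DERIV_diff[OF dY this] ev]
    have "dir_deriv [(1, n)] Y q = dir_deriv [(1, n)] X q * dir_deriv [1] h (X q)" by simp
    moreover have "dir_deriv [(1, n)] Y q = dir_deriv [(1, 0)] Y q + n * dir_deriv [(0, 1)] Y q"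
      "dir_deriv [(1, n)] X q = dir_deriv [(1, 0)] X q + n * dir_deriv [(0, 1)] X q"
      using dir_deriv_linear_arg[OF N(1) XYZ_smooth(1) q(1), of "[]" 1 n "[]"]
        dir_deriv_linear_arg[OF N(1) XYZ_smooth(2) q(1), of "[]" 1 n "[]"] by simp_all
    ultimately show ?thesis
      using ev eventually_nhds_x_imp_x k(1) by (fastforce simp: mult.commute simp del: dir_deriv.simps)
  qed
  obtain \<gamma> where \<gamma>: "\<gamma> 0 = (0, 0, m)" "(\<gamma> has_vector_derivative w) (at (0::real))" "w \<noteq> 0"
    "\<forall>\<^sub>F s in nhds 0. \<gamma> s \<in> legendrian_lift (pull U\<sigma> \<sigma> C)"
    using curve_tangentE[OF t] by blast
  define a b d where w: "a = fst w" "b = fst (snd w)" "d = snd (snd w)"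
  define q where "q s = (fst (\<gamma> s), fst (snd (\<gamma> s)))" for s
  define n where "n s = snd (snd (\<gamma> s))" for s
  have q0: "q 0 = ?o" "n 0 = m" using \<gamma>(1) by (simp_all add: q_def n_def)
  have dq: "(q has_vector_derivative (a, b)) (at 0)"
    unfolding q_def[abs_def] w
    by (intro has_vector_derivative_Pair bounded_linear.has_vector_derivative[OF bounded_linear_fst]
        bounded_linear.has_vector_derivative[OF bounded_linear_snd] \<gamma>(2))
  have dn: "(n has_real_derivative d) (at 0)"
    unfolding n_def[abs_def] w has_real_derivative_iff_has_vector_derivative
    by (intro bounded_linear.has_vector_derivative[OF bounded_linear_snd] \<gamma>(2))
  have "(q \<longlongrightarrow> ?o) (nhds 0)"
    using has_vector_derivative_continuous[OF dq, unfolded continuous_at tendsto_at_iff_tendsto_nhds] q0(1) by simp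
  then have "\<forall>\<^sub>F s in nhds 0. near (q s)" using near unfolding filterlim_iff by blast
  with \<gamma>(4) have ev: "\<forall>\<^sub>F s in nhds 0. Y (q s) = h (X (q s)) \<and> dir_deriv [(1, 0)] Y (q s) + n s * dir_deriv [(0, 1)] Y (q s) =
      dir_deriv [1] h (X (q s)) * (dir_deriv [(1, 0)] X (q s) + n s * dir_deriv [(0, 1)] X (q s))"
    by eventually_elim (rule lift, auto simp: q_def n_def)
  note chain = smooth_on_curve_derivative[OF _ N(1) _ dq, unfolded q0(1), OF _ N(2)]
  have X0I: "X (q 0) \<in> ?I" using q0 XYZ0 h(1) by simp
  have lX: "dir_deriv [(u, v)] X ?o = u * dir_deriv [(1, 0)] X ?o + v * dir_deriv [(0, 1)] X ?o" for u v
    using dir_deriv_linear_arg[OF N(1) XYZ_smooth(1) N(2), of "[]" u v "[]"] by simp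
  have lY: "dir_deriv ((u, v) # vs) Y ?o = u * dir_deriv ((1, 0) # vs) Y ?o + v * dir_deriv ((0, 1) # vs) Y ?o" for u v vs
    using dir_deriv_linear_arg[OF N(1) XYZ_smooth(2) N(2), of "[]" u v vs] by simp
  have dX: "((\<lambda>s. X (q s)) has_real_derivative dir_deriv [(a, b)] X ?o) (at 0)"
    using chain[OF XYZ_smooth(1), of "[]"] by simp
  have "((\<lambda>s. h (X (q s))) has_real_derivative dir_deriv [(a, b)] X ?o * dir_deriv [1] h 0) (at 0)"
    using h_chain[OF X0I dX, of "[]"] q0 XYZ0 by simp
  from DERIV_diff[OF chain[OF XYZ_smooth(2), of "[]", unfolded dir_deriv.simps(1)] this]
  have "((\<lambda>s. Y (q s) - h (X (q s))) has_real_derivative dir_deriv [(a, b)] Y ?o) (at 0)"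
    using h1 by simp
  then have tan: "dir_deriv [(a, b)] Y ?o = 0"
    by (rule DERIV_eventually_zero) (use ev in \<open>auto elim: eventually_mono\<close>)
  have m0: "dir_deriv [(1, 0)] Y ?o + m * Yv = 0"
    using eventually_nhds_x_imp_x[OF ev] q0 XYZ0 h1 by (simp add: Yv_def del: dir_deriv.simps)
  \<comment> \<open>If Yv = 0, the derivative of Y vanishes altogether; a kernel direction of the
    derivative of X then contradicts \<open>coordinates_immersive\<close>.\<close>
  show Yv: "Yv \<noteq> 0"
  proof
    assume 0: "Yv = 0"
    then have Y0: "dir_deriv [(u, v)] Y ?o = 0" for u v using m0 lY[of u v "[]"] by (simp add: Yv_def)
    define xu xv where x: "xu = dir_deriv [(1, 0)] X ?o" "xv = dir_deriv [(0, 1)] X ?o"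
    have "dir_deriv [(xv, - xu)] X ?o = 0" unfolding lX[of xv "- xu"] x[symmetric] by simp
    from coordinates_immersive[OF this Y0] have "xu = 0" by simp
    then have "dir_deriv [(1, 0)] X ?o = 0" unfolding x .
    from coordinates_immersive[OF this Y0] show False by simp
  qed
  have Y1m: "dir_deriv [(1, m)] Y ?o = 0" using m0 lY[of 1 m "[]"] by (simp add: Yv_def)
  show L: "L \<noteq> 0"
  proof
    assume "L = 0"
    from coordinates_immersive[OF this[unfolded L_def] Y1m] show False by simp
  qed
  \<comment> \<open>The tangent vector of the lift lies in the contact plane.\<close>
  have b: "b = m * a"
  proof -
    have "dir_deriv [(1, 0)] Y ?o = - m * Yv" using m0 by linarith
    from tan[unfolded lY[of a b "[]"] this Yv_def[symmetric]]
    have "(b - m * a) * Yv = 0" by (simp add: algebra_simps)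
    then show ?thesis using Yv by simp
  qed
  define G where "G s = dir_deriv [(1, 0)] Y (q s) + n s * dir_deriv [(0, 1)] Y (q s) -
      dir_deriv [1] h (X (q s)) * (dir_deriv [(1, 0)] X (q s) + n s * dir_deriv [(0, 1)] X (q s))" for s
  have dh': "((\<lambda>s. dir_deriv [1] h (X (q s))) has_real_derivative dir_deriv [(a, b)] X ?o * (2 * c)) (at 0)"
    using h_chain[OF X0I dX, of "[1]"] q0 XYZ0 h2 by (simp del: dir_deriv.simps)
  have "(G has_real_derivative (dir_deriv [(a, b), (1, 0)] Y ?o + (d * dir_deriv [(0, 1)] Y ?o + dir_deriv [(a, b), (0, 1)] Y ?o * m)) -
      ((dir_deriv [(a, b)] X ?o * (2 * c)) * (dir_deriv [(1, 0)] X ?o + m * dir_deriv [(0, 1)] X ?o) +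
       (dir_deriv [(a, b), (1, 0)] X ?o + (d * dir_deriv [(0, 1)] X ?o + dir_deriv [(a, b), (0, 1)] X ?o * m)) * dir_deriv [1] h 0)) (at 0)"
    unfolding G_def[abs_def]
    using DERIV_diff[OF DERIV_add[OF chain[OF XYZ_smooth(2), of "[(1, 0)]"] DERIV_mult[OF dn chain[OF XYZ_smooth(2), of "[(0, 1)]"]]]
        DERIV_mult[OF dh' DERIV_add[OF chain[OF XYZ_smooth(1), of "[(1, 0)]"] DERIV_mult[OF dn chain[OF XYZ_smooth(1), of "[(0, 1)]"]]]]]
    unfolding q0 XYZ0 .
  moreover have "\<forall>\<^sub>F s in nhds 0. G s = 0"
    using ev by eventually_elim (simp add: G_def del: dir_deriv.simps)
  ultimately have "(dir_deriv [(a, b), (1, 0)] Y ?o + (d * Yv + dir_deriv [(a, b), (0, 1)] Y ?o * m)) -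
      ((dir_deriv [(a, b)] X ?o * (2 * c)) * L) = 0"
    using DERIV_eventually_zero h1 unfolding L_def lX[of 1 m] Yv_def by fastforce
  moreover have "dir_deriv [(a, b)] X ?o = a * L"
    unfolding L_def b lX[of a "m * a"] lX[of 1 m] by (simp add: algebra_simps del: dir_deriv.simps)
  moreover have "dir_deriv [(a, b), v] Y ?o = a * dir_deriv [(1, m), v] Y ?o" for v
    unfolding b lY[of a "m * a"] lY[of 1 m] by (simp add: algebra_simps del: dir_deriv.simps)
  ultimately have eq: "d * Yv + a * K = 2 * c * a * L\<^sup>2"
    unfolding K_def by (simp add: algebra_simps power2_eq_square del: dir_deriv.simps)
  then show "snd (snd w) * Yv + fst w * K = 2 * c * fst w * L\<^sup>2" by (simp add: w)
  show "fst w \<noteq> 0"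
  proof
    assume "fst w = 0"
    then have "a = 0" "b = 0" "d = 0" using eq b Yv by (auto simp: w)
    then show False using \<gamma>(3) by (simp add: w prod_eq_iff)
  qed
qed

end

lemma fibre_tangent:
  assumes "curve_tangent (fibre (0, 0)) (0, 0, m) w"
  shows "fst w = 0" "snd (snd w) \<noteq> 0"
proof -
  obtain \<gamma> where \<gamma>: "\<gamma> 0 = (0, 0, m)" "(\<gamma> has_vector_derivative w) (at (0::real))" "w \<noteq> 0" "\<forall>\<^sub>F t in nhds 0. \<gamma> t \<in> fibre (0, 0)"
    using curve_tangentE[OF assms] by blast
  have "((\<lambda>t. fst (\<gamma> t)) has_vector_derivative fst w) (at 0)" "((\<lambda>t. fst (snd (\<gamma> t))) has_vector_derivative fst (snd w)) (at 0)"
    by (intro bounded_linear.has_vector_derivative[OF bounded_linear_fst]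
        bounded_linear.has_vector_derivative[OF bounded_linear_snd] \<gamma>(2))+
  then have d: "((\<lambda>t. fst (\<gamma> t)) has_real_derivative fst w) (at 0)" "((\<lambda>t. fst (snd (\<gamma> t))) has_real_derivative fst (snd w)) (at 0)"
    by (simp_all add: has_real_derivative_iff_has_vector_derivative)
  have "fst w = 0" by (rule DERIV_eventually_zero[OF d(1)]) (use \<gamma>(4) in \<open>auto simp: fibre_def elim!: eventually_mono\<close>)
  moreover have "fst (snd w) = 0" by (rule DERIV_eventually_zero[OF d(2)]) (use \<gamma>(4) in \<open>auto simp: fibre_def elim!: eventually_mono\<close>)
  ultimately show "fst w = 0" "snd (snd w) \<noteq> 0" using \<gamma>(3) by (auto simp: prod_eq_iff)
qed

text \<open>The basis in \<open>has_cross_ratio\<close> is unknown, but any alternating form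
  replaces \<open>det2\<close> up to a common factor, and the scalings of the four spanning vectors
  cancel. The ratio can thus be computed with one convenient form A.\<close>

lemma cross_ratio_alternating:
  fixes A :: "'a::real_vector \<Rightarrow> 'a \<Rightarrow> real"
  assumes cr: "has_cross_ratio E (span {w1}) (span {w2}) (span {w3}) (span {w4}) \<rho>"
    and A: "\<And>e f p q s t. A (p *\<^sub>R e + q *\<^sub>R f) (s *\<^sub>R e + t *\<^sub>R f) = (p * t - s * q) * A e f"
    and ne: "A w1 w4 \<noteq> 0"
  shows "A w2 w3 \<noteq> 0" "\<rho> * (A w2 w3 * A w1 w4) = A w1 w3 * A w2 w4"
proof -
  obtain e f a b c d where cr': "independent {e, f}" "e \<noteq> f"
    "span {w1} = span {fst a *\<^sub>R e + snd a *\<^sub>R f}" "span {w2} = span {fst b *\<^sub>R e + snd b *\<^sub>R f}"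
    "span {w3} = span {fst c *\<^sub>R e + snd c *\<^sub>R f}" "span {w4} = span {fst d *\<^sub>R e + snd d *\<^sub>R f}"
    "a \<noteq> 0" "b \<noteq> 0" "c \<noteq> 0" "d \<noteq> 0" "det2 b c \<noteq> 0" "det2 a d \<noteq> 0"
    "\<rho> = (det2 a c * det2 b d) / (det2 b c * det2 a d)"
    using cr unfolding has_cross_ratio_def by blast
  have scale: "\<exists>k. k \<noteq> 0 \<and> w = (k * fst p) *\<^sub>R e + (k * snd p) *\<^sub>R f"
    if "span {w} = span {fst p *\<^sub>R e + snd p *\<^sub>R f}" "p \<noteq> 0" for w and p :: "real \<times> real"
  proof -
    have ne: "fst p *\<^sub>R e + snd p *\<^sub>R f \<noteq> 0"
    proof
      assume 0: "fst p *\<^sub>R e + snd p *\<^sub>R f = 0"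
      have "fst p = 0 \<and> snd p = 0"
      proof (rule ccontr)
        assume "\<not> (fst p = 0 \<and> snd p = 0)"
        then have "dependent {e, f}"
          unfolding dependent_explicit
          by (intro exI[of _ "{e, f}"] exI[of _ "\<lambda>v. if v = e then fst p else snd p"]) (use 0 cr'(2) in auto)
        then show False using cr'(1) by simp
      qed
      then show False using that(2) by (simp add: prod_eq_iff)
    qed
    have "fst p *\<^sub>R e + snd p *\<^sub>R f \<in> span {w}" using that(1) by (metis span_base singletonI)
    then have "w \<noteq> 0" using ne by (auto simp: span_singleton)
    moreover have "w \<in> span {fst p *\<^sub>R e + snd p *\<^sub>R f}" using that(1) by (metis span_base singletonI)
    then obtain k where "w = k *\<^sub>R (fst p *\<^sub>R e + snd p *\<^sub>R f)" by (auto simp: span_singleton)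
    ultimately show ?thesis by (intro exI[of _ k]) (auto simp: scaleR_add_right)
  qed
  obtain k1 where k1: "k1 \<noteq> 0" "w1 = (k1 * fst a) *\<^sub>R e + (k1 * snd a) *\<^sub>R f" using scale[OF cr'(3,7)] by blast
  obtain k2 where k2: "k2 \<noteq> 0" "w2 = (k2 * fst b) *\<^sub>R e + (k2 * snd b) *\<^sub>R f" using scale[OF cr'(4,8)] by blast
  obtain k3 where k3: "k3 \<noteq> 0" "w3 = (k3 * fst c) *\<^sub>R e + (k3 * snd c) *\<^sub>R f" using scale[OF cr'(5,9)] by blast
  obtain k4 where k4: "k4 \<noteq> 0" "w4 = (k4 * fst d) *\<^sub>R e + (k4 * snd d) *\<^sub>R f" using scale[OF cr'(6,10)] by blast
  have det: "det2 p q = fst p * snd q - fst q * snd p" for p q by (simp add: det2_def case_prod_beta)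
  have Aw: "A w1 w4 = k1 * k4 * det2 a d * A e f" "A w2 w3 = k2 * k3 * det2 b c * A e f"
    "A w1 w3 = k1 * k3 * det2 a c * A e f" "A w2 w4 = k2 * k4 * det2 b d * A e f"
    unfolding k1(2) k2(2) k3(2) k4(2) A det by (simp_all add: algebra_simps)
  then have "A e f \<noteq> 0" using ne by auto
  then show "A w2 w3 \<noteq> 0" using Aw k2 k3 cr'(11) by simp
  have "\<rho> * (det2 b c * det2 a d) = det2 a c * det2 b d" using cr'(11-13) by simp
  then have "\<rho> * (det2 b c * det2 a d) * (k1 * k2 * k3 * k4 * A e f * A e f) = det2 a c * det2 b d * (k1 * k2 * k3 * k4 * A e f * A e f)"
    by simp
  then show "\<rho> * (A w2 w3 * A w1 w4) = A w1 w3 * A w2 w4"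
    unfolding Aw by (simp only: mult.assoc mult.commute mult.left_commute)
qed

section \<open>From the hypotheses to charts and to the coefficients\<close>

lemma proj_surj: obtains v where "v \<noteq> 0" "proj v = p"
proof -
  obtain L where L: "subspace L" "dim L = 1" "p = Abs_rp3 L"
    using Abs_rp3_cases[of p] by auto
  obtain A where A: "A \<subseteq> L" "independent A" "L \<subseteq> span A" "card A = dim L"
    using basis_exists[of L] by metis
  then obtain v where v: "A = {v}" using L(2) by (auto simp: card_1_singleton_iff)
  have "L = span {v}" using A L(1) v span_minimal[of "{v}" L] by auto
  moreover have "v \<noteq> 0" using A(2) v dependent_zero by auto
  ultimately show thesis using that L(3) by (simp add: proj_def)
qed

lemma smooth_surface_local_equation: "smooth_surface S \<Longrightarrow> p \<in> S \<Longrightarrow> has_local_equation S p"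
  using proj_surj[of p] by (metis has_local_equation_def smooth_surface_def)

lemma normal_form_chart:
  assumes "smooth_surface S" "normal_form S g B r \<phi>"
  obtains U V where "normal_chart S B r \<phi> U V"
proof -
  obtain U V where nf: "invertible B" "open U" "(0, 0) \<in> U" "smooth_on U \<phi>"
    "\<forall>vs. length vs \<le> 4 \<longrightarrow> dir_deriv vs \<phi> (0, 0) = 0" "open V" "(0, 0, 0) \<in> V"
    "\<forall>(x, y, z)\<in>V. affine_pt B (x, y, z) \<in> S \<longleftrightarrow> z = normal_form_fun r \<phi> (x, y)"
    using assms(2) unfolding normal_form_def by blast
  have "open ((\<lambda>p. (fst p, fst (snd p))) -` U :: (real \<times> real \<times> real) set)"
    by (intro open_vimage nf(2) continuous_intros)
  moreover have "V \<inter> (\<lambda>p. (fst p, fst (snd p))) -` U = {(x, y, z). (x, y, z) \<in> V \<and> (x, y) \<in> U}" by auto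
  ultimately have "open {(x, y, z). (x, y, z) \<in> V \<and> (x, y) \<in> U}"
    using nf(6) by (metis open_Int)
  then have "normal_chart S B r \<phi> U {(x, y, z). (x, y, z) \<in> V \<and> (x, y) \<in> U}"
    by unfold_locales
      (use nf normal_form_smooth[OF nf(2,4)] smooth_surface_local_equation[OF assms(1)] in auto)
  then show thesis using that by blast
qed

text \<open>Continuity gives the neighbourhood N. The rank condition excludes that \<sigma> vanishes
  at the origin, so its value there is a multiple of \<open>hom B 0 0 0 1\<close>.\<close>

lemma (in normal_chart) param_chart:
  assumes "surface_param S (affine_pt B (0, 0, 0)) U\<sigma> \<sigma>"
  obtains N where "parametrised_chart S B r \<phi> U V N U\<sigma> \<sigma>"
proof -
  obtain W \<tau> where p: "open U\<sigma>" "(0, 0) \<in> U\<sigma>" "smooth_on U\<sigma> \<sigma>" "proj (\<sigma> (0, 0)) = affine_pt B (0, 0, 0)"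
    "dim {\<sigma> (0, 0), frechet_derivative \<sigma> (at (0, 0)) (1, 0), frechet_derivative \<sigma> (at (0, 0)) (0, 1)} = 3"
    "homeomorphism U\<sigma> (S \<inter> W) (\<lambda>q. proj (\<sigma> q)) \<tau>"
    using assms unfolding surface_param_def by blast
  have "\<sigma> (0, 0) \<noteq> 0"
  proof
    assume "\<sigma> (0, 0) = 0"
    then have "dim {frechet_derivative \<sigma> (at (0, 0)) (1, 0), frechet_derivative \<sigma> (at (0, 0)) (0, 1)} = 3"
      using p(5) dim_insert[of "0 :: real^4"] by (simp add: span_zero)
    moreover have "dim {frechet_derivative \<sigma> (at (0, 0)) (1, 0), frechet_derivative \<sigma> (at (0, 0)) (0, 1)} \<le> 2"
      by (rule order_trans[OF dim_le_card']) (auto simp: card_insert_if)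
    ultimately show False by simp
  qed
  then obtain c where c: "c \<noteq> 0" "\<sigma> (0, 0) = c *\<^sub>R hom B 0 0 0 1"
    using proj_eq_chart_point p(4) by metis
  then have b: "coord B 4 (\<sigma> (0, 0)) \<noteq> 0" "affine_coords (\<sigma> (0, 0)) = (0, 0, 0)"
    using affine_hom[OF c(1), of 0 0 0] by (simp_all add: hom_scale coord_hom[OF inv])
  have "(\<sigma> \<longlongrightarrow> \<sigma> (0, 0)) (nhds (0, 0))"
    using smooth_on_continuous[OF p(3,1,2), of "[]"] by (simp add: continuous_at tendsto_at_iff_tendsto_nhds)
  moreover have "\<forall>\<^sub>F Q in nhds (\<sigma> (0, 0)). coord B 4 Q \<noteq> 0 \<and> affine_coords Q \<in> V"
    by (rule eventually_in_chart) (use b origin in auto)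
  ultimately have "\<forall>\<^sub>F q in nhds (0, 0). coord B 4 (\<sigma> q) \<noteq> 0 \<and> affine_coords (\<sigma> q) \<in> V"
    unfolding filterlim_iff by blast
  then have "\<forall>\<^sub>F q in nhds (0, 0). q \<in> U\<sigma> \<and> coord B 4 (\<sigma> q) \<noteq> 0 \<and> affine_coords (\<sigma> q) \<in> V"
    using eventually_nhds_in_open[OF p(1,2)] by (simp add: eventually_conj_iff)
  then obtain N where N: "open N" "(0, 0) \<in> N" "\<forall>q\<in>N. q \<in> U\<sigma> \<and> coord B 4 (\<sigma> q) \<noteq> 0 \<and> affine_coords (\<sigma> q) \<in> V"
    unfolding eventually_nhds by blast
  then have sub: "N \<subseteq> U\<sigma>" by blast
  have "proj (\<sigma> q) \<in> S" if "q \<in> U\<sigma>" for q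
    using homeomorphism_image1[OF p(6)] that by blast
  then have "parametrised_chart S B r \<phi> U V N U\<sigma> \<sigma>"
    by unfold_locales (use N b p smooth_on_subset[OF p(3) sub] sub in auto)
  then show thesis using that by blast
qed

text \<open>The identification cD = r requires r different from 1, which is not a hypothesis. The
  relation between \<rho> and the coefficients is therefore derived first, for whatever cD is; it
  excludes r = 1, and only then is cD computed.\<close>

theorem coefficients_from_cr_invariant:
  assumes S: "smooth_surface S" and cr: "is_cr_invariant S g \<rho>" and rho: "\<rho> \<noteq> 1"
    and cc: "canonical_coefficients S g cF cP cD"
  shows "cF = 2 * \<rho>\<^sup>2 - \<rho>" "cP = 3 * \<rho> - 2" "cD = \<rho>"
proof -
  obtain B r \<phi> where nf: "normal_form S g B r \<phi>"
    and F: "has_2jet B (normal_form_fun r \<phi>) (flecnodal_curve S) cF"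
    and P: "has_2jet B (normal_form_fun r \<phi>) (parabolic_curve S) cP"
    and D: "germ_conodal S g (\<lambda>D. has_2jet B (normal_form_fun r \<phi>) D cD)"
    using cc unfolding canonical_coefficients_def by blast
  obtain U V where "normal_chart S B r \<phi> U V" using normal_form_chart[OF S nf] .
  then interpret normal_chart S B r \<phi> U V .
  have g: "g = affine_pt B (0, 0, 0)" using nf by (simp add: normal_form_def)
  have cF: "cF = 2 * r\<^sup>2 - r" by (rule flecnodal_coefficient[OF F])
  have cP: "cP = 3 * r - 2" by (rule parabolic_coefficient[OF P])
  obtain U\<sigma> \<sigma> m wF wP wD wg where \<sigma>: "surface_param S g U\<sigma> \<sigma>"
    and tF: "curve_tangent (legendrian_lift (pull U\<sigma> \<sigma> (flecnodal_curve S))) (0, 0, m) wF"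
    and tP: "curve_tangent (legendrian_lift (pull U\<sigma> \<sigma> (parabolic_curve S))) (0, 0, m) wP"
    and tD: "germ_conodal S g (\<lambda>D. curve_tangent (legendrian_lift (pull U\<sigma> \<sigma> D)) (0, 0, m) wD)"
    and tg: "curve_tangent (fibre (0, 0)) (0, 0, m) wg"
    and ratio: "has_cross_ratio (contact_plane (0, 0, m)) (span {wF}) (span {wP}) (span {wD}) (span {wg}) \<rho>"
    using cr unfolding is_cr_invariant_def by blast
  obtain N where "parametrised_chart S B r \<phi> U V N U\<sigma> \<sigma>" using param_chart \<sigma> g by blast
  then interpret parametrised_chart S B r \<phi> U V N U\<sigma> \<sigma> .
  obtain W1 where W1: "open W1" "g \<in> W1" "\<And>W. open W \<Longrightarrow> g \<in> W \<Longrightarrow> W \<subseteq> W1 \<Longrightarrow> has_2jet B nf (conodal_curve (S \<inter> W)) cD"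
    using D unfolding germ_conodal_def by blast
  obtain W2 where W2: "open W2" "g \<in> W2" "\<And>W. open W \<Longrightarrow> g \<in> W \<Longrightarrow> W \<subseteq> W2 \<Longrightarrow>
      curve_tangent (legendrian_lift (pull U\<sigma> \<sigma> (conodal_curve (S \<inter> W)))) (0, 0, m) wD"
    using tD unfolding germ_conodal_def by blast
  \<comment> \<open>A common neighbourhood, so that the 2-jet and the Legendrian lift belong to the
    same conodal curve.\<close>
  have jD: "has_2jet B nf (conodal_curve (S \<inter> (W1 \<inter> W2))) cD"
    and tD': "curve_tangent (legendrian_lift (pull U\<sigma> \<sigma> (conodal_curve (S \<inter> (W1 \<inter> W2))))) (0, 0, m) wD"
    using W1(3)[of "W1 \<inter> W2"] W2(3)[of "W1 \<inter> W2"] W1(1,2) W2(1,2) by (simp_all add: open_Int)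
  define K L Yv where "K = dir_deriv [(1, m), (1, 0)] Y (0, 0) + m * dir_deriv [(1, m), (0, 1)] Y (0, 0)"
    and "L = dir_deriv [(1, m)] X (0, 0)" and "Yv = dir_deriv [(0, 1)] Y (0, 0)"
  note slope = legendrian_slope[where m = m, folded K_def L_def Yv_def]
  note sF = slope[OF F tF] and sP = slope[OF P tP] and sD = slope[OF jD tD']
  \<comment> \<open>The alternating form in the coordinates u and m, which parametrise every contact
    plane because dv = m du there.\<close>
  define A where "A v w = fst v * snd (snd w) - fst w * snd (snd v)" for v w :: "real \<times> real \<times> real"
  have Ag: "A w wg = fst w * snd (snd wg)" for w using fibre_tangent[OF tg] by (simp add: A_def)
  have Aslope: "A v w * Yv = 2 * L\<^sup>2 * (fst v * fst w) * (d - c)"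
    if "snd (snd v) * Yv + fst v * K = 2 * c * fst v * L\<^sup>2" "snd (snd w) * Yv + fst w * K = 2 * d * fst w * L\<^sup>2" for v w c d
  proof -
    have "A v w * Yv = fst v * (snd (snd w) * Yv + fst w * K) - fst w * (snd (snd v) * Yv + fst v * K)"
      by (simp add: A_def algebra_simps)
    also have "\<dots> = 2 * L\<^sup>2 * (fst v * fst w) * (d - c)" unfolding that by (simp add: algebra_simps)
    finally show ?thesis .
  qed
  have Aalt: "A (p *\<^sub>R e + q *\<^sub>R f) (s *\<^sub>R e + t *\<^sub>R f) = (p * t - s * q) * A e f" for e f p q s t
    by (simp add: A_def algebra_simps)
  have ne: "A wF wg \<noteq> 0" using fibre_tangent[OF tg] sF(3) by (simp add: Ag)
  note ar = cross_ratio_alternating[OF ratio, of A, OF Aalt ne]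
  \<comment> \<open>The nonzero denominator required by the cross-ratio separates the lines of P and
    D, hence their coefficients.\<close>
  have "cD \<noteq> cP" using ar(1) Aslope[OF sP(4) sD(4)] sP(1) by auto
  have "\<rho> * (A wP wD * Yv * A wF wg) = A wF wD * Yv * A wP wg"
    using ar(2) by (simp add: algebra_simps)
  then have "\<rho> * (cD - cP) * (2 * L\<^sup>2 * fst wP * fst wD * fst wF * snd (snd wg)) =
      (cD - cF) * (2 * L\<^sup>2 * fst wP * fst wD * fst wF * snd (snd wg))"
    unfolding Aslope[OF sP(4) sD(4)] Aslope[OF sF(4) sD(4)] Ag by (simp add: algebra_simps)
  then have eq: "\<rho> * (cD - cP) = cD - cF"
    using sF(2,3) sP(3) sD(3) fibre_tangent[OF tg] by simp
  \<comment> \<open>For r = 1 the coefficients of F and P coincide, and \<open>eq\<close> would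
    force \<rho> = 1.\<close>
  have "r \<noteq> 1"
  proof
    assume "r = 1"
    then have "cF = cP" using cF cP by simp
    then show False using eq \<open>cD \<noteq> cP\<close> rho by simp
  qed
  have cD: "cD = r"
    by (rule conodal_coefficient[OF \<open>r \<noteq> 1\<close>]) (use D g in simp)
  \<comment> \<open>Here cD - cP = 2 - 2 r and cD - cF = r (2 - 2 r).\<close>
  have "(\<rho> - r) * (2 - 2 * r) = 0" using eq unfolding cD cF cP by (simp add: power2_eq_square algebra_simps)
  then have "\<rho> = r" using \<open>r \<noteq> 1\<close> by simp
  then show "cF = 2 * \<rho>\<^sup>2 - \<rho>" "cP = 3 * \<rho> - 2" "cD = \<rho>" using cF cP cD by auto
qed

text \<open>All signs come from factorisations: cF - cP = 2 (\<rho> - 1)^2, cF = \<rho> (2 \<rho> -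
  1), cF - cD = 2 \<rho> (\<rho> - 1), cF - 1 = (2 \<rho> + 1)(\<rho> - 1). Their roots, with the
  root 2/3 of cP, are the excluded values.\<close>

lemma configuration_intervals:
  fixes \<rho> :: real
  assumes "\<rho> \<notin> {-1/2, 0, 1/2, 2/3, 1}" and c: "cF = 2 * \<rho>\<^sup>2 - \<rho>" "cP = 3 * \<rho> - 2" "cD = \<rho>"
  shows "(\<rho> \<in> {1<..} \<longleftrightarrow> 1 < cD \<and> cD < cP \<and> cP < cF) \<and>
        (\<rho> \<in> {2/3<..<1} \<longleftrightarrow> 0 < cP \<and> cP < cF \<and> cF < cD \<and> cD < 1) \<and>
        (\<rho> \<in> {1/2<..<2/3} \<longleftrightarrow> cP < 0 \<and> 0 < cF \<and> cF < cD \<and> cD < 1) \<and>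
        (\<rho> \<in> {0<..<1/2} \<longleftrightarrow> cP < cF \<and> cF < 0 \<and> 0 < cD \<and> cD < 1) \<and>
        (\<rho> \<in> {-1/2<..<0} \<longleftrightarrow> cP < cD \<and> cD < 0 \<and> 0 < cF \<and> cF < 1) \<and>
        (\<rho> \<in> {..<-1/2} \<longleftrightarrow> cP < cD \<and> cD < 0 \<and> 1 < cF)"
proof -
  have "cF - cP = 2 * (\<rho> - 1)\<^sup>2" unfolding c by (simp add: power2_eq_square algebra_simps)
  moreover have "0 < (\<rho> - 1)\<^sup>2" using assms(1) by simp
  ultimately have PF: "cP < cF" by linarith
  have F0: "0 < cF \<longleftrightarrow> \<rho> < 0 \<or> 1/2 < \<rho>" and F0': "cF < 0 \<longleftrightarrow> 0 < \<rho> \<and> \<rho> < 1/2"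
  proof -
    have "cF = \<rho> * (2 * \<rho> - 1)" unfolding c by (simp add: power2_eq_square algebra_simps)
    then show "0 < cF \<longleftrightarrow> \<rho> < 0 \<or> 1/2 < \<rho>" "cF < 0 \<longleftrightarrow> 0 < \<rho> \<and> \<rho> < 1/2"
      by (auto simp: zero_less_mult_iff mult_less_0_iff)
  qed
  have FD: "cF < cD \<longleftrightarrow> 0 < \<rho> \<and> \<rho> < 1"
  proof -
    have "cF - cD = 2 * (\<rho> * (\<rho> - 1))" unfolding c by (simp add: power2_eq_square algebra_simps)
    moreover have "\<rho> * (\<rho> - 1) < 0 \<longleftrightarrow> 0 < \<rho> \<and> \<rho> < 1" by (auto simp: mult_less_0_iff)
    ultimately show ?thesis by linarith
  qed
  have F1: "cF < 1 \<longleftrightarrow> -1/2 < \<rho> \<and> \<rho> < 1" and F1': "1 < cF \<longleftrightarrow> \<rho> < -1/2 \<or> 1 < \<rho>"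
  proof -
    have "cF - 1 = (2 * \<rho> + 1) * (\<rho> - 1)" unfolding c by (simp add: power2_eq_square algebra_simps)
    moreover have "(2 * \<rho> + 1) * (\<rho> - 1) < 0 \<longleftrightarrow> -1/2 < \<rho> \<and> \<rho> < 1" "0 < (2 * \<rho> + 1) * (\<rho> - 1) \<longleftrightarrow> \<rho> < -1/2 \<or> 1 < \<rho>"
      by (auto simp: mult_less_0_iff zero_less_mult_iff)
    ultimately show "cF < 1 \<longleftrightarrow> -1/2 < \<rho> \<and> \<rho> < 1" "1 < cF \<longleftrightarrow> \<rho> < -1/2 \<or> 1 < \<rho>" by linarith+
  qed
  show ?thesis
    unfolding F0 F0' FD F1 F1' using PF assms(1) unfolding c(2,3) by auto
qed

section \<open>The graphs of the normal form polynomials\<close>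

definition graph_surface :: "real \<Rightarrow> rp3 set" where
  "graph_surface r = {affine_pt (mat 1) (x, y, nf_poly r (x, y)) |x y. True}"

lemma invertible_mat_1: "invertible (mat 1 :: real^'n^'n)"
  by (auto simp: invertible_def intro!: exI[of _ "mat 1"])

lemma hom_mat1: "hom (mat 1) x y z t = vector [x, y, z, t]"
  by (simp add: hom_def)

lemma coord_mat1: "coord (mat 1) i v = v $ i"
proof -
  have "i = 1 \<or> i = 2 \<or> i = 3 \<or> i = 4" by (rule exhaust_4)
  then show ?thesis
    using arg_cong[OF hom_coord[of "mat 1" v], of "\<lambda>w. w $ i"]
    by (auto simp: hom_mat1 vector_4 invertible_mat_1)
qed

lemma nf_poly_eq: "nf_poly r (x, y) = y\<^sup>2 / 2 - x\<^sup>2 * y + r / 2 * x ^ 4"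
  by (simp add: nf_poly_def normal_form_fun_def)

lemma normal_form_fun_zero: "normal_form_fun r (\<lambda>_. 0) = nf_poly r"
  by (simp add: nf_poly_def)

lemma in_graph_surface: "affine_pt (mat 1) (x, y, z) \<in> graph_surface r \<longleftrightarrow> z = nf_poly r (x, y)"
  by (auto simp: graph_surface_def affine_pt_eq_iff[OF invertible_mat_1])

text \<open>The equation z = f multiplied by the fourth power of the last coordinate. Its derivative
  in the third coordinate is the cube of the last one, hence nonzero.\<close>

lemma graph_surface_equation:
  fixes v :: "real^4"
  assumes "v $ 4 \<noteq> 0"
  shows "local_equation (graph_surface r) v {w. w $ 4 \<noteq> 0}
    (\<lambda>w. (w $ 4) ^ 3 * w $ 3 - ((w $ 4)\<^sup>2 * (w $ 2)\<^sup>2 / 2 - w $ 4 * (w $ 1)\<^sup>2 * w $ 2 + r / 2 * (w $ 1) ^ 4))"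
    (is "local_equation _ _ ?W ?F")
  unfolding local_equation_def
proof (intro conjI ballI)
  show W: "open ?W" by (intro open_Collect_neq continuous_intros)
  show sm: "smooth_on ?W ?F"
    by (intro smooth_on_intros W smooth_on_nth_compose)
  show "v \<in> ?W" "0 \<notin> ?W" using assms by auto
  fix w :: "real^4" assume w: "w \<in> ?W"
  then have w4: "w $ 4 \<noteq> 0" by simp
  have "proj w \<in> graph_surface r \<longleftrightarrow> w $ 3 / w $ 4 = nf_poly r (w $ 1 / w $ 4, w $ 2 / w $ 4)"
    using proj_affine_pt[OF invertible_mat_1, of w] w4 in_graph_surface by (simp add: coord_mat1)
  also have "\<dots> \<longleftrightarrow> (w $ 3 / w $ 4 - nf_poly r (w $ 1 / w $ 4, w $ 2 / w $ 4)) * (w $ 4) ^ 4 = 0"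
    using w4 by simp
  also have "(w $ 3 / w $ 4 - nf_poly r (w $ 1 / w $ 4, w $ 2 / w $ 4)) * (w $ 4) ^ 4 = ?F w"
    using w4 by (simp add: nf_poly_eq power2_eq_square power3_eq_cube power4_eq_xxxx field_simps)
  finally show "proj w \<in> graph_surface r \<longleftrightarrow> ?F w = 0" .
  let ?e = "axis 3 1 :: real^4"
  have "((\<lambda>t. ?F (w + t *\<^sub>R ?e)) has_real_derivative (w $ 4) ^ 3) (at 0)"
    by (auto simp: axis_def intro!: derivative_eq_intros)
  moreover have "((\<lambda>t. ?F (w + t *\<^sub>R ?e)) has_real_derivative frechet_derivative ?F (at w) ?e) (at 0)"
    using smooth_on_line_derivative[OF sm W, of w 0 ?e "[]"] w by simp
  ultimately have "frechet_derivative ?F (at w) ?e = (w $ 4) ^ 3" using DERIV_unique by blast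
  then show "frechet_derivative ?F (at w) \<noteq> (\<lambda>_. 0)" using w4 by (metis power_not_zero)
qed

lemma graph_surface_smooth: "smooth_surface (graph_surface r)"
  unfolding smooth_surface_def
proof (intro allI impI)
  fix v assume v: "v \<noteq> 0 \<and> proj v \<in> graph_surface r"
  then obtain x y where "proj v = affine_pt (mat 1) (x, y, nf_poly r (x, y))"
    by (auto simp: graph_surface_def)
  then obtain c where "c \<noteq> 0" "v = c *\<^sub>R hom (mat 1) x y (nf_poly r (x, y)) 1"
    using v proj_eq_affine_pt_iff[OF invertible_mat_1] by blast
  then have "v $ 4 \<noteq> 0" by (simp add: hom_mat1 vector_4)
  then show "\<exists>W F. local_equation (graph_surface r) v W F" using graph_surface_equation by blast
qed

lemma graph_chart_example: "normal_chart (graph_surface r) (mat 1) r (\<lambda>_. 0) UNIV UNIV"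
proof unfold_locales
  show "smooth_on UNIV (normal_form_fun r (\<lambda>_. 0))"
    by (rule normal_form_smooth) (auto intro: smooth_on_constant)
  show "dir_deriv vs (\<lambda>_. 0::real) (0, 0::real) = 0" if "length vs \<le> 4" for vs :: "(real \<times> real) list"
    using dir_deriv_lincomb[of UNIV "\<lambda>_. 0" "\<lambda>_. 0" "(0, 0)" vs 0 0] by (simp add: smooth_on_constant)
qed (auto simp: invertible_mat_1 smooth_on_constant in_graph_surface normal_form_fun_zero
    intro: smooth_surface_local_equation[OF graph_surface_smooth])

lemma normal_chart_restrict:
  assumes "open W" "affine_pt (mat 1) (0, 0, 0) \<in> W"
  shows "normal_chart (graph_surface r \<inter> W) (mat 1) r (\<lambda>_. 0) UNIV (affine_pt (mat 1) -` W)"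
proof -
  interpret normal_chart "graph_surface r" "mat 1" r "\<lambda>_. 0" UNIV UNIV by (rule graph_chart_example)
  show ?thesis using restrict_chart[of W UNIV] assms by simp
qed

text \<open>Stated for open pieces of the graph, since germs of the conodal curve involve the
  tangential maps of such pieces.\<close>

lemma tangential_map_graph:
  assumes W: "open W" "affine_pt (mat 1) (0, 0, 0) \<in> W" "affine_pt (mat 1) (x, y, nf_poly r (x, y)) \<in> W"
  defines "p \<equiv> - 2 * x * y + 2 * r * x ^ 3" and "q \<equiv> y - x\<^sup>2"
  shows "tangential_map (graph_surface r \<inter> W) (affine_pt (mat 1) (x, y, nf_poly r (x, y))) =
    proj (vector [- p, - q, 1, - (nf_poly r (x, y) - x * p - y * q)])"
proof -
  interpret normal_chart "graph_surface r \<inter> W" "mat 1" r "\<lambda>_. 0" UNIV "affine_pt (mat 1) -` W"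
    by (rule normal_chart_restrict[OF W(1,2)])
  have V: "(x, y, nf (x, y)) \<in> affine_pt (mat 1) -` W" using W(3) by (simp add: normal_form_fun_zero)
  have "tangential_map (graph_surface r \<inter> W) (affine_pt (mat 1) (x, y, nf (x, y))) =
      proj (vector [- p, - q, 1, - (nf_poly r (x, y) - x * p - y * q)])"
  proof (rule tangential_map_eq[OF V point_in_surface(2)[OF V], of 1])
    fix Q :: "real^4"
    show "vector [- p, - q, 1, - (nf_poly r (x, y) - x * p - y * q)] \<bullet> Q = 1 * conormal (x, y) Q"
      unfolding conormal_def
      unfolding normal_form_fun_zero nf_poly_deriv1 p_def q_def
      by (simp add: inner_vec_def sum_4 vector_4 coord_mat1 algebra_simps)
  qed simp
  then show ?thesis by (simp add: normal_form_fun_zero)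
qed

text \<open>The exact counterpart of \<open>bitangent_estimate\<close>. With u the common
  y-derivative, the x-derivatives give u = (r - 1)(x1^2 + x1 x2 + x2^2), and the intercepts then
  reduce to (r - 1)(x2 - x1)^3 (x1 + x2) = 0.\<close>

lemma bitangent_iff:
  fixes r :: real
  assumes r: "r \<noteq> 1" and ne: "(x1, y1) \<noteq> (x2, y2)"
    and gx: "- 2 * x1 * y1 + 2 * r * x1 ^ 3 = - 2 * x2 * y2 + 2 * r * x2 ^ 3"
    and gy: "y1 - x1\<^sup>2 = y2 - x2\<^sup>2"
    and e: "nf_poly r (x1, y1) - x1 * (- 2 * x1 * y1 + 2 * r * x1 ^ 3) - y1 * (y1 - x1\<^sup>2) =
      nf_poly r (x2, y2) - x2 * (- 2 * x2 * y2 + 2 * r * x2 ^ 3) - y2 * (y2 - x2\<^sup>2)"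
  shows "x2 = - x1" "y1 = r * x1\<^sup>2" "y2 = y1"
proof -
  define u where "u = y1 - x1\<^sup>2"
  have y: "y1 = u + x1\<^sup>2" "y2 = u + x2\<^sup>2" using gy by (auto simp: u_def)
  have d: "x2 - x1 \<noteq> 0" using ne y by auto
  have "(x2 - x1) * ((r - 1) * (x1\<^sup>2 + x1 * x2 + x2\<^sup>2) - u) = 0"
    using gx unfolding y by (simp add: algebra_simps power2_eq_square power3_eq_cube)
  then have u: "u = (r - 1) * (x1\<^sup>2 + x1 * x2 + x2\<^sup>2)" using d by simp
  have "u * x1\<^sup>2 - 3/2 * (r - 1) * x1 ^ 4 = u * x2\<^sup>2 - 3/2 * (r - 1) * x2 ^ 4"
    using e unfolding y nf_poly_eq by (simp add: field_simps power2_eq_square power3_eq_cube power4_eq_xxxx)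
  then have "(r - 1) * ((x2 - x1) * ((x2 - x1) * ((x2 - x1) * (x1 + x2)))) = 0"
    unfolding u by (simp add: field_simps power2_eq_square power4_eq_xxxx)
  then show x: "x2 = - x1" using d r by simp
  show "y1 = r * x1\<^sup>2" unfolding y u x by (simp add: power2_eq_square algebra_simps)
  show "y2 = y1" unfolding y x by simp
qed

section \<open>Parabolas and their Legendrian lifts\<close>

lemma has_vector_derivative_parabola:
  "((\<lambda>t. (u + t, c * (u + t)\<^sup>2)) has_vector_derivative (1, 2 * c * (u + t))) (at (t::real))"
proof -
  have "((\<lambda>t. u + t) has_real_derivative 1) (at t)" "((\<lambda>t. c * (u + t)\<^sup>2) has_real_derivative 2 * c * (u + t)) (at t)"
    by (auto intro!: derivative_eq_intros)
  then show ?thesis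
    unfolding has_real_derivative_iff_has_vector_derivative by (rule has_vector_derivative_Pair)
qed

text \<open>Needed at every point near the vertex, because the Legendrian lift collects tangents at
  all points. The inverse of the parametrisation is the shifted abscissa.\<close>

lemma curve_tangent_parabola:
  fixes c u \<delta> :: real
  assumes C: "\<And>x y. \<bar>x\<bar> < \<delta> \<Longrightarrow> \<bar>y\<bar> < \<delta> \<Longrightarrow> (x, y) \<in> C \<longleftrightarrow> y = c * x\<^sup>2"
    and u: "\<bar>u\<bar> < \<delta>" "\<bar>c * u\<^sup>2\<bar> < \<delta>"
  shows "curve_tangent C (u, c * u\<^sup>2) (1, 2 * c * u)"
proof -
  define \<gamma> where "\<gamma> t = (u + t, c * (u + t)\<^sup>2)" for t
  have "((\<lambda>t. \<bar>u + t\<bar>) \<longlongrightarrow> \<bar>u + 0\<bar>) (nhds 0)" "((\<lambda>t. \<bar>c * (u + t)\<^sup>2\<bar>) \<longlongrightarrow> \<bar>c * (u + 0)\<^sup>2\<bar>) (nhds 0)"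
    by (intro tendsto_intros filterlim_ident)+
  then have "\<forall>\<^sub>F t in nhds 0. \<bar>u + t\<bar> < \<delta>" "\<forall>\<^sub>F t in nhds 0. \<bar>c * (u + t)\<^sup>2\<bar> < \<delta>"
    using order_tendstoD(2)[where a = \<delta>] u by auto
  then have "\<forall>\<^sub>F t in nhds 0. \<bar>u + t\<bar> < \<delta> \<and> \<bar>c * (u + t)\<^sup>2\<bar> < \<delta>" by (rule eventually_conj)
  then obtain e where e: "0 < e" "\<And>t. \<bar>t\<bar> < e \<Longrightarrow> \<bar>u + t\<bar> < \<delta> \<and> \<bar>c * (u + t)\<^sup>2\<bar> < \<delta>"
    unfolding eventually_nhds_metric by (auto simp: dist_real_def)
  define W where "W = {u - e<..<u + e} \<times> {-\<delta><..<\<delta>}"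
  have mem: "p \<in> C \<inter> W \<longleftrightarrow> (\<exists>t\<in>{-e<..<e}. p = \<gamma> t)" for p
  proof
    assume p: "p \<in> C \<inter> W"
    obtain x y where xy: "p = (x, y)" by (metis prod.exhaust)
    have t: "\<bar>x - u\<bar> < e" "\<bar>y\<bar> < \<delta>" using p by (auto simp: W_def xy)
    then have "y = c * x\<^sup>2" using C[of x y] e(2)[of "x - u"] p by (simp add: xy)
    then show "\<exists>t\<in>{-e<..<e}. p = \<gamma> t" using t by (intro bexI[of _ "x - u"]) (auto simp: \<gamma>_def xy)
  next
    assume "\<exists>t\<in>{-e<..<e}. p = \<gamma> t"
    then obtain t where "t \<in> {-e<..<e}" and p: "p = \<gamma> t" by blast
    then have t: "\<bar>t\<bar> < e" by (auto simp: abs_less_iff)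
    then show "p \<in> C \<inter> W" using C e(2)[OF t] t p by (auto simp: \<gamma>_def W_def abs_less_iff)
  qed
  have vd: "vector_derivative \<gamma> (at t) = (1, 2 * c * (u + t))" for t
    unfolding \<gamma>_def[abs_def] by (rule vector_derivative_at[OF has_vector_derivative_parabola])
  show ?thesis
    unfolding curve_tangent_def
  proof (intro exI conjI)
    show "0 < e" by fact
    show "open W" by (auto simp: W_def intro: open_Times)
    show "smooth_on {-e<..<e} \<gamma>" unfolding \<gamma>_def[abs_def] by (intro smooth_on_intros) auto
    show "\<forall>t\<in>{-e<..<e}. vector_derivative \<gamma> (at t) \<noteq> 0" unfolding vd by (simp add: zero_prod_def)
    show "\<gamma> 0 = (u, c * u\<^sup>2)" by (simp add: \<gamma>_def)
    show "vector_derivative \<gamma> (at 0) = (1, 2 * c * u)" unfolding vd by simp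
    show "homeomorphism {-e<..<e} (C \<inter> W) \<gamma> (\<lambda>p. fst p - u)"
    proof (rule homeomorphismI)
      show "continuous_on {-e<..<e} \<gamma>" unfolding \<gamma>_def[abs_def] by (intro continuous_intros)
      show "continuous_on (C \<inter> W) (\<lambda>p. fst p - u)" by (intro continuous_intros)
      show "\<gamma> ` {-e<..<e} \<subseteq> C \<inter> W" using mem by blast
      show "(\<lambda>p. fst p - u) ` (C \<inter> W) \<subseteq> {-e<..<e}" by (auto simp: W_def)
      show "fst (\<gamma> t) - u = t" if "t \<in> {-e<..<e}" for t by (simp add: \<gamma>_def)
      show "\<gamma> (fst p - u) = p" if "p \<in> C \<inter> W" for p using that unfolding mem by (auto simp: \<gamma>_def)
    qed
  qed
qed

text \<open>Over the box the lift is exactly the curve (t, c t^2, 2 c t). That no other slopes occur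
  follows by differentiating y - c x^2 along an arbitrary curve contained in C.\<close>

lemma legendrian_lift_parabola:
  fixes c \<delta> :: real
  assumes "0 < \<delta>" and C: "\<And>x y. \<bar>x\<bar> < \<delta> \<Longrightarrow> \<bar>y\<bar> < \<delta> \<Longrightarrow> (x, y) \<in> C \<longleftrightarrow> y = c * x\<^sup>2"
  shows "curve_tangent (legendrian_lift C) (0, 0, 0) (1, 0, 2 * c)"
proof -
  have lift: "(x, y, m) \<in> legendrian_lift C \<longleftrightarrow> y = c * x\<^sup>2 \<and> m = 2 * c * x" if xy: "\<bar>x\<bar> < \<delta>" "\<bar>y\<bar> < \<delta>" for x y m
  proof
    assume "y = c * x\<^sup>2 \<and> m = 2 * c * x"
    then show "(x, y, m) \<in> legendrian_lift C"
      using curve_tangent_parabola[of \<delta> C c x, OF C] xy by (simp add: legendrian_lift_def)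
  next
    assume "(x, y, m) \<in> legendrian_lift C"
    then have "curve_tangent C (x, y) (1, m)" by (simp add: legendrian_lift_def)
    then obtain k where k: "k 0 = (x, y)" "(k has_vector_derivative (1, m)) (at (0::real))" "\<forall>\<^sub>F s in nhds 0. k s \<in> C"
      using curve_tangentE by blast
    have "(k \<longlongrightarrow> (x, y)) (nhds 0)"
      using has_vector_derivative_continuous[OF k(2), unfolded continuous_at tendsto_at_iff_tendsto_nhds] k(1) by simp
    then have "\<forall>\<^sub>F s in nhds 0. k s \<in> {-\<delta><..<\<delta>} \<times> {-\<delta><..<\<delta>}"
      by (rule topological_tendstoD) (use xy in \<open>auto intro: open_Times\<close>)
    with k(3) have ev: "\<forall>\<^sub>F s in nhds 0. snd (k s) - c * (fst (k s))\<^sup>2 = 0"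
      by eventually_elim (use C in \<open>auto simp: abs_less_iff\<close>)
    have y: "y = c * x\<^sup>2" using eventually_nhds_x_imp_x[OF ev] k(1) by simp
    have "((\<lambda>s. fst (k s)) has_real_derivative 1) (at 0)" "((\<lambda>s. snd (k s)) has_real_derivative m) (at 0)"
      using bounded_linear.has_vector_derivative[OF bounded_linear_fst k(2)]
        bounded_linear.has_vector_derivative[OF bounded_linear_snd k(2)]
      by (simp_all add: has_real_derivative_iff_has_vector_derivative)
    then have "((\<lambda>s. snd (k s) - c * (fst (k s))\<^sup>2) has_real_derivative m - c * (2 * fst (k 0) * 1)) (at 0)"
      by (auto intro!: derivative_eq_intros)
    then have "m - c * (2 * fst (k 0) * 1) = 0" by (rule DERIV_eventually_zero[OF _ ev])
    then show "y = c * x\<^sup>2 \<and> m = 2 * c * x" using y k(1) by simp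
  qed
  define \<gamma> where "\<gamma> t = (t, c * t\<^sup>2, 2 * c * t)" for t :: real
  have "((\<lambda>t. \<bar>c * t\<^sup>2\<bar>) \<longlongrightarrow> \<bar>c * 0\<^sup>2\<bar>) (nhds 0)" by (intro tendsto_intros filterlim_ident)
  then have "\<forall>\<^sub>F t in nhds 0. \<bar>c * t\<^sup>2\<bar> < \<delta>" using order_tendstoD(2)[where a = \<delta>] assms(1) by simp
  then obtain e0 where e0: "0 < e0" "\<And>t. \<bar>t\<bar> < e0 \<Longrightarrow> \<bar>c * t\<^sup>2\<bar> < \<delta>"
    unfolding eventually_nhds_metric by (auto simp: dist_real_def)
  define e where "e = min e0 \<delta>"
  have e: "0 < e" "\<And>t. \<bar>t\<bar> < e \<Longrightarrow> \<bar>t\<bar> < \<delta> \<and> \<bar>c * t\<^sup>2\<bar> < \<delta>" using e0 assms(1) by (auto simp: e_def)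
  define W where "W = {-e<..<e} \<times> {-\<delta><..<\<delta>} \<times> (UNIV :: real set)"
  have mem: "p \<in> legendrian_lift C \<inter> W \<longleftrightarrow> (\<exists>t\<in>{-e<..<e}. p = \<gamma> t)" for p
  proof
    assume p: "p \<in> legendrian_lift C \<inter> W"
    obtain x y m where xy: "p = (x, y, m)" by (metis prod.exhaust)
    have "\<bar>x\<bar> < e" "\<bar>y\<bar> < \<delta>" using p by (auto simp: W_def xy)
    then show "\<exists>t\<in>{-e<..<e}. p = \<gamma> t"
      using lift[of x y m] e(2)[of x] p by (intro bexI[of _ x]) (auto simp: \<gamma>_def xy abs_less_iff)
  next
    assume "\<exists>t\<in>{-e<..<e}. p = \<gamma> t"
    then obtain t where "t \<in> {-e<..<e}" and p: "p = \<gamma> t" by blast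
    then have t: "\<bar>t\<bar> < e" by (auto simp: abs_less_iff)
    then show "p \<in> legendrian_lift C \<inter> W" using lift e(2)[OF t] t p by (auto simp: \<gamma>_def W_def abs_less_iff)
  qed
  have hv: "(\<gamma> has_vector_derivative (1, 2 * c * t, 2 * c)) (at t)" for t
  proof -
    have "((\<lambda>t. t) has_real_derivative 1) (at t)" "((\<lambda>t. c * t\<^sup>2) has_real_derivative 2 * c * t) (at t)"
      "((\<lambda>t. 2 * c * t) has_real_derivative 2 * c) (at t)"
      by (auto intro!: derivative_eq_intros)
    then show ?thesis
      unfolding \<gamma>_def[abs_def] has_real_derivative_iff_has_vector_derivative
      by (intro has_vector_derivative_Pair)
  qed
  show ?thesis
    unfolding curve_tangent_def
  proof (intro exI conjI)
    show "0 < e" by fact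
    show "open W" by (auto simp: W_def intro!: open_Times)
    show "smooth_on {-e<..<e} \<gamma>" unfolding \<gamma>_def[abs_def] by (intro smooth_on_intros) auto
    show "\<forall>t\<in>{-e<..<e}. vector_derivative \<gamma> (at t) \<noteq> 0"
      unfolding vector_derivative_at[OF hv] by (simp add: zero_prod_def)
    show "\<gamma> 0 = (0, 0, 0)" by (simp add: \<gamma>_def)
    show "vector_derivative \<gamma> (at 0) = (1, 0, 2 * c)" unfolding vector_derivative_at[OF hv] by simp
    show "homeomorphism {-e<..<e} (legendrian_lift C \<inter> W) \<gamma> fst"
    proof (rule homeomorphismI)
      show "continuous_on {-e<..<e} \<gamma>" unfolding \<gamma>_def[abs_def] by (intro continuous_intros)
      show "continuous_on (legendrian_lift C \<inter> W) fst" by (intro continuous_intros)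
      show "\<gamma> ` {-e<..<e} \<subseteq> legendrian_lift C \<inter> W" using mem by blast
      show "fst ` (legendrian_lift C \<inter> W) \<subseteq> {-e<..<e}" by (auto simp: W_def)
      show "fst (\<gamma> t) = t" if "t \<in> {-e<..<e}" for t by (simp add: \<gamma>_def)
      show "\<gamma> (fst p) = p" if "p \<in> legendrian_lift C \<inter> W" for p using that unfolding mem by (auto simp: \<gamma>_def)
    qed
  qed
qed

lemma fibre_curve_tangent: "curve_tangent (fibre (0, 0)) (0, 0, 0) (0, 0, 1)"
  unfolding curve_tangent_def
proof (intro exI conjI)
  let ?W = "UNIV \<times> UNIV \<times> {-1<..<1} :: (real \<times> real \<times> real) set"
  let ?\<gamma> = "\<lambda>t. (0, 0, t) :: real \<times> real \<times> real"
  have hv: "(?\<gamma> has_vector_derivative (0, 0, 1)) (at t)" for t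
    by (intro has_vector_derivative_Pair has_vector_derivative_const has_vector_derivative_id)
  show "(0::real) < 1" by simp
  show "open ?W" by (intro open_Times) auto
  show "smooth_on {-1<..<1} ?\<gamma>" by (intro smooth_on_intros) auto
  show "\<forall>t\<in>{-1<..<1}. vector_derivative ?\<gamma> (at t) \<noteq> 0"
    unfolding vector_derivative_at[OF hv] by (simp add: zero_prod_def)
  show "?\<gamma> 0 = (0, 0, 0)" by simp
  show "vector_derivative ?\<gamma> (at 0) = (0, 0, 1)" by (rule vector_derivative_at[OF hv])
  show "homeomorphism {-1<..<1} (fibre (0, 0) \<inter> ?W) ?\<gamma> (\<lambda>p. snd (snd p))"
    by (rule homeomorphismI) (auto simp: fibre_def intro!: continuous_intros)
qed

section \<open>Parametrisations of the graph\<close>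

lemma affine_pt_homeomorphism:
  assumes "invertible B"
  obtains A where "homeomorphism UNIV (range (affine_pt B)) (affine_pt B) A"
proof (rule homeomorphism_injective_open_map[of UNIV "affine_pt B" "range (affine_pt B)"])
  show "continuous_on UNIV (affine_pt B)" by (rule continuous_on_affine_pt[OF assms])
  show "inj_on (affine_pt B) UNIV" by (simp add: inj_on_def affine_pt_eq_iff[OF assms])
  show "openin (top_of_set (range (affine_pt B))) (affine_pt B ` U)" if "openin (top_of_set UNIV) U" for U
    using that open_affine_pt_image[OF assms] by (intro open_openin_trans) auto
qed (use that in auto)

text \<open>General coordinates X, Y are allowed because two parametrisations are needed: by (x, y)
  for the curves, and one adapted to the swallowtail.\<close>

lemma graph_surface_param:
  fixes X Y :: "real \<times> real \<Rightarrow> real"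
  assumes sm: "smooth_on UNIV X" "smooth_on UNIV Y"
    and hom: "homeomorphism UNIV UNIV (\<lambda>q. (X q, Y q)) \<psi>" and base: "X (0, 0) = 0" "Y (0, 0) = 0"
    and jac: "\<And>q. dir_deriv [(1, 0)] X q * dir_deriv [(0, 1)] Y q - dir_deriv [(0, 1)] X q * dir_deriv [(1, 0)] Y q \<noteq> 0"
  shows "surface_param (graph_surface r) (affine_pt (mat 1) (0, 0, 0)) UNIV
    (\<lambda>q. hom (mat 1) (X q) (Y q) (nf_poly r (X q, Y q)) 1)"
  unfolding surface_param_def
proof (intro conjI ballI)
  define Z where "Z q = nf_poly r (X q, Y q)" for q
  let ?\<sigma> = "\<lambda>q. hom (mat 1) (X q) (Y q) (nf_poly r (X q, Y q)) 1"
  have smZ: "smooth_on UNIV Z"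
    unfolding Z_def[abs_def] nf_poly_eq by (intro smooth_on_intros sm open_UNIV)
  show "smooth_on UNIV ?\<sigma>"
    using smooth_on_hom[OF open_UNIV sm smZ smooth_on_constant[OF open_UNIV, of 1]] by (simp add: Z_def)
  show "proj (?\<sigma> (0, 0)) = affine_pt (mat 1) (0, 0, 0)"
    by (simp add: base affine_pt_hom nf_poly_eq)
  show "dim {?\<sigma> q, frechet_derivative ?\<sigma> (at q) (1, 0), frechet_derivative ?\<sigma> (at q) (0, 1)} = 3" for q
  proof -
    have fd: "(k has_derivative (\<lambda>v. dir_deriv [v] k q)) (at q)" if "smooth_on UNIV k" for k :: "real \<times> real \<Rightarrow> real"
      using smooth_on_has_derivative[OF that open_UNIV UNIV_I, where vs = "[]"] by simp
    have "((\<lambda>q. hom (mat 1) (X q) (Y q) (Z q) 1) has_derivative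
        (\<lambda>v. hom (mat 1) (dir_deriv [v] X q) (dir_deriv [v] Y q) (dir_deriv [v] Z q) 0)) (at q)"
      by (intro has_derivative_hom fd sm smZ has_derivative_const)
    from frechet_derivative_at[OF this, symmetric]
    have D: "frechet_derivative ?\<sigma> (at q) v = hom (mat 1) (dir_deriv [v] X q) (dir_deriv [v] Y q) (dir_deriv [v] Z q) 0" for v
      by (simp add: Z_def)
    define a1 b1 c1 a2 b2 c2 where d: "a1 = dir_deriv [(1, 0)] X q" "b1 = dir_deriv [(1, 0)] Y q" "c1 = dir_deriv [(1, 0)] Z q"
      "a2 = dir_deriv [(0, 1)] X q" "b2 = dir_deriv [(0, 1)] Y q" "c2 = dir_deriv [(0, 1)] Z q"
    have j: "a1 * b2 - a2 * b1 \<noteq> 0" using jac[of q] unfolding d .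
    let ?u1 = "hom (mat 1) a1 b1 c1 0" and ?u2 = "hom (mat 1) a2 b2 c2 0" and ?u3 = "?\<sigma> q"
    have "?u2 \<noteq> 0" using j by (auto simp: hom_eq_0_iff[OF invertible_mat_1])
    moreover have u1: "?u1 \<notin> span {?u2}"
    proof
      assume "?u1 \<in> span {?u2}"
      then obtain k where "?u1 = k *\<^sub>R ?u2" by (auto simp: span_singleton)
      then have "a1 = k * a2" "b1 = k * b2" by (simp_all add: hom_scale hom_eq_iff[OF invertible_mat_1])
      then show False using j by simp
    qed
    moreover have u3: "?u3 \<notin> span {?u1, ?u2}"
    proof
      assume "?u3 \<in> span {?u1, ?u2}"
      then obtain k l where "?u3 = k *\<^sub>R ?u1 + l *\<^sub>R ?u2"
        unfolding span_breakdown_eq by (auto simp: span_singleton algebra_simps)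
      then show False by (simp add: hom_scale hom_add hom_eq_iff[OF invertible_mat_1])
    qed
    ultimately have "independent {?u3, ?u1, ?u2}" by (simp add: independent_insert)
    moreover have "?u1 \<noteq> ?u2" "?u3 \<noteq> ?u1" "?u3 \<noteq> ?u2" using u1 u3 by (auto intro: span_base)
    ultimately have "dim {?u3, ?u1, ?u2} = 3" by (simp add: dim_eq_card_independent)
    then show ?thesis unfolding D d .
  qed
  obtain A where A: "homeomorphism UNIV (range (affine_pt (mat 1))) (affine_pt (mat 1)) A"
    using affine_pt_homeomorphism[OF invertible_mat_1] .
  have pr: "proj (?\<sigma> q) = affine_pt (mat 1) (X q, Y q, nf_poly r (X q, Y q))" for q by (simp add: affine_pt_hom)
  have sub: "graph_surface r \<subseteq> range (affine_pt (mat 1))" by (auto simp: graph_surface_def)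
  have inv1: "A (affine_pt (mat 1) p) = p" for p using homeomorphism_apply1[OF A] by blast
  have "homeomorphism UNIV (graph_surface r \<inter> UNIV) (\<lambda>q. proj (?\<sigma> q)) (\<lambda>p. \<psi> (fst (A p), fst (snd (A p))))"
  proof (rule homeomorphismI)
    have c: "continuous_on UNIV X" "continuous_on UNIV Y"
      using smooth_on_continuous[OF sm(1) open_UNIV UNIV_I, where vs = "[]"] smooth_on_continuous[OF sm(2) open_UNIV UNIV_I, where vs = "[]"]
      by (auto simp: continuous_at_imp_continuous_on)
    have "continuous_on UNIV (\<lambda>q. (X q, Y q, nf_poly r (X q, Y q)))"
      unfolding nf_poly_eq by (intro continuous_intros c) auto
    then show "continuous_on UNIV (\<lambda>q. proj (?\<sigma> q))"
      unfolding pr by (rule continuous_on_compose2[OF continuous_on_affine_pt[OF invertible_mat_1, of UNIV]]) simp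
    have "continuous_on (graph_surface r \<inter> UNIV) A"
      using homeomorphism_cont2[OF A] sub by (auto intro: continuous_on_subset)
    then have "continuous_on (graph_surface r \<inter> UNIV) (\<lambda>p. (fst (A p), fst (snd (A p))))"
      by (intro continuous_intros)
    then show "continuous_on (graph_surface r \<inter> UNIV) (\<lambda>p. \<psi> (fst (A p), fst (snd (A p))))"
      by (rule continuous_on_compose2[OF homeomorphism_cont2[OF hom]]) simp
    show "(\<lambda>q. proj (?\<sigma> q)) ` UNIV \<subseteq> graph_surface r \<inter> UNIV"
      unfolding pr by (auto simp: in_graph_surface)
    show "\<psi> (fst (A (proj (?\<sigma> q))), fst (snd (A (proj (?\<sigma> q))))) = q" for q
      unfolding pr inv1 using homeomorphism_apply1[OF hom, of q] by simp
    show "proj (?\<sigma> (\<psi> (fst (A p), fst (snd (A p))))) = p" if pS: "p \<in> graph_surface r \<inter> UNIV" for p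
    proof -
      obtain x y where p: "p = affine_pt (mat 1) (x, y, nf_poly r (x, y))" using pS by (auto simp: graph_surface_def)
      have "X (\<psi> (x, y)) = x \<and> Y (\<psi> (x, y)) = y" using homeomorphism_apply2[OF hom, of "(x, y)"] by simp
      then show ?thesis unfolding pr p inv1 by simp
    qed
  qed auto
  then show "\<exists>W \<tau>. open W \<and> homeomorphism UNIV (graph_surface r \<inter> W) (\<lambda>q. proj (?\<sigma> q)) \<tau>" by blast
qed auto

lemma dir_deriv_fst_snd:
  fixes q :: "real \<times> real"
  shows "dir_deriv [v] fst q = fst v" "dir_deriv [v] snd q = snd v"
  using frechet_derivative_at[OF bounded_linear_imp_has_derivative[OF bounded_linear_fst], of q, symmetric]
    frechet_derivative_at[OF bounded_linear_imp_has_derivative[OF bounded_linear_snd], of q, symmetric]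
  by simp_all

definition graph_param :: "real \<Rightarrow> real \<times> real \<Rightarrow> real^4" where
  "graph_param r q = hom (mat 1) (fst q) (snd q) (nf_poly r q) 1"

lemma surface_param_graph_param: "surface_param (graph_surface r) (affine_pt (mat 1) (0, 0, 0)) UNIV (graph_param r)"
proof -
  have "homeomorphism UNIV UNIV (\<lambda>q::real \<times> real. (fst q, snd q)) (\<lambda>q. q)"
    by (rule homeomorphismI) auto
  from graph_surface_param[OF smooth_on_fst[OF open_UNIV] smooth_on_snd[OF open_UNIV] this]
  show ?thesis by (simp add: dir_deriv_fst_snd graph_param_def[abs_def] del: dir_deriv.simps)
qed

lemma pull_graph_param: "pull UNIV (graph_param r) C = {(x, y). affine_pt (mat 1) (x, y, nf_poly r (x, y)) \<in> C}"
  by (auto simp: pull_def graph_param_def affine_pt_hom)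

section \<open>The three curves on the polynomial graph\<close>

context
  fixes r :: real
begin

interpretation normal_chart "graph_surface r" "mat 1" r "\<lambda>_. 0" UNIV UNIV
  by (rule graph_chart_example)

lemma graph_point: "has_local_equation (graph_surface r) (affine_pt (mat 1) (x, y, nf_poly r (x, y)))"
  by (intro smooth_surface_local_equation[OF graph_surface_smooth]) (simp add: in_graph_surface)

text \<open>Without a remainder the discriminant is exactly 8 (y - (3 r - 2) x^2).\<close>

lemma graph_curvature:
  shows graph_parabolic: "affine_pt (mat 1) (x, y, nf_poly r (x, y)) \<in> parabolic_curve (graph_surface r) \<longleftrightarrow> y = (3 * r - 2) * x\<^sup>2"
    and graph_hyperbolic: "affine_pt (mat 1) (x, y, nf_poly r (x, y)) \<in> hyperbolic_domain (graph_surface r) \<longleftrightarrow> (3 * r - 2) * x\<^sup>2 < y"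
proof -
  have n: "dir_deriv [(0, 1), (0, 1)] nf (x, y) \<noteq> 0" by (simp only: normal_form_fun_zero nf_poly_deriv2)
  have h: "(dir_deriv [(1, 0), (0, 1)] nf (x, y) + dir_deriv [(0, 1), (1, 0)] nf (x, y))\<^sup>2
    - 4 * dir_deriv [(1, 0), (1, 0)] nf (x, y) * dir_deriv [(0, 1), (0, 1)] nf (x, y) = 8 * (y - (3 * r - 2) * x\<^sup>2)"
    unfolding normal_form_fun_zero nf_poly_deriv2 by (simp add: power2_eq_square algebra_simps)
  note c = asymptotic_count[of x y, OF UNIV_I _ n, unfolded h, unfolded normal_form_fun_zero, OF graph_point]
  show "affine_pt (mat 1) (x, y, nf_poly r (x, y)) \<in> parabolic_curve (graph_surface r) \<longleftrightarrow> y = (3 * r - 2) * x\<^sup>2"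
    "affine_pt (mat 1) (x, y, nf_poly r (x, y)) \<in> hyperbolic_domain (graph_surface r) \<longleftrightarrow> (3 * r - 2) * x\<^sup>2 < y"
    using c by auto
qed

text \<open>Raising y at fixed x moves into the hyperbolic domain. This supplies the closure
  condition in the definition of the flecnodal curve.\<close>

lemma graph_closure_hyperbolic:
  assumes "(3 * r - 2) * x\<^sup>2 \<le> y"
  shows "affine_pt (mat 1) (x, y, nf_poly r (x, y)) \<in> closure (hyperbolic_domain (graph_surface r))"
proof (rule ccontr)
  let ?H = "hyperbolic_domain (graph_surface r)"
  assume "affine_pt (mat 1) (x, y, nf_poly r (x, y)) \<notin> closure ?H"
  moreover have "open (affine_pt (mat 1) -` (- closure ?H))"
    by (intro open_affine_pt_vimage invertible_mat_1 open_Compl closed_closure)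
  moreover have "((\<lambda>s. (x, y + s, nf_poly r (x, y + s))) \<longlongrightarrow> (x, y + 0, nf_poly r (x, y + 0))) (at_right 0)"
    unfolding nf_poly_eq by (intro tendsto_intros) auto
  ultimately have "\<forall>\<^sub>F s in at_right 0. (x, y + s, nf_poly r (x, y + s)) \<in> affine_pt (mat 1) -` (- closure ?H)"
    by (intro topological_tendstoD[where S = "affine_pt (mat 1) -` (- closure ?H)"]) auto
  moreover have "\<forall>\<^sub>F s in at_right (0::real). 0 < s" by (rule eventually_at_right_less)
  ultimately have "\<forall>\<^sub>F s in at_right (0::real). False"
  proof eventually_elim
    case (elim s)
    have "affine_pt (mat 1) (x, y + s, nf_poly r (x, y + s)) \<in> ?H" using assms elim by (simp add: graph_hyperbolic)
    then show False using elim closure_subset by blast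
  qed
  then show False by simp
qed

text \<open>The third derivative forces m = 2 r x, and the second then gives y. The curve lies in
  the closed hyperbolic domain because (2 r^2 - r) - (3 r - 2) = 2 (r - 1)^2.\<close>

lemma graph_flecnodal:
  "affine_pt (mat 1) (x, y, nf_poly r (x, y)) \<in> flecnodal_curve (graph_surface r) \<longleftrightarrow> y = (2 * r\<^sup>2 - r) * x\<^sup>2"
proof -
  have n: "dir_deriv [(0, 1), (0, 1)] nf (x, y) \<noteq> 0" by (simp only: normal_form_fun_zero nf_poly_deriv2)
  have set: "{2..<4::nat} = {2, 3}" by auto
  have d: "dir_deriv (replicate 2 (1, m)) (nf_poly r) (x, y) = m\<^sup>2 - 4 * x * m - 2 * y + 6 * r * x\<^sup>2"
    "dir_deriv (replicate 3 (1, m)) (nf_poly r) (x, y) = 12 * r * x - 6 * m" for m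
    unfolding numeral_2_eq_2 numeral_3_eq_3 replicate.simps nf_poly_deriv2 nf_poly_deriv3
    by (simp_all add: power2_eq_square algebra_simps)
  have "(\<exists>L. has_contact 4 (graph_surface r) (affine_pt (mat 1) (x, y, nf_poly r (x, y))) L) \<longleftrightarrow>
      (\<exists>m. m\<^sup>2 - 4 * x * m - 2 * y + 6 * r * x\<^sup>2 = 0 \<and> 12 * r * x - 6 * m = 0)"
    using has_contact_slope_iff[of x y 4, OF UNIV_I _ _ n, unfolded normal_form_fun_zero, OF graph_point]
    unfolding set by (auto simp: d)
  also have "\<dots> \<longleftrightarrow> y = (2 * r\<^sup>2 - r) * x\<^sup>2"
  proof -
    have "12 * r * x - 6 * m = 0 \<longleftrightarrow> m = 2 * r * x" for m by auto
    moreover have "(2 * r * x)\<^sup>2 - 4 * x * (2 * r * x) - 2 * y + 6 * r * x\<^sup>2 = 2 * ((2 * r\<^sup>2 - r) * x\<^sup>2 - y)"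
      by (simp add: power2_eq_square algebra_simps)
    ultimately show ?thesis by auto
  qed
  finally have *: "(\<exists>L. has_contact 4 (graph_surface r) (affine_pt (mat 1) (x, y, nf_poly r (x, y))) L) \<longleftrightarrow> y = (2 * r\<^sup>2 - r) * x\<^sup>2" .
  have "(3 * r - 2) * x\<^sup>2 \<le> (2 * r\<^sup>2 - r) * x\<^sup>2"
  proof (rule mult_right_mono)
    have "(2 * r\<^sup>2 - r) - (3 * r - 2) = 2 * (r - 1)\<^sup>2" by (simp add: power2_eq_square algebra_simps)
    moreover have "0 \<le> (r - 1)\<^sup>2" by simp
    ultimately show "3 * r - 2 \<le> 2 * r\<^sup>2 - r" by linarith
  qed simp
  then show ?thesis
    using graph_closure_hyperbolic[of x y] * by (auto simp: flecnodal_curve_def in_graph_surface)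
qed

lemma graph_godron: "godron (graph_surface r) (affine_pt (mat 1) (0, 0, 0))"
proof -
  have z: "nf_poly r (0, 0) = 0" by (simp add: nf_poly_eq)
  have par: "affine_pt (mat 1) (0, 0, 0) \<in> parabolic_curve (graph_surface r)"
    using graph_parabolic[of 0 0] z by simp
  have ct: "curve_tangent (pull UNIV (graph_param r) (parabolic_curve (graph_surface r))) (0, 0) (1, 0)"
    using curve_tangent_parabola[of 1 _ "3 * r - 2" 0] unfolding pull_graph_param by (simp add: graph_parabolic)
  have n: "dir_deriv [(0, 1), (0, 1)] nf (0, 0) \<noteq> 0" by (simp only: normal_form_fun_zero nf_poly_deriv2)
  have "tangent_line (0, 0) 0 \<in> asymptotic_lines (graph_surface r) (affine_pt (mat 1) (0, 0, nf (0, 0)))"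
    using asymptotic_lines_iff[of 0 0, OF UNIV_I _ n] graph_point[of 0 0]
    unfolding normal_form_fun_zero nf_poly_deriv2 by auto
  moreover have "tangent_line (0, 0) 0 = span {graph_param r (0, 0), frechet_derivative (graph_param r) (at (0, 0)) (1, 0)}"
  proof -
    have "((\<lambda>q. hom (mat 1) (fst q) (snd q) (nf_poly r q) 1) has_derivative
        (\<lambda>v. hom (mat 1) (fst v) (snd v) (dir_deriv [v] (nf_poly r) (0, 0)) 0)) (at (0, 0))"
      using smooth_on_has_derivative[OF nf_poly_smooth[OF open_UNIV] open_UNIV UNIV_I, where vs = "[]"]
      by (intro has_derivative_hom bounded_linear_imp_has_derivative bounded_linear_fst bounded_linear_snd has_derivative_const) simp
    from frechet_derivative_at[OF this, symmetric]
    show ?thesis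
      unfolding tangent_line_def unfolding normal_form_fun_zero by (simp add: graph_param_def[abs_def])
  qed
  ultimately have "span {graph_param r (0, 0), frechet_derivative (graph_param r) (at (0, 0)) (1, 0)} \<in>
      asymptotic_lines (graph_surface r) (affine_pt (mat 1) (0, 0, 0))"
    by (simp add: normal_form_fun_zero z)
  then show ?thesis unfolding godron_def using par surface_param_graph_param ct by blast
qed

text \<open>For small nonzero x the point (x, r x^2) has partner (-x, r x^2). At the origin the
  partners merge, so this point is obtained only through the closure; \<delta> ensures that both
  partners lie in W.\<close>

lemma graph_conodal:
  assumes r: "r \<noteq> 1" and W: "open W" "affine_pt (mat 1) (0, 0, 0) \<in> W"
  obtains \<delta> where "0 < \<delta>" "\<And>x y. \<bar>x\<bar> < \<delta> \<Longrightarrow> \<bar>y\<bar> < \<delta> \<Longrightarrow>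
    affine_pt (mat 1) (x, y, nf_poly r (x, y)) \<in> conodal_curve (graph_surface r \<inter> W) \<longleftrightarrow> y = r * x\<^sup>2"
proof -
  let ?S = "graph_surface r \<inter> W"
  define P where "P x y = affine_pt (mat 1) (x, y, nf_poly r (x, y))" for x y
  define T where "T = {p \<in> ?S. \<exists>q\<in>?S. q \<noteq> p \<and> tangential_map ?S q = tangential_map ?S p}"
  have PS: "P x y \<in> graph_surface r" for x y by (simp add: P_def in_graph_surface)
  have tm: "tangential_map ?S (P x y) = proj (vector [- (- 2 * x * y + 2 * r * x ^ 3), - (y - x\<^sup>2), 1,
      - (nf_poly r (x, y) - x * (- 2 * x * y + 2 * r * x ^ 3) - y * (y - x\<^sup>2))])" if "P x y \<in> W" for x y
    unfolding P_def by (rule tangential_map_graph[OF W]) (use that in \<open>simp add: P_def\<close>)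
  have T_sub: "y = r * x\<^sup>2" if T: "P x y \<in> T" for x y
  proof -
    obtain q where q: "q \<in> ?S" "q \<noteq> P x y" "tangential_map ?S q = tangential_map ?S (P x y)" using T by (auto simp: T_def)
    then obtain x' y' where q': "q = P x' y'" by (auto simp: graph_surface_def P_def)
    have ne: "(x, y) \<noteq> (x', y')" using q(2) q' by auto
    let ?v = "\<lambda>x y. vector [- (- 2 * x * y + 2 * r * x ^ 3), - (y - x\<^sup>2), 1,
      - (nf_poly r (x, y) - x * (- 2 * x * y + 2 * r * x ^ 3) - y * (y - x\<^sup>2))] :: real^4"
    have nz: "?v a b \<noteq> 0" for a b by (auto simp: vec_eq_iff forall_4 vector_4)
    have "proj (?v x y) = proj (?v x' y')" using q T q' tm[of x y] tm[of x' y'] by (simp add: T_def)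
    then obtain c where c: "?v x y = c *\<^sub>R ?v x' y'" using proj_eq_iff[OF nz nz] by blast
    have c1: "c = 1" using arg_cong[OF c, of "\<lambda>w. w $ 3"] by (simp add: vector_4)
    have e1: "- 2 * x * y + 2 * r * x ^ 3 = - 2 * x' * y' + 2 * r * x' ^ 3"
      using arg_cong[OF c, of "\<lambda>w. w $ 1"] by (simp add: vector_4 c1)
    have e2: "y - x\<^sup>2 = y' - x'\<^sup>2" using arg_cong[OF c, of "\<lambda>w. w $ 2"] by (simp add: vector_4 c1)
    have e3: "nf_poly r (x, y) - x * (- 2 * x * y + 2 * r * x ^ 3) - y * (y - x\<^sup>2) =
      nf_poly r (x', y') - x' * (- 2 * x' * y' + 2 * r * x' ^ 3) - y' * (y' - x'\<^sup>2)"
      using arg_cong[OF c, of "\<lambda>w. w $ 4"] by (simp add: vector_4 c1)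
    show ?thesis by (rule bitangent_iff(2)[OF r ne e1 e2 e3])
  qed
  have T_sup: "P x (r * x\<^sup>2) \<in> T" if "x \<noteq> 0" "P x (r * x\<^sup>2) \<in> W" "P (- x) (r * x\<^sup>2) \<in> W" for x
  proof -
    have "tangential_map ?S (P x (r * x\<^sup>2)) = tangential_map ?S (P (- x) (r * x\<^sup>2))"
      unfolding tm[OF that(2)] tm[OF that(3)] by (simp add: nf_poly_eq power2_eq_square power3_eq_cube)
    moreover have "P (- x) (r * x\<^sup>2) \<noteq> P x (r * x\<^sup>2)"
      using that(1) by (simp add: P_def affine_pt_eq_iff[OF invertible_mat_1])
    ultimately show ?thesis using that PS unfolding T_def by auto
  qed
  have con: "conodal_curve ?S = ?S \<inter> closure T" by (simp add: conodal_curve_def T_def)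
  have only: "y = r * x\<^sup>2" if "P x y \<in> closure T" for x y
  proof (rule ccontr)
    assume "y \<noteq> r * x\<^sup>2"
    \<comment> \<open>The complement of the parabola is open, so the closure of the bitangent points
      adds nothing off it.\<close>
    define Q where "Q = {p :: real \<times> real \<times> real. fst (snd p) \<noteq> r * (fst p)\<^sup>2}"
    have "open Q" unfolding Q_def by (intro open_Collect_neq continuous_intros)
    then have oQ: "open (affine_pt (mat 1) ` Q)" by (rule open_affine_pt_image[OF invertible_mat_1])
    have "P x y \<in> affine_pt (mat 1) ` Q"
      unfolding P_def using \<open>y \<noteq> r * x\<^sup>2\<close> by (intro imageI) (simp add: Q_def)
    then have "affine_pt (mat 1) ` Q \<inter> closure T \<noteq> {}" using that by blast
    then obtain p where p: "p \<in> affine_pt (mat 1) ` Q" "p \<in> T"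
      unfolding open_Int_closure_eq_empty[OF oQ] by blast
    then obtain a b where "p = P a b" by (auto simp: T_def graph_surface_def P_def)
    then have "b \<noteq> r * a\<^sup>2" using p(1) by (auto simp: P_def Q_def affine_pt_eq_iff[OF invertible_mat_1])
    then show False using T_sub p(2) \<open>p = P a b\<close> by blast
  qed
  have "((\<lambda>x. (x, r * x\<^sup>2, nf_poly r (x, r * x\<^sup>2))) \<longlongrightarrow> (0, r * 0\<^sup>2, nf_poly r (0, r * 0\<^sup>2))) (nhds 0)"
    unfolding nf_poly_eq by (intro tendsto_intros filterlim_ident) auto
  moreover have "(0, r * 0\<^sup>2, nf_poly r (0, r * 0\<^sup>2)) \<in> affine_pt (mat 1) -` W"
    using W(2) by (simp add: nf_poly_eq)
  ultimately have "\<forall>\<^sub>F x in nhds 0. (x, r * x\<^sup>2, nf_poly r (x, r * x\<^sup>2)) \<in> affine_pt (mat 1) -` W"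
    using topological_tendstoD open_affine_pt_vimage[OF invertible_mat_1 W(1)] by blast
  then obtain \<delta> where \<delta>: "0 < \<delta>" "\<And>x. \<bar>x\<bar> < \<delta> \<Longrightarrow> P x (r * x\<^sup>2) \<in> W"
    unfolding eventually_nhds_metric by (auto simp: dist_real_def P_def)
  have nonzero: "P x (r * x\<^sup>2) \<in> T" if "\<bar>x\<bar> < \<delta>" "x \<noteq> 0" for x
    using T_sup[of x] \<delta>(2)[of x] \<delta>(2)[of "- x"] that by simp
  have "P 0 0 \<in> closure T"
  proof (rule ccontr)
    assume "P 0 0 \<notin> closure T"
    then have "(0, r * 0\<^sup>2, nf_poly r (0, r * 0\<^sup>2)) \<in> affine_pt (mat 1) -` (- closure T)" by (simp add: P_def)
    moreover have "open (affine_pt (mat 1) -` (- closure T))"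
      by (intro open_affine_pt_vimage invertible_mat_1 open_Compl closed_closure)
    moreover have "((\<lambda>x. (x, r * x\<^sup>2, nf_poly r (x, r * x\<^sup>2))) \<longlongrightarrow> (0, r * 0\<^sup>2, nf_poly r (0, r * 0\<^sup>2))) (at 0)"
      unfolding nf_poly_eq by (intro tendsto_intros) auto
    ultimately have "\<forall>\<^sub>F x in at 0. (x, r * x\<^sup>2, nf_poly r (x, r * x\<^sup>2)) \<in> affine_pt (mat 1) -` (- closure T)"
      using topological_tendstoD by blast
    moreover have "\<forall>\<^sub>F x::real in at 0. x \<noteq> 0" by (simp add: eventually_at_filter)
    moreover have "\<forall>\<^sub>F x in at 0. dist x 0 < \<delta>" by (rule tendstoD[OF tendsto_ident_at \<delta>(1)])
    ultimately have "\<forall>\<^sub>F x::real in at 0. False"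
    proof eventually_elim
      case (elim x)
      then have "P x (r * x\<^sup>2) \<in> T" using nonzero[of x] by (simp add: dist_real_def)
      then show False using elim closure_subset by (auto simp: P_def)
    qed
    then show False by simp
  qed
  then have all: "P x (r * x\<^sup>2) \<in> closure T" if "\<bar>x\<bar> < \<delta>" for x
    using nonzero[OF that] closure_subset by (cases "x = 0") auto
  show thesis
  proof (rule that[OF \<delta>(1)])
    fix x y assume "\<bar>x\<bar> < \<delta>" "\<bar>y\<bar> < \<delta>"
    then show "affine_pt (mat 1) (x, y, nf_poly r (x, y)) \<in> conodal_curve ?S \<longleftrightarrow> y = r * x\<^sup>2"
      using only[of x y] all[of x] \<delta>(2)[of x] PS[of x y] unfolding con P_def[symmetric] by auto
  qed
qed

end

section \<open>Invariants of the polynomial graph\<close>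

lemma has_2jet_parabola:
  assumes "0 < \<delta>" "\<And>x y. \<bar>x\<bar> < \<delta> \<Longrightarrow> \<bar>y\<bar> < \<delta> \<Longrightarrow> affine_pt B (x, y, f (x, y)) \<in> C \<longleftrightarrow> y = c * x\<^sup>2"
  shows "has_2jet B f C c"
  unfolding has_2jet_def
proof (intro exI conjI ballI)
  have d1: "deriv (\<lambda>x. c * x\<^sup>2) = (\<lambda>x. 2 * c * x)"
  proof
    show "deriv (\<lambda>x. c * x\<^sup>2) x = 2 * c * x" for x
      by (rule DERIV_imp_deriv) (auto intro!: derivative_eq_intros)
  qed
  have d2: "deriv (\<lambda>x. 2 * c * x) 0 = 2 * c"
    by (rule DERIV_imp_deriv) (auto intro!: derivative_eq_intros)
  show "0 < \<delta>" by fact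
  show "smooth_on {-\<delta><..<\<delta>} (\<lambda>x. c * x\<^sup>2)" by (intro smooth_on_intros) auto
  show "affine_pt B (x, y, f (x, y)) \<in> C \<longleftrightarrow> y = c * x\<^sup>2" if "x \<in> {-\<delta><..<\<delta>}" "y \<in> {-\<delta><..<\<delta>}" for x y
    using that assms(2)[of x y] by (auto simp: abs_less_iff)
  show "deriv (\<lambda>x. c * x\<^sup>2) 0 = 0" "deriv (deriv (\<lambda>x. c * x\<^sup>2)) 0 = 2 * c" unfolding d1 d2 by simp_all
qed simp

lemma graph_canonical_coefficients:
  assumes "r \<noteq> 1"
  shows "canonical_coefficients (graph_surface r) (affine_pt (mat 1) (0, 0, 0)) (2 * r\<^sup>2 - r) (3 * r - 2) r"
  unfolding canonical_coefficients_def
proof (intro exI conjI)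
  interpret normal_chart "graph_surface r" "mat 1" r "\<lambda>_. 0" UNIV UNIV by (rule graph_chart_example)
  show "normal_form (graph_surface r) (affine_pt (mat 1) (0, 0, 0)) (mat 1) r (\<lambda>_. 0)"
    unfolding normal_form_def
  proof (intro conjI allI impI)
    show "\<exists>U. open U \<and> (0, 0) \<in> U \<and> smooth_on U (\<lambda>_::real \<times> real. 0::real)"
      using smooth_on_constant by blast
    show "\<exists>V. open V \<and> (0, 0, 0) \<in> V \<and>
        (\<forall>(x, y, z)\<in>V. affine_pt (mat 1) (x, y, z) \<in> graph_surface r \<longleftrightarrow> z = normal_form_fun r (\<lambda>_. 0) (x, y))"
      by (intro exI[of _ UNIV]) (auto simp: in_graph_surface normal_form_fun_zero)
  qed (use jet invertible_mat_1 in auto)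
  show "has_2jet (mat 1) (normal_form_fun r (\<lambda>_. 0)) (flecnodal_curve (graph_surface r)) (2 * r\<^sup>2 - r)"
    by (rule has_2jet_parabola[of 1]) (simp_all add: normal_form_fun_zero graph_flecnodal)
  show "has_2jet (mat 1) (normal_form_fun r (\<lambda>_. 0)) (parabolic_curve (graph_surface r)) (3 * r - 2)"
    by (rule has_2jet_parabola[of 1]) (simp_all add: normal_form_fun_zero graph_parabolic)
  have "has_2jet (mat 1) (normal_form_fun r (\<lambda>_. 0)) (conodal_curve (graph_surface r \<inter> W)) r"
    if W: "open W" "affine_pt (mat 1) (0, 0, 0) \<in> W" for W
  proof -
    obtain \<delta> where "0 < \<delta>" "\<And>x y. \<bar>x\<bar> < \<delta> \<Longrightarrow> \<bar>y\<bar> < \<delta> \<Longrightarrow>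
        affine_pt (mat 1) (x, y, nf_poly r (x, y)) \<in> conodal_curve (graph_surface r \<inter> W) \<longleftrightarrow> y = r * x\<^sup>2"
      using graph_conodal[OF assms W] by blast
    then show ?thesis unfolding normal_form_fun_zero by (rule has_2jet_parabola)
  qed
  then show "germ_conodal (graph_surface r) (affine_pt (mat 1) (0, 0, 0))
      (\<lambda>D. has_2jet (mat 1) (normal_form_fun r (\<lambda>_. 0)) D r)"
    unfolding germ_conodal_def by (intro exI[of _ UNIV]) auto
qed

text \<open>In this basis the affine coordinate of a line is its slope dm / du, and the fibre is the
  line at infinity, so the ratio of differences remains.\<close>

lemma contact_plane_cross_ratio:
  assumes "cP \<noteq> cD"
  shows "has_cross_ratio (contact_plane (0, 0, 0)) (span {(1, 0, 2 * cF)}) (span {(1, 0, 2 * cP)}) (span {(1, 0, 2 * cD)})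
    (span {(0, 0, 1)}) ((cF - cD) / (cP - cD))"
  unfolding has_cross_ratio_def
proof (intro exI conjI)
  let ?e = "(0, 0, 1) :: real \<times> real \<times> real" and ?f = "(1, 0, 0) :: real \<times> real \<times> real"
  show "contact_plane (0, 0, 0) = span {?e, ?f}"
  proof (intro set_eqI iffI)
    fix p assume "p \<in> contact_plane (0, 0, 0)"
    then have "p = snd (snd p) *\<^sub>R ?e + fst p *\<^sub>R ?f" by (auto simp: contact_plane_def)
    moreover have "snd (snd p) *\<^sub>R ?e + fst p *\<^sub>R ?f \<in> span {?e, ?f}"
      by (intro span_add span_scale) (auto intro: span_base)
    ultimately show "p \<in> span {?e, ?f}" by simp
  next
    fix p assume "p \<in> span {?e, ?f}"
    then obtain k l where "p - k *\<^sub>R ?e = l *\<^sub>R ?f"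
      unfolding span_breakdown_eq span_singleton by blast
    then have "p = l *\<^sub>R ?f + k *\<^sub>R ?e" by (simp only: diff_eq_eq)
    then show "p \<in> contact_plane (0, 0, 0)" by (simp add: contact_plane_def)
  qed
  show "?e \<noteq> ?f" by simp
  show "independent {?e, ?f}" by (auto simp: independent_insert span_singleton zero_prod_def)
  show "span {(1, 0, 2 * cF)} = span {fst (2 * cF, 1) *\<^sub>R ?e + snd (2 * cF, 1) *\<^sub>R ?f}" by simp
  show "span {(1, 0, 2 * cP)} = span {fst (2 * cP, 1) *\<^sub>R ?e + snd (2 * cP, 1) *\<^sub>R ?f}" by simp
  show "span {(1, 0, 2 * cD)} = span {fst (2 * cD, 1) *\<^sub>R ?e + snd (2 * cD, 1) *\<^sub>R ?f}" by simp
  show "span {(0, 0, 1)} = span {fst (1, 0) *\<^sub>R ?e + snd (1, 0) *\<^sub>R ?f}" by simp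
  show "(cF - cD) / (cP - cD) = det2 (2 * cF, 1) (2 * cD, 1) * det2 (2 * cP, 1) (1, 0) / (det2 (2 * cP, 1) (2 * cD, 1) * det2 (2 * cF, 1) (1, 0))"
    using assms by (simp add: det2_def field_simps)
qed (use assms in \<open>simp_all add: det2_def zero_prod_def\<close>)

lemma graph_cr_invariant:
  assumes "r \<noteq> 1"
  shows "is_cr_invariant (graph_surface r) (affine_pt (mat 1) (0, 0, 0)) r"
  unfolding is_cr_invariant_def
proof (intro exI conjI)
  show "surface_param (graph_surface r) (affine_pt (mat 1) (0, 0, 0)) UNIV (graph_param r)"
    by (rule surface_param_graph_param)
  show "curve_tangent (legendrian_lift (pull UNIV (graph_param r) (flecnodal_curve (graph_surface r)))) (0, 0, 0) (1, 0, 2 * (2 * r\<^sup>2 - r))"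
    by (rule legendrian_lift_parabola[of 1]) (simp_all add: pull_graph_param graph_flecnodal)
  show "curve_tangent (legendrian_lift (pull UNIV (graph_param r) (parabolic_curve (graph_surface r)))) (0, 0, 0) (1, 0, 2 * (3 * r - 2))"
    by (rule legendrian_lift_parabola[of 1]) (simp_all add: pull_graph_param graph_parabolic)
  show "curve_tangent (fibre (0, 0)) (0, 0, 0) (0, 0, 1)" by (rule fibre_curve_tangent)
  have "curve_tangent (legendrian_lift (pull UNIV (graph_param r) (conodal_curve (graph_surface r \<inter> W)))) (0, 0, 0) (1, 0, 2 * r)"
    if W: "open W" "affine_pt (mat 1) (0, 0, 0) \<in> W" for W
  proof -
    obtain \<delta> where "0 < \<delta>" "\<And>x y. \<bar>x\<bar> < \<delta> \<Longrightarrow> \<bar>y\<bar> < \<delta> \<Longrightarrow>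
        affine_pt (mat 1) (x, y, nf_poly r (x, y)) \<in> conodal_curve (graph_surface r \<inter> W) \<longleftrightarrow> y = r * x\<^sup>2"
      using graph_conodal[OF assms W] by blast
    then show ?thesis by (intro legendrian_lift_parabola[of \<delta>]) (simp_all add: pull_graph_param)
  qed
  then show "germ_conodal (graph_surface r) (affine_pt (mat 1) (0, 0, 0))
      (\<lambda>D. curve_tangent (legendrian_lift (pull UNIV (graph_param r) D)) (0, 0, 0) (1, 0, 2 * r))"
    unfolding germ_conodal_def by (intro exI[of _ UNIV]) auto
  have "r - 1 \<noteq> 0" using assms by simp
  then have "2 * (r - 1) \<noteq> 0" by (intro no_zero_divisors) simp_all
  moreover have "3 * r - 2 - r = 2 * (r - 1)" by simp
  ultimately have n0: "3 * r - 2 - r \<noteq> 0" by metis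
  then have ne: "3 * r - 2 \<noteq> r" unfolding right_minus_eq .
  have "2 * r\<^sup>2 - r - r = r * (3 * r - 2 - r)" by (simp add: power2_eq_square algebra_simps)
  then have "(2 * r\<^sup>2 - r - r) / (3 * r - 2 - r) = r"
    by (simp only: nonzero_mult_div_cancel_right[OF n0])
  then show "has_cross_ratio (contact_plane (0, 0, 0)) (span {(1, 0, 2 * (2 * r\<^sup>2 - r))}) (span {(1, 0, 2 * (3 * r - 2))})
      (span {(1, 0, 2 * r)}) (span {(0, 0, 1)}) r"
    using contact_plane_cross_ratio[OF ne, of "2 * r\<^sup>2 - r"] by simp
qed

text \<open>With v = x and u = (x^2 - y) / k, k = (r - 1) / 2, the gradient becomes k (4 v^3 + 2 u
  v) and -k u, and the negated intercept k (3 v^4 + u v^2) + k^2 u^2 / 2. These are the swallowtail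
  coordinates up to scaling and the quadratic term in u.\<close>

lemma graph_dual_swallowtail:
  assumes r: "r \<noteq> 1"
  shows "dual_swallowtail (graph_surface r) (affine_pt (mat 1) (0, 0, 0))"
proof -
  define k where "k = (r - 1) / 2"
  have k: "k \<noteq> 0" "r = 2 * k + 1" using r by (simp_all add: k_def field_simps)
  define Y where "Y q = (snd q)\<^sup>2 - k * fst q" for q :: "real \<times> real"
  \<comment> \<open>The conormal vector in terms of the three swallowtail coordinates; the quadratic
    term has zero derivative at the origin and does not affect the rank.\<close>
  define \<Phi> where "\<Phi> p = hom (mat 1) (- k * fst (snd p)) (k * fst p) 1 (k\<^sup>2 * (fst p)\<^sup>2 / 2 + k * snd (snd p))" for p :: "real \<times> real \<times> real"
  have smY: "smooth_on UNIV Y"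
    unfolding Y_def[abs_def] by (intro smooth_on_intros smooth_on_fst smooth_on_snd open_UNIV)
  have dY: "dir_deriv [v] Y q = 2 * snd q * snd v - k * fst v" for v q
  proof -
    have "(Y has_derivative (\<lambda>v. 2 * snd q * snd v - k * fst v)) (at q)"
      unfolding Y_def[abs_def] by (auto intro!: derivative_eq_intros)
    from frechet_derivative_at[OF this, symmetric] show ?thesis by simp
  qed
  have "homeomorphism UNIV UNIV (\<lambda>q. (snd q, Y q)) (\<lambda>(x, y). ((x\<^sup>2 - y) / k, x))"
    by (rule homeomorphismI) (auto simp: Y_def case_prod_beta k(1) intro!: continuous_intros)
  from graph_surface_param[OF smooth_on_snd[OF open_UNIV] smY this, of r]
  have sp: "surface_param (graph_surface r) (affine_pt (mat 1) (0, 0, 0)) UNIV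
      (\<lambda>q. hom (mat 1) (snd q) (Y q) (nf_poly r (snd q, Y q)) 1)"
    using k(1) unfolding dY dir_deriv_fst_snd by (simp add: Y_def)
  have sm\<Phi>: "smooth_on UNIV \<Phi>"
    unfolding \<Phi>_def[abs_def]
    by (intro smooth_on_hom smooth_on_intros smooth_on_fst open_UNIV
        smooth_on_linear_compose[OF open_UNIV smooth_on_snd[OF open_UNIV] bounded_linear_fst]
        smooth_on_linear_compose[OF open_UNIV smooth_on_snd[OF open_UNIV] bounded_linear_snd])
  have "(\<Phi> has_derivative (\<lambda>v. hom (mat 1) (- k * fst (snd v)) (k * fst v) 0 (k * snd (snd v)))) (at (0, 0, 0))"
    unfolding \<Phi>_def[abs_def]
    by (intro has_derivative_hom has_derivative_const) (auto intro!: derivative_eq_intros)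
  from frechet_derivative_at[OF this, symmetric]
  have D\<Phi>: "frechet_derivative \<Phi> (at (0, 0, 0)) v = hom (mat 1) (- k * fst (snd v)) (k * fst v) 0 (k * snd (snd v))" for v
    by simp
  have dim4: "dim {\<Phi> (0, 0, 0), frechet_derivative \<Phi> (at (0, 0, 0)) (1, 0, 0), frechet_derivative \<Phi> (at (0, 0, 0)) (0, 1, 0),
      frechet_derivative \<Phi> (at (0, 0, 0)) (0, 0, 1)} = 4" (is "dim ?A = 4")
  proof -
    have "w \<in> span ?A" for w
    proof -
      have A: "?A = {hom (mat 1) 0 0 1 0, hom (mat 1) 0 k 0 0, hom (mat 1) (- k) 0 0 0, hom (mat 1) 0 0 0 k}"
        unfolding D\<Phi> by (simp add: \<Phi>_def)
      have "w = hom (mat 1) (w $ 1) (w $ 2) (w $ 3) (w $ 4)"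
        using hom_coord[OF invertible_mat_1, of w] by (simp add: coord_mat1)
      also have "\<dots> = (w $ 3) *\<^sub>R hom (mat 1) 0 0 1 0 + (w $ 2 / k) *\<^sub>R hom (mat 1) 0 k 0 0 +
          (- w $ 1 / k) *\<^sub>R hom (mat 1) (- k) 0 0 0 + (w $ 4 / k) *\<^sub>R hom (mat 1) 0 0 0 k"
        using k(1) by (simp add: hom_scale hom_add)
      also have "\<dots> \<in> span ?A" unfolding A
        by (intro span_add span_scale) (auto intro: span_base)
      finally show ?thesis .
    qed
    then have "span ?A = UNIV" by auto
    then show ?thesis using dim_eq_full[of ?A] by simp
  qed
  have tm: "tangential_map (graph_surface r) (proj (hom (mat 1) (snd q) (Y q) (nf_poly r (snd q, Y q)) 1)) = proj (\<Phi> (std_swallowtail q))" for q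
  proof -
    obtain u v where q: "q = (u, v)" by (metis prod.exhaust)
    have "tangential_map (graph_surface r \<inter> UNIV) (affine_pt (mat 1) (v, Y q, nf_poly r (v, Y q))) =
        proj (vector [- (- 2 * v * Y q + 2 * r * v ^ 3), - (Y q - v\<^sup>2), 1,
          - (nf_poly r (v, Y q) - v * (- 2 * v * Y q + 2 * r * v ^ 3) - Y q * (Y q - v\<^sup>2))])"
      by (rule tangential_map_graph) auto
    moreover have "- (- 2 * v * Y q + 2 * r * v ^ 3) = - k * (4 * v ^ 3 + 2 * u * v)"
      by (simp add: q Y_def k(2) power2_eq_square power3_eq_cube algebra_simps)
    moreover have "- (Y q - v\<^sup>2) = k * u" by (simp add: q Y_def)
    moreover have "- (nf_poly r (v, Y q) - v * (- 2 * v * Y q + 2 * r * v ^ 3) - Y q * (Y q - v\<^sup>2)) =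
        k\<^sup>2 * u\<^sup>2 / 2 + k * (3 * v ^ 4 + u * v\<^sup>2)"
      by (simp add: nf_poly_eq q Y_def k(2) power2_eq_square power3_eq_cube power4_eq_xxxx field_simps)
    ultimately show ?thesis
      by (simp add: q \<Phi>_def std_swallowtail_def hom_mat1 affine_pt_hom)
  qed
  show ?thesis
    unfolding dual_swallowtail_def
    using sp sm\<Phi> dim4 tm by (intro exI[of _ UNIV] exI[of _ "\<lambda>q. hom (mat 1) (snd q) (Y q) (nf_poly r (snd q, Y q)) 1"] exI[of _ \<Phi>] conjI ballI) auto
qed

lemma graph_surface_realises:
  assumes "r \<noteq> 1"
  shows "\<exists>S g cF cP cD. smooth_surface S \<and> simple_godron S g \<and> is_cr_invariant S g r \<and> canonical_coefficients S g cF cP cD"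
  using graph_surface_smooth graph_godron graph_dual_swallowtail[OF assms] graph_cr_invariant[OF assms]
    graph_canonical_coefficients[OF assms] unfolding simple_godron_def by blast

theorem theorem5:
  shows "(\<forall>S g (\<rho>::real) c\<^sub>F c\<^sub>P c\<^sub>D.
      smooth_surface S \<and> simple_godron S g \<and> is_cr_invariant S g \<rho> \<and>
      \<rho> \<notin> {-1/2, 0, 1/2, 2/3, 1} \<and> canonical_coefficients S g c\<^sub>F c\<^sub>P c\<^sub>D \<longrightarrow>
        (\<rho> \<in> {1<..} \<longleftrightarrow> 1 < c\<^sub>D \<and> c\<^sub>D < c\<^sub>P \<and> c\<^sub>P < c\<^sub>F) \<and>
        (\<rho> \<in> {2/3<..<1} \<longleftrightarrow> 0 < c\<^sub>P \<and> c\<^sub>P < c\<^sub>F \<and> c\<^sub>F < c\<^sub>D \<and> c\<^sub>D < 1) \<and>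
        (\<rho> \<in> {1/2<..<2/3} \<longleftrightarrow> c\<^sub>P < 0 \<and> 0 < c\<^sub>F \<and> c\<^sub>F < c\<^sub>D \<and> c\<^sub>D < 1) \<and>
        (\<rho> \<in> {0<..<1/2} \<longleftrightarrow> c\<^sub>P < c\<^sub>F \<and> c\<^sub>F < 0 \<and> 0 < c\<^sub>D \<and> c\<^sub>D < 1) \<and>
        (\<rho> \<in> {-1/2<..<0} \<longleftrightarrow> c\<^sub>P < c\<^sub>D \<and> c\<^sub>D < 0 \<and> 0 < c\<^sub>F \<and> c\<^sub>F < 1) \<and>
        (\<rho> \<in> {..<-1/2} \<longleftrightarrow> c\<^sub>P < c\<^sub>D \<and> c\<^sub>D < 0 \<and> 1 < c\<^sub>F)) \<and>
    (\<forall>I \<in> {{1<..}, {2/3<..<1}, {1/2<..<2/3}, {0<..<1/2}, {-1/2<..<0}, {..<-1/2}}.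
      \<exists>S g. \<exists>\<rho>\<in>I. \<exists>c\<^sub>F c\<^sub>P c\<^sub>D.
        smooth_surface S \<and> simple_godron S g \<and> is_cr_invariant S g \<rho> \<and>
        canonical_coefficients S g c\<^sub>F c\<^sub>P c\<^sub>D)"
\<comment> \<open>The explicit pattern splits only the outer conjunction; the six equivalences stay
  together to match \<open>configuration_intervals\<close>.\<close>
proof (intro conjI[of "\<forall>S g \<rho> c\<^sub>F c\<^sub>P c\<^sub>D. _ S g \<rho> c\<^sub>F c\<^sub>P c\<^sub>D"] allI impI ballI, goal_cases)
  case (1 S g \<rho> c\<^sub>F c\<^sub>P c\<^sub>D)
  then have "\<rho> \<noteq> 1" by blast
  with 1 show ?case
    by (intro configuration_intervals) (auto dest: coefficients_from_cr_invariant)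
next
  case (2 I)
  have "\<exists>\<rho>\<in>I. \<rho> \<noteq> 1"
  proof -
    \<comment> \<open>Any value different from 1 is realised by a graph, so one sample point per
      interval suffices.\<close>
    have w: "\<exists>\<rho>\<in>{1::real<..}. \<rho> \<noteq> 1" "\<exists>\<rho>\<in>{2/3::real<..<1}. \<rho> \<noteq> 1" "\<exists>\<rho>\<in>{1/2::real<..<2/3}. \<rho> \<noteq> 1"
      "\<exists>\<rho>\<in>{0::real<..<1/2}. \<rho> \<noteq> 1" "\<exists>\<rho>\<in>{-1/2::real<..<0}. \<rho> \<noteq> 1" "\<exists>\<rho>\<in>{..<-1/2::real}. \<rho> \<noteq> 1"
      by (rule bexI[of _ 2], simp, simp, rule bexI[of _ "3/4"], simp, simp, rule bexI[of _ "7/12"], simp, simp,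
          rule bexI[of _ "1/4"], simp, simp, rule bexI[of _ "-1/4"], simp, simp, rule bexI[of _ "-1"], simp, simp)
    show ?thesis using 2 by (elim insertE emptyE) (simp_all only: w)
  qed
  then show ?case using graph_surface_realises by metis
qed

end
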